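(* Let $R$ be a commutative ring and $\delta\in R$. There are categories $\mathcal C_{\mathrm{TL}}$, $\mathcal C_{\mathrm{Br}}$, and $\mathcal C_P$ enriched in $R$-modules whose objects are the nonnegative integers and whose morphisms are given by $$\mathrm{Hom}_{\mathcal C_{\mathrm{TL}}}(m,n)=\mathrm{TL}_n\otimes_{\mathrm{TL}_{n-m}}R,$$ $$\mathrm{Hom}_{\mathcal C_{\mathrm{Br}}}(m,n)=\mathrm{Br}_n\otimes_{\mathrm{Br}_{n-m}}R,$$ $$\mathrm{Hom}_{\mathcal C_P}(m,n)=P_n\otimes_{P_{n-m}}R$$ if $m\le n$, where $A_{n-m}\subset A_n$ by the right embedding (for $A=\mathrm{TL},\mathrm{Br},P$ respectively) and $R$ is the trivial $A_{n-m}$-module, and $$\mathrm{Hom}_{\mathcal C_{\mathrm{TL}}}(m,n)=\mathrm{Hom}_{\mathcal C_{\mathrm{Br}}}(m,n)=\mathrm{Hom}_{\mathcal C_P}(m,n)=0$$ if $m>n$. (The category associated to the sequence $(A_n)_{n\in\mathbb N}$ is denoted $\mathcal C_A$.)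
   Context: $\mathbb N=\{0,1,2,\dots\}$, $[n]=\{1,\dots,n\}$, $[-n]=\{-n,\dots,-1\}$. $(A_n)_{n\in\mathbb N}$ stands for any one of the three sequences of algebras $(\mathrm{TL}_n)_{n\in\mathbb N}$, $(\mathrm{Br}_n)_{n\in\mathbb N}$, $(P_n)_{n\in\mathbb N}$, defined as follows. A diagram on $n$ is a set partition of $[-n]\cup[n]$, pictured with dots $-1,\dots,-n$ on the left and $1,\dots,n$ on the right (from top to bottom). The partition algebra $P_n=P_n(R,\delta)$ is the free $R$-module on these diagrams. The product $pr$ of two diagrams is obtained by placing $p$ to the left of $r$, identifying dot $k$ of $p$ with dot $-k$ of $r$ and connecting blocks; if $s$ is the resulting partition of the outer dots and $c$ blocks lie entirely in the middle, then $pr=\delta^c s$. The Brauer algebra $\mathrm{Br}_n=\mathrm{Br}_n(R,\delta)\subset P_n$ is spanned by the diagrams all of whose blocks have exactly two elements; the Temperley--Lieb algebra $\mathrm{TL}_n=\mathrm{TL}_n(R,\delta)\subset\mathrm{Br}_n$ is spanned by those among them having no two blocks $\{a,b\},\{c,d\}$ with $a<c<b<d$. Putting a diagram on $a$ nodes on top of a diagram on $b$ nodes gives an algebra embedding $A_a\otimes A_b\hookrightarrow A_{a+b}$. The right embedding $A_b\hookrightarrow A_{a+b}$ is $d\mapsto 1\otimes d$ followed by this map. The trivial $A_k$-module $R$ is the module on which all invertible diagrams (i.e. permutations: all blocks of the form $\{-i,j\}$ with $i,j\in[k]$) act as the identity and all other diagrams act as $0$. *)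

theory Defs
  imports "HOL-Algebra.Module" "HOL-Algebra.AbelCoset" "HOL-Library.Disjoint_Sets"
begin

section \<open>Modules over a commutative ring\<close>

text \<open>
  Modules and algebras over \<open>R\<close> are records of type \<open>('r, 'm) module\<close>. For a mere module the
  fields \<open>mult\<close> and \<open>one\<close> carry no information; for an algebra they are its multiplication
  and its unit.
\<close>

definition free_module :: "('r, 'x) ring_scheme \<Rightarrow> 's set \<Rightarrow> ('r, 's \<Rightarrow> 'r) module" where
  "free_module R S =
     \<lparr>carrier = {x. (\<forall>s\<in>S. x s \<in> carrier R) \<and> (\<forall>s. s \<notin> S \<longrightarrow> x s = \<zero>\<^bsub>R\<^esub>)
                    \<and> finite {s. x s \<noteq> \<zero>\<^bsub>R\<^esub>}},
      mult = undefined, one = undefined,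
      zero = (\<lambda>s. \<zero>\<^bsub>R\<^esub>), add = (\<lambda>x y s. x s \<oplus>\<^bsub>R\<^esub> y s),
      smult = (\<lambda>a x s. a \<otimes>\<^bsub>R\<^esub> x s)\<rparr>"

definition basis_vec :: "('r, 'x) ring_scheme \<Rightarrow> 's \<Rightarrow> 's \<Rightarrow> 'r" where
  "basis_vec R s = (\<lambda>t. if t = s then \<one>\<^bsub>R\<^esub> else \<zero>\<^bsub>R\<^esub>)"

definition module_span ::
    "('r, 'x) ring_scheme \<Rightarrow> ('r, 'm, 'y) module_scheme \<Rightarrow> 'm set \<Rightarrow> 'm set" where
  "module_span R M S = \<Inter>{H. submodule H R M \<and> S \<subseteq> H}"

definition quotient_module ::
    "('r, 'm, 'y) module_scheme \<Rightarrow> 'm set \<Rightarrow> ('r, 'm set) module" where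
  "quotient_module M N =
     \<lparr>carrier = a_rcosets\<^bsub>M\<^esub> N, mult = undefined, one = undefined,
      zero = N, add = set_add M,
      smult = (\<lambda>a X. \<Union>x\<in>X. N +>\<^bsub>M\<^esub> (a \<odot>\<^bsub>M\<^esub> x))\<rparr>"

definition zero_module :: "('r, 'm) module" where
  "zero_module =
     \<lparr>carrier = {undefined}, mult = undefined, one = undefined,
      zero = undefined, add = (\<lambda>_ _. undefined), smult = (\<lambda>_ _. undefined)\<rparr>"

definition ring_as_module :: "('r, 'x) ring_scheme \<Rightarrow> ('r, 'r) module" where
  "ring_as_module R =
     \<lparr>carrier = carrier R, mult = mult R, one = one R,
      zero = zero R, add = add R, smult = mult R\<rparr>"

subsection \<open>Tensor products over an algebra\<close>

text \<open>
  \<open>M \<otimes>\<^sub>A N\<close> for an \<open>R\<close>-algebra \<open>A\<close>, a right \<open>A\<close>-module \<open>M\<close> with action \<open>rho\<close> and a left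
  \<open>A\<close>-module \<open>N\<close> with action \<open>lam\<close>, as the quotient of the free \<open>R\<close>-module on pairs.
\<close>

definition tensor_relations ::
    "('r, 'x) ring_scheme \<Rightarrow> ('r, 'a, 'z) module_scheme
     \<Rightarrow> ('r, 'm, 'y) module_scheme \<Rightarrow> ('m \<Rightarrow> 'a \<Rightarrow> 'm)
     \<Rightarrow> ('r, 'n, 'w) module_scheme \<Rightarrow> ('a \<Rightarrow> 'n \<Rightarrow> 'n) \<Rightarrow> ('m \<times> 'n \<Rightarrow> 'r) set" where
  "tensor_relations R A M rho N lam =
    (let F = free_module R (carrier M \<times> carrier N); e = basis_vec R in
      {e (x \<oplus>\<^bsub>M\<^esub> x', y) \<ominus>\<^bsub>F\<^esub> (e (x, y) \<oplus>\<^bsub>F\<^esub> e (x', y)) | x x' y.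
         x \<in> carrier M \<and> x' \<in> carrier M \<and> y \<in> carrier N}
      \<union> {e (x, y \<oplus>\<^bsub>N\<^esub> y') \<ominus>\<^bsub>F\<^esub> (e (x, y) \<oplus>\<^bsub>F\<^esub> e (x, y')) | x y y'.
         x \<in> carrier M \<and> y \<in> carrier N \<and> y' \<in> carrier N}
      \<union> {e (r \<odot>\<^bsub>M\<^esub> x, y) \<ominus>\<^bsub>F\<^esub> (r \<odot>\<^bsub>F\<^esub> e (x, y)) | r x y.
         r \<in> carrier R \<and> x \<in> carrier M \<and> y \<in> carrier N}
      \<union> {e (x, r \<odot>\<^bsub>N\<^esub> y) \<ominus>\<^bsub>F\<^esub> (r \<odot>\<^bsub>F\<^esub> e (x, y)) | r x y.
         r \<in> carrier R \<and> x \<in> carrier M \<and> y \<in> carrier N}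
      \<union> {e (rho x a, y) \<ominus>\<^bsub>F\<^esub> e (x, lam a y) | a x y.
         a \<in> carrier A \<and> x \<in> carrier M \<and> y \<in> carrier N})"

definition tensor_kernel ::
    "('r, 'x) ring_scheme \<Rightarrow> ('r, 'a, 'z) module_scheme
     \<Rightarrow> ('r, 'm, 'y) module_scheme \<Rightarrow> ('m \<Rightarrow> 'a \<Rightarrow> 'm)
     \<Rightarrow> ('r, 'n, 'w) module_scheme \<Rightarrow> ('a \<Rightarrow> 'n \<Rightarrow> 'n) \<Rightarrow> ('m \<times> 'n \<Rightarrow> 'r) set" where
  "tensor_kernel R A M rho N lam =
     module_span R (free_module R (carrier M \<times> carrier N)) (tensor_relations R A M rho N lam)"

definition tensor_product ::
    "('r, 'x) ring_scheme \<Rightarrow> ('r, 'a, 'z) module_scheme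
     \<Rightarrow> ('r, 'm, 'y) module_scheme \<Rightarrow> ('m \<Rightarrow> 'a \<Rightarrow> 'm)
     \<Rightarrow> ('r, 'n, 'w) module_scheme \<Rightarrow> ('a \<Rightarrow> 'n \<Rightarrow> 'n)
     \<Rightarrow> ('r, ('m \<times> 'n \<Rightarrow> 'r) set) module" where
  "tensor_product R A M rho N lam =
     quotient_module (free_module R (carrier M \<times> carrier N)) (tensor_kernel R A M rho N lam)"

definition pure_tensor ::
    "('r, 'x) ring_scheme \<Rightarrow> ('r, 'a, 'z) module_scheme
     \<Rightarrow> ('r, 'm, 'y) module_scheme \<Rightarrow> ('m \<Rightarrow> 'a \<Rightarrow> 'm)
     \<Rightarrow> ('r, 'n, 'w) module_scheme \<Rightarrow> ('a \<Rightarrow> 'n \<Rightarrow> 'n)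
     \<Rightarrow> 'm \<Rightarrow> 'n \<Rightarrow> ('m \<times> 'n \<Rightarrow> 'r) set" where
  "pure_tensor R A M rho N lam x y =
     tensor_kernel R A M rho N lam
       +>\<^bsub>free_module R (carrier M \<times> carrier N)\<^esub> basis_vec R (x, y)"

section \<open>Categories enriched in modules\<close>

text \<open>
  \<open>cmp l m n f g\<close> is the composite \<open>f \<circ> g : l \<rightarrow> n\<close> of \<open>g : l \<rightarrow> m\<close> and \<open>f : m \<rightarrow> n\<close>.
\<close>

locale module_enriched_category =
  fixes R :: "('r, 'x) ring_scheme"
    and Ob :: "'o set"
    and Hom :: "'o \<Rightarrow> 'o \<Rightarrow> ('r, 'h, 'y) module_scheme"
    and cmp :: "'o \<Rightarrow> 'o \<Rightarrow> 'o \<Rightarrow> 'h \<Rightarrow> 'h \<Rightarrow> 'h"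
    and ident :: "'o \<Rightarrow> 'h"
  assumes Hom_module: "\<lbrakk>m \<in> Ob; n \<in> Ob\<rbrakk> \<Longrightarrow> module R (Hom m n)"
    and cmp_closed:
      "\<lbrakk>l \<in> Ob; m \<in> Ob; n \<in> Ob; f \<in> carrier (Hom m n); g \<in> carrier (Hom l m)\<rbrakk>
       \<Longrightarrow> cmp l m n f g \<in> carrier (Hom l n)"
    and cmp_add_left:
      "\<lbrakk>l \<in> Ob; m \<in> Ob; n \<in> Ob; f \<in> carrier (Hom m n); f' \<in> carrier (Hom m n);
        g \<in> carrier (Hom l m)\<rbrakk>
       \<Longrightarrow> cmp l m n (f \<oplus>\<^bsub>Hom m n\<^esub> f') g = cmp l m n f g \<oplus>\<^bsub>Hom l n\<^esub> cmp l m n f' g"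
    and cmp_add_right:
      "\<lbrakk>l \<in> Ob; m \<in> Ob; n \<in> Ob; f \<in> carrier (Hom m n); g \<in> carrier (Hom l m);
        g' \<in> carrier (Hom l m)\<rbrakk>
       \<Longrightarrow> cmp l m n f (g \<oplus>\<^bsub>Hom l m\<^esub> g') = cmp l m n f g \<oplus>\<^bsub>Hom l n\<^esub> cmp l m n f g'"
    and cmp_smult_left:
      "\<lbrakk>l \<in> Ob; m \<in> Ob; n \<in> Ob; r \<in> carrier R; f \<in> carrier (Hom m n); g \<in> carrier (Hom l m)\<rbrakk>
       \<Longrightarrow> cmp l m n (r \<odot>\<^bsub>Hom m n\<^esub> f) g = r \<odot>\<^bsub>Hom l n\<^esub> cmp l m n f g"
    and cmp_smult_right:
      "\<lbrakk>l \<in> Ob; m \<in> Ob; n \<in> Ob; r \<in> carrier R; f \<in> carrier (Hom m n); g \<in> carrier (Hom l m)\<rbrakk>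
       \<Longrightarrow> cmp l m n f (r \<odot>\<^bsub>Hom l m\<^esub> g) = r \<odot>\<^bsub>Hom l n\<^esub> cmp l m n f g"
    and cmp_assoc:
      "\<lbrakk>k \<in> Ob; l \<in> Ob; m \<in> Ob; n \<in> Ob; f \<in> carrier (Hom m n); g \<in> carrier (Hom l m);
        h \<in> carrier (Hom k l)\<rbrakk>
       \<Longrightarrow> cmp k m n f (cmp k l m g h) = cmp k l n (cmp l m n f g) h"
    and ident_closed: "n \<in> Ob \<Longrightarrow> ident n \<in> carrier (Hom n n)"
    and ident_left:
      "\<lbrakk>m \<in> Ob; n \<in> Ob; f \<in> carrier (Hom m n)\<rbrakk> \<Longrightarrow> cmp m n n (ident n) f = f"
    and ident_right:
      "\<lbrakk>m \<in> Ob; n \<in> Ob; f \<in> carrier (Hom m n)\<rbrakk> \<Longrightarrow> cmp m m n f (ident m) = f"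

section \<open>Diagrams\<close>

type_synonym diagram = "int set set"

definition dots :: "nat \<Rightarrow> int set" where
  "dots n = {- int n .. -1} \<union> {1 .. int n}"

definition diagrams :: "nat \<Rightarrow> diagram set" where
  "diagrams n = {d. partition_on (dots n) d}"

definition brauer_diagrams :: "nat \<Rightarrow> diagram set" where
  "brauer_diagrams n = {d \<in> diagrams n. \<forall>B\<in>d. card B = 2}"

definition tl_diagrams :: "nat \<Rightarrow> diagram set" where
  "tl_diagrams n = {p \<in> brauer_diagrams n.
     \<not> (\<exists>a b c d. {a, b} \<in> p \<and> {c, d} \<in> p \<and> a < c \<and> c < b \<and> b < d)}"

definition id_diagram :: "nat \<Rightarrow> diagram" where
  "id_diagram n = {{- i, i} | i. i \<in> {1 .. int n}}"

definition permutation_diagram :: "nat \<Rightarrow> diagram \<Rightarrow> bool" where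
  "permutation_diagram k d \<longleftrightarrow>
     d \<in> diagrams k \<and> (\<forall>B\<in>d. \<exists>i\<in>{1 .. int k}. \<exists>j\<in>{1 .. int k}. B = {- i, j})"

subsection \<open>Composition of diagrams\<close>

text \<open>
  To form \<open>p r\<close>, the dots are put in three columns 0, 1, 2, a dot of the picture being a pair
  (column, height): the dots of \<open>p\<close> go to the columns 0 and 1, those of \<open>r\<close> to the columns
  1 and 2, so that dot \<open>k\<close> of \<open>p\<close> and dot \<open>-k\<close> of \<open>r\<close> both become \<open>(1, k)\<close>.
\<close>

definition place :: "nat \<Rightarrow> int \<Rightarrow> nat \<times> nat" where
  "place c i = (if i < 0 then c else Suc c, nat \<bar>i\<bar>)"

definition stacked_blocks :: "diagram \<Rightarrow> diagram \<Rightarrow> (nat \<times> nat) set set" where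
  "stacked_blocks p r = (\<lambda>B. place 0 ` B) ` p \<union> (\<lambda>B. place 1 ` B) ` r"

definition connected_rel :: "'v set set \<Rightarrow> ('v \<times> 'v) set" where
  "connected_rel Bs = {(u, v). \<exists>B\<in>Bs. u \<in> B \<and> v \<in> B}\<^sup>+"

definition components :: "'v set set \<Rightarrow> 'v set set" where
  "components Bs = \<Union>Bs // connected_rel Bs"

definition outer_dots :: "(nat \<times> nat) set \<Rightarrow> int set" where
  "outer_dots C = {i. (if i < 0 then 0 else 2, nat \<bar>i\<bar>) \<in> C}"

definition diagram_comp :: "diagram \<Rightarrow> diagram \<Rightarrow> diagram" where
  "diagram_comp p r = outer_dots ` components (stacked_blocks p r) - {{}}"

definition middle_count :: "diagram \<Rightarrow> diagram \<Rightarrow> nat" where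
  "middle_count p r = card {C \<in> components (stacked_blocks p r). C \<subseteq> {1} \<times> UNIV}"

subsection \<open>Putting a diagram on top of another one\<close>

definition shift_dot :: "nat \<Rightarrow> int \<Rightarrow> int" where
  "shift_dot a i = (if i < 0 then i - int a else i + int a)"

definition diagram_on_top :: "nat \<Rightarrow> diagram \<Rightarrow> diagram \<Rightarrow> diagram" where
  "diagram_on_top a p q = p \<union> (\<lambda>B. shift_dot a ` B) ` q"

section \<open>Diagram algebras\<close>

definition partition_algebra ::
    "('r, 'x) ring_scheme \<Rightarrow> 'r \<Rightarrow> nat \<Rightarrow> ('r, diagram \<Rightarrow> 'r) module" where
  "partition_algebra R \<delta> n =
     (free_module R (diagrams n))
       \<lparr>mult := (\<lambda>x y s. finsum R
                   (\<lambda>(p, r). (x p \<otimes>\<^bsub>R\<^esub> y r) \<otimes>\<^bsub>R\<^esub> (\<delta> [^]\<^bsub>R\<^esub> middle_count p r))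
                   {(p, r). p \<in> diagrams n \<and> r \<in> diagrams n \<and> diagram_comp p r = s}),
        one := basis_vec R (id_diagram n)\<rparr>"

definition brauer_algebra ::
    "('r, 'x) ring_scheme \<Rightarrow> 'r \<Rightarrow> nat \<Rightarrow> ('r, diagram \<Rightarrow> 'r) module" where
  "brauer_algebra R \<delta> n =
     (partition_algebra R \<delta> n)
       \<lparr>carrier := module_span R (partition_algebra R \<delta> n) (basis_vec R ` brauer_diagrams n)\<rparr>"

definition temperley_lieb_algebra ::
    "('r, 'x) ring_scheme \<Rightarrow> 'r \<Rightarrow> nat \<Rightarrow> ('r, diagram \<Rightarrow> 'r) module" where
  "temperley_lieb_algebra R \<delta> n =
     (partition_algebra R \<delta> n)
       \<lparr>carrier := module_span R (partition_algebra R \<delta> n) (basis_vec R ` tl_diagrams n)\<rparr>"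

text \<open>
  The bilinear extension of \<open>diagram_on_top a\<close> to \<open>P\<^sub>a \<times> P\<^sub>b\<close>, that is, the map
  \<open>P\<^sub>a \<otimes> P\<^sub>b \<rightarrow> P\<^sub>a\<^sub>+\<^sub>b\<close> evaluated on \<open>x \<otimes> y\<close>.
\<close>

definition on_top ::
    "('r, 'x) ring_scheme \<Rightarrow> nat \<Rightarrow> nat
     \<Rightarrow> (diagram \<Rightarrow> 'r) \<Rightarrow> (diagram \<Rightarrow> 'r) \<Rightarrow> diagram \<Rightarrow> 'r" where
  "on_top R a b x y =
     (\<lambda>s. finsum R (\<lambda>(p, q). x p \<otimes>\<^bsub>R\<^esub> y q)
            {(p, q). p \<in> diagrams a \<and> q \<in> diagrams b \<and> diagram_on_top a p q = s})"

section \<open>The categories associated to a sequence of diagram algebras\<close>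

context
  fixes R :: "('r, 'x) ring_scheme" and A :: "nat \<Rightarrow> ('r, diagram \<Rightarrow> 'r) module"
begin

definition right_embedding :: "nat \<Rightarrow> nat \<Rightarrow> (diagram \<Rightarrow> 'r) \<Rightarrow> diagram \<Rightarrow> 'r" where
  "right_embedding a b y = on_top R a b \<one>\<^bsub>A a\<^esub> y"

text \<open>The right action of \<open>A\<^sub>n\<^sub>-\<^sub>m\<close> on \<open>A\<^sub>n\<close> through the right embedding.\<close>

definition restricted_action ::
    "nat \<Rightarrow> nat \<Rightarrow> (diagram \<Rightarrow> 'r) \<Rightarrow> (diagram \<Rightarrow> 'r) \<Rightarrow> diagram \<Rightarrow> 'r" where
  "restricted_action m n x d = x \<otimes>\<^bsub>A n\<^esub> right_embedding m (n - m) d"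

definition trivial_action :: "nat \<Rightarrow> (diagram \<Rightarrow> 'r) \<Rightarrow> 'r \<Rightarrow> 'r" where
  "trivial_action k a x =
     (\<Oplus>\<^bsub>R\<^esub>d\<in>diagrams k. a d \<otimes>\<^bsub>R\<^esub> (if permutation_diagram k d then x else \<zero>\<^bsub>R\<^esub>))"

definition cat_hom :: "nat \<Rightarrow> nat \<Rightarrow> ('r, ((diagram \<Rightarrow> 'r) \<times> 'r \<Rightarrow> 'r) set) module" where
  "cat_hom m n =
     (if m \<le> n
      then tensor_product R (A (n - m)) (A n) (restricted_action m n)
             (ring_as_module R) (trivial_action (n - m))
      else zero_module)"

text \<open>The morphism \<open>x \<otimes> r\<close> from \<open>m\<close> to \<open>n\<close>, for \<open>m \<le> n\<close>.\<close>

definition cat_tensor ::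
    "nat \<Rightarrow> nat \<Rightarrow> (diagram \<Rightarrow> 'r) \<Rightarrow> 'r \<Rightarrow> ((diagram \<Rightarrow> 'r) \<times> 'r \<Rightarrow> 'r) set" where
  "cat_tensor m n x r =
     pure_tensor R (A (n - m)) (A n) (restricted_action m n)
       (ring_as_module R) (trivial_action (n - m)) x r"

end

end

theory Submission
  imports Defs
begin

text \<open>
  The composite of \<open>x \<otimes> r\<close> and \<open>y \<otimes> s\<close> is \<open>x (y \<otimes> 1) \<otimes> rs\<close>. It is well defined because, for \<open>d\<close>
  in \<open>A\<^sub>n\<^sub>-\<^sub>m\<close>, the element \<open>1 \<otimes> d\<close> commutes with \<open>y \<otimes> 1\<close> and stays in the image of \<open>A\<^sub>n\<^sub>-\<^sub>l\<close>, while
  for \<open>d\<close> in \<open>A\<^sub>m\<^sub>-\<^sub>l\<close> one has \<open>(1 \<otimes> d) \<otimes> 1 = 1 \<otimes> (d \<otimes> 1)\<close>; adding identity strands to a diagram does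
  not change whether it is a permutation. As every element of \<open>A\<^sub>n \<otimes> R\<close> has the form \<open>x \<otimes> 1\<close>, the
  category axioms reduce to associativity and units in \<open>A\<^sub>n\<close> and the interchange law for stacking.

  These laws for diagrams all come from one principle: eliminating two sets of dots from a picture
  may be done one after the other, provided the blocks added in between avoid the dots eliminated
  first. Closure of the Brauer and Temperley--Lieb diagrams under composition follows by gluing one
  pair of adjacent dots at a time.
\<close>

section \<open>Components and elimination of vertices\<close>

text \<open>Morphisms are cosets in a free module on pairs, so a composite can only be defined
  through chosen representatives in \<open>A n\<close>. What must be controlled is when two elements
  represent the same morphism. The kernel of x \<mapsto> x \<otimes> 1 is shown to be exactly the
  submodule generated by the elements x(1 \<otimes> d) - \<epsilon>(d)x, where \<epsilon> is the
  character of the trivial module. Well-definedness then says that composition respects these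
  submodules in each argument, which is checked on generators. The inclusion from equal cosets to
  the submodule needs a map out of the tensor product and rests on the universal property of the
  free module.

  The three sequences are handled at once: any family of diagrams that contains the identities and
  is closed under composition and stacking will do. Of the closure properties, planarity of a
  composite is the delicate one, because the eliminated column lies inside the picture. The order -n
  < ... < -1 < 1 < ... < n runs along the boundary of a diagram; with \<open>p\<close> to the left
  of \<open>r\<close> on one line, dot n of \<open>p\<close> and dot -n of \<open>r\<close> become
  neighbours, and each gluing exposes the next pair.\<close>

lemma equiv_connected_rel: "equiv (\<Union>Bs) (connected_rel Bs)"
proof (rule equivI)
  have "(u, v) \<in> connected_rel Bs \<Longrightarrow> u \<in> \<Union>Bs \<and> v \<in> \<Union>Bs" for u v
    unfolding connected_rel_def by (induction rule: trancl_induct) auto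
  then show "connected_rel Bs \<subseteq> \<Union>Bs \<times> \<Union>Bs" by auto
  show "refl_on (\<Union>Bs) (connected_rel Bs)"
    unfolding connected_rel_def by (auto intro!: refl_onI)
  show "sym (connected_rel Bs)"
    unfolding connected_rel_def by (rule sym_trancl) (auto simp: sym_def)
  show "trans (connected_rel Bs)" by (simp add: connected_rel_def)
qed

lemma connected_rel_trans:
  "\<lbrakk>(u, v) \<in> connected_rel Bs; (v, w) \<in> connected_rel Bs\<rbrakk> \<Longrightarrow> (u, w) \<in> connected_rel Bs"
  unfolding connected_rel_def by (rule trancl_trans)

lemma connected_rel_sym: "(u, v) \<in> connected_rel Bs \<Longrightarrow> (v, u) \<in> connected_rel Bs"
  using equiv_connected_rel[of Bs] by (simp add: equiv_def sym_def)

lemma connected_rel_refl: "u \<in> \<Union>Bs \<Longrightarrow> (u, u) \<in> connected_rel Bs"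
  using equiv_connected_rel[of Bs] unfolding equiv_def refl_on_def by blast

lemma connected_rel_Union: "(u, v) \<in> connected_rel Bs \<Longrightarrow> u \<in> \<Union>Bs"
  using equiv_connected_rel[of Bs] by (auto simp: equiv_def)

lemma connected_rel_block: "\<lbrakk>B \<in> Bs; u \<in> B; v \<in> B\<rbrakk> \<Longrightarrow> (u, v) \<in> connected_rel Bs"
  unfolding connected_rel_def by blast

lemma connected_rel_mono: "As \<subseteq> Bs \<Longrightarrow> connected_rel As \<subseteq> connected_rel Bs"
  unfolding connected_rel_def by (rule subsetI) (auto elim!: trancl_mono)

lemma connected_rel_induct [consumes 1, case_names base step]:
  assumes "(u, v) \<in> connected_rel Bs"
    and "u \<in> \<Union>Bs \<Longrightarrow> P u"
    and "\<And>B y z. \<lbrakk>(u, y) \<in> connected_rel Bs; P y; B \<in> Bs; y \<in> B; z \<in> B\<rbrakk> \<Longrightarrow> P z"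
  shows "P v"
proof -
  have u: "u \<in> \<Union>Bs"
    using assms(1) by (rule connected_rel_Union)
  from assms(1) show ?thesis
    unfolding connected_rel_def
  proof (induction rule: trancl_induct)
    case (base y)
    then show ?case using assms(2)[OF u] assms(3) connected_rel_refl[OF u] by blast
  next
    case (step y z)
    then show ?case using assms(3) unfolding connected_rel_def by blast
  qed
qed

lemma partition_on_components: "partition_on (\<Union>Bs) (components Bs)"
  unfolding components_def by (intro partition_on_quotient equiv_connected_rel)

lemma Union_components [simp]: "\<Union>(components Bs) = \<Union>Bs"
  using partition_on_components[of Bs] by (simp add: partition_on_def)

lemma component_nonempty: "C \<in> components Bs \<Longrightarrow> \<exists>u. u \<in> C"
  using partition_on_components[of Bs] unfolding partition_on_def by (metis ex_in_conv)

lemma partition_on_eqI: "\<lbrakk>partition_on V P; B \<in> P; C \<in> P; x \<in> B; x \<in> C\<rbrakk> \<Longrightarrow> B = C"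
  unfolding partition_on_def disjoint_def by blast

lemma partition_on_cover: "partition_on V P \<Longrightarrow> x \<in> V \<Longrightarrow> \<exists>B\<in>P. x \<in> B"
  by (auto simp: partition_on_def)

lemma partition_on_Un:
  assumes "partition_on V P" "partition_on W Q" "V \<inter> W = {}"
  shows "partition_on (V \<union> W) (P \<union> Q)"
proof (rule partition_onI)
  show "disjnt p q" if "p \<in> P \<union> Q" "q \<in> P \<union> Q" "p \<noteq> q" for p q
  proof -
    have "\<And>B. B \<in> P \<Longrightarrow> B \<subseteq> V" "\<And>B. B \<in> Q \<Longrightarrow> B \<subseteq> W"
      using assms by (auto simp: partition_on_def)
    then have "disjnt B C" if "B \<in> P" "C \<in> Q" for B C using that assms(3) unfolding disjnt_def by blast
    moreover have "disjnt B C" if "B \<in> P" "C \<in> P" "B \<noteq> C" for B C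
      using that assms(1) by (auto simp: partition_on_def pairwise_def)
    moreover have "disjnt B C" if "B \<in> Q" "C \<in> Q" "B \<noteq> C" for B C
      using that assms(2) by (auto simp: partition_on_def pairwise_def)
    ultimately show ?thesis using that by (metis Un_iff disjnt_sym)
  qed
qed (use assms in \<open>auto simp: partition_on_def\<close>)

lemma component_connected: "\<lbrakk>C \<in> components Bs; u \<in> C; v \<in> C\<rbrakk> \<Longrightarrow> (u, v) \<in> connected_rel Bs"
  unfolding components_def quotient_def
  by (auto intro: connected_rel_trans connected_rel_sym)

lemma component_closed: "\<lbrakk>C \<in> components Bs; u \<in> C; (u, v) \<in> connected_rel Bs\<rbrakk> \<Longrightarrow> v \<in> C"
  unfolding components_def quotient_def by (auto intro: connected_rel_trans)

lemma block_subset_component: "\<lbrakk>B \<in> Bs; B \<noteq> {}\<rbrakk> \<Longrightarrow> \<exists>C\<in>components Bs. B \<subseteq> C"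
proof -
  assume B: "B \<in> Bs" "B \<noteq> {}"
  then obtain u where u: "u \<in> B" by blast
  then obtain C where "C \<in> components Bs" "u \<in> C"
    using B Union_components[of Bs] by blast
  then show ?thesis using component_closed connected_rel_block[OF B(1) u] by (metis subsetI)
qed

lemma components_subset_component:
  assumes "As \<subseteq> Bs" "E \<in> components As"
  shows "\<exists>C\<in>components Bs. E \<subseteq> C"
proof -
  obtain u where u: "u \<in> E"
    using component_nonempty[OF assms(2)] ..
  then have "u \<in> \<Union>Bs" using assms Union_components[of As] by blast
  then obtain C where "C \<in> components Bs" "u \<in> C" using Union_components[of Bs] by blast
  then show ?thesis
    using component_closed component_connected[OF assms(2) u] connected_rel_mono[OF assms(1)]
    by (metis subsetI subsetD)
qed

text \<open>The first condition makes every class a union of components, the second makes it no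
  larger than one. All explicit computations of components below go through this criterion.\<close>

lemma components_eqI:
  assumes D: "partition_on (\<Union>Bs) D"
    and refines: "\<And>B. B \<in> Bs \<Longrightarrow> B \<noteq> {} \<Longrightarrow> \<exists>C\<in>D. B \<subseteq> C"
    and conn: "\<And>C u v. \<lbrakk>C \<in> D; u \<in> C; v \<in> C\<rbrakk> \<Longrightarrow> (u, v) \<in> connected_rel Bs"
  shows "components Bs = D"
proof -
  have rel: "(u, v) \<in> connected_rel Bs \<longleftrightarrow> (\<exists>C\<in>D. u \<in> C \<and> v \<in> C)" for u v
  proof
    assume "(u, v) \<in> connected_rel Bs"
    then show "\<exists>C\<in>D. u \<in> C \<and> v \<in> C"
    proof (induction rule: connected_rel_induct)
      case base
      then show ?case using partition_on_cover[OF D] by blast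
    next
      case (step B y z)
      then obtain C C' where "C \<in> D" "u \<in> C" "y \<in> C" "C' \<in> D" "B \<subseteq> C'" using refines by blast
      then show ?case using partition_on_eqI[OF D, of C C' y] step by blast
    qed
  qed (use conn in blast)
  then have "connected_rel Bs = {(x, y). \<exists>p\<in>D. x \<in> p \<and> y \<in> p}" by auto
  then show ?thesis unfolding components_def using partition_on_eq_quotient[OF D] by simp
qed

lemma components_partition: "partition_on V P \<Longrightarrow> components P = P"
  by (rule components_eqI) (auto simp: partition_on_def intro: connected_rel_block)

lemma components_image:
  assumes f: "inj_on f (\<Union>Bs)"
  shows "components ((`) f ` Bs) = (`) f ` components Bs"
proof (rule components_eqI)
  have "partition_on (f ` \<Union>Bs) ((`) f ` components Bs - {{}})"
    using partition_on_inj_image[OF partition_on_components f] .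
  moreover have "{} \<notin> (`) f ` components Bs"
    using partition_on_components[of Bs] by (auto simp: partition_on_def)
  moreover have "\<Union>((`) f ` Bs) = f ` \<Union>Bs" by auto
  ultimately show "partition_on (\<Union>((`) f ` Bs)) ((`) f ` components Bs)" by simp
  show "\<exists>C\<in>(`) f ` components Bs. B \<subseteq> C" if B: "B \<in> (`) f ` Bs" "B \<noteq> {}" for B
  proof -
    obtain B' where "B = f ` B'" "B' \<in> Bs" "B' \<noteq> {}" using B by blast
    then show ?thesis using block_subset_component[of B' Bs] by blast
  qed
  show "(u, v) \<in> connected_rel ((`) f ` Bs)" if uv: "C \<in> (`) f ` components Bs" "u \<in> C" "v \<in> C" for C u v
  proof -
    obtain C' x y where "C' \<in> components Bs" "x \<in> C'" "y \<in> C'" and eq: "u = f x" "v = f y"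
      using uv by auto
    then have "(x, y) \<in> connected_rel Bs" by (metis component_connected)
    then show ?thesis unfolding eq
    proof (induction rule: connected_rel_induct)
      case base
      then show ?case by (auto intro!: connected_rel_refl)
    next
      case (step B y z)
      then have "(f y, f z) \<in> connected_rel ((`) f ` Bs)" by (intro connected_rel_block[of "f ` B"]) auto
      with step show ?case using connected_rel_trans by metis
    qed
  qed
qed

section \<open>Eliminating vertices and counting the components that disappear\<close>

definition eliminate :: "'v set \<Rightarrow> 'v set set \<Rightarrow> 'v set set" where
  "eliminate W Bs = (\<lambda>C. C - W) ` components Bs - {{}}"

text \<open>For the middle column \<open>W\<close> of a stacked picture this is the exponent of
  \<open>\<delta>\<close>, while \<open>eliminate\<close> yields the composite. Both are kept for
  arbitrary families of blocks, so that pictures with four columns and pictures on a line obey the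
  same laws.\<close>

definition loops :: "'v set \<Rightarrow> 'v set set \<Rightarrow> nat" where
  "loops W Bs = card {C \<in> components Bs. C \<subseteq> W}"

lemma partition_on_eliminate: "partition_on (\<Union>Bs - W) (eliminate W Bs)"
  unfolding eliminate_def
  by (rule partition_on_transform[OF partition_on_components]) (auto simp: disjnt_def)

lemma Union_eliminate [simp]: "\<Union>(eliminate W Bs) = \<Union>Bs - W"
  using partition_on_eliminate[of Bs W] by (simp add: partition_on_def)

text \<open>A path in \<open>Bs \<union> Cs\<close> can enter or leave \<open>W\<close> only through
  blocks of \<open>Bs\<close>. Each stretch through \<open>Bs\<close> between two vertices outside
  \<open>W\<close> is therefore replaced by one block of \<open>eliminate W Bs\<close>, which turns
  the path into one that avoids \<open>W\<close>.\<close>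

lemma components_eliminate_Un:
  assumes disj: "\<Union>Cs \<inter> W = {}"
  shows "components (eliminate W Bs \<union> Cs) = eliminate W (Bs \<union> Cs)"
proof (rule components_eqI)
  have "\<Union>(eliminate W Bs \<union> Cs) = \<Union>(Bs \<union> Cs) - W"
    using disj by auto
  then show "partition_on (\<Union>(eliminate W Bs \<union> Cs)) (eliminate W (Bs \<union> Cs))"
    using partition_on_eliminate[of "Bs \<union> Cs" W] by simp
  show "\<exists>C\<in>eliminate W (Bs \<union> Cs). B \<subseteq> C" if B: "B \<in> eliminate W Bs \<union> Cs" "B \<noteq> {}" for B
  proof -
    have "\<exists>C\<in>components (Bs \<union> Cs). B \<subseteq> C - W"
    proof (cases "B \<in> Cs")
      case True
      then show ?thesis using block_subset_component[of B "Bs \<union> Cs"] B disj by blast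
    next
      case False
      then obtain E where "E \<in> components Bs" "B = E - W" using B unfolding eliminate_def by blast
      then obtain C where "C \<in> components (Bs \<union> Cs)" "E \<subseteq> C"
        using components_subset_component[of Bs "Bs \<union> Cs" E] by auto
      then show ?thesis using \<open>B = E - W\<close> by (intro bexI[of _ C]) auto
    qed
    then show ?thesis using B(2) unfolding eliminate_def by blast
  qed
  show "(u, v) \<in> connected_rel (eliminate W Bs \<union> Cs)"
    if C: "C \<in> eliminate W (Bs \<union> Cs)" "u \<in> C" "v \<in> C" for C u v
  proof -
    let ?R = "connected_rel (eliminate W Bs \<union> Cs)"
    have link: "(y, z) \<in> ?R" if yz: "(y, z) \<in> connected_rel Bs" "y \<notin> W" "z \<notin> W" for y z
    proof -
      obtain E where E: "E \<in> components Bs" "y \<in> E"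
        using connected_rel_Union[OF yz(1)] Union_components[of Bs] by (metis UnionE)
      then have "E - W \<in> eliminate W Bs" "z \<in> E"
        using yz component_closed[OF E] unfolding eliminate_def by auto
      then show ?thesis using E yz by (intro connected_rel_block[of "E - W"]) auto
    qed
    obtain E where "E \<in> components (Bs \<union> Cs)" "C = E - W" using C(1) unfolding eliminate_def by blast
    then have uv: "u \<notin> W" "v \<notin> W" "(u, v) \<in> connected_rel (Bs \<union> Cs)"
      using C(2,3) component_connected[of E "Bs \<union> Cs" u v] by auto
    \<comment> \<open>The path may currently be inside \<open>W\<close>, where the reduced picture
      has no vertices. The invariant therefore remembers a checkpoint \<open>v'\<close> outside
      \<open>W\<close> from which the present vertex is reached through \<open>Bs\<close>
      alone.\<close>
    have "\<exists>v'. v' \<notin> W \<and> (u, v') \<in> ?R \<and> (v' = v \<or> (v', v) \<in> connected_rel Bs)"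
      using uv(3)
    proof (induction rule: connected_rel_induct)
      case base
      have "u \<in> \<Union>(eliminate W Bs \<union> Cs)" using base uv(1) by auto
      then have "(u, u) \<in> ?R" by (rule connected_rel_refl)
      then show ?case using uv(1) by (intro exI[of _ u]) simp
    next
      case (step B y z)
      then obtain v' where v': "v' \<notin> W" "(u, v') \<in> ?R" "v' = y \<or> (v', y) \<in> connected_rel Bs" by blast
      show ?case
      proof (cases "B \<in> Bs")
        case True
        then have "(y, z) \<in> connected_rel Bs" using step connected_rel_block by metis
        then have "(v', z) \<in> connected_rel Bs" using v'(3) connected_rel_trans by metis
        then show ?thesis using v'(1,2) by (intro exI[of _ v']) simp
      next
        case False
        then have B: "B \<in> Cs" "y \<notin> W" "z \<notin> W" using step disj by blast+
        then have "(u, y) \<in> ?R" using v' link connected_rel_trans by metis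
        moreover have "(y, z) \<in> ?R" using B step by (intro connected_rel_block[of B]) auto
        ultimately show ?thesis using B connected_rel_trans by metis
      qed
    qed
    then show ?thesis using link uv connected_rel_trans by metis
  qed
qed

lemma eliminate_eliminate_Un:
  assumes "\<Union>Cs \<inter> W = {}"
  shows "eliminate W' (eliminate W Bs \<union> Cs) = eliminate (W \<union> W') (Bs \<union> Cs)"
proof -
  have "eliminate W' (eliminate W Bs \<union> Cs) = (\<lambda>C. C - W') ` eliminate W (Bs \<union> Cs) - {{}}"
    unfolding eliminate_def[of W'] components_eliminate_Un[OF assms] ..
  also have "\<dots> = eliminate (W \<union> W') (Bs \<union> Cs)"
  proof -
    have "(\<lambda>C. C - W') ` (F - {{}}) - {{}} = (\<lambda>C. C - W') ` F - {{}}" for F by auto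
    moreover have "C - W - W' = C - (W \<union> W')" for C by blast
    ultimately show ?thesis unfolding eliminate_def by (simp add: image_image)
  qed
  finally show ?thesis .
qed

lemma eliminate_partition: "partition_on V P \<Longrightarrow> V \<inter> W = {} \<Longrightarrow> eliminate W P = P"
proof -
  assume P: "partition_on V P" and "V \<inter> W = {}"
  then have "C - W = C" if "C \<in> P" for C using that by (auto simp: partition_on_def)
  moreover have "{} \<notin> P" using P by (simp add: partition_on_def)
  ultimately show ?thesis unfolding eliminate_def components_partition[OF P] by simp
qed

text \<open>Blocks of \<open>Cs\<close> cannot touch a component inside \<open>W\<close>, so adding
  them neither enlarges nor creates such a component.\<close>

lemma components_Un_subset:
  assumes disj: "\<Union>Cs \<inter> W = {}"
  shows "{C \<in> components (Bs \<union> Cs). C \<subseteq> W} = {C \<in> components Bs. C \<subseteq> W}"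
proof -
  \<comment> \<open>From a vertex whose whole class stays inside \<open>W\<close>, no step of a path
    can use a block of \<open>Cs\<close>.\<close>
  have stay: "(u, v) \<in> connected_rel Bs"
    if "C \<subseteq> W" "\<And>z. (u, z) \<in> connected_rel (Bs \<union> Cs) \<Longrightarrow> z \<in> C"
      "(u, v) \<in> connected_rel (Bs \<union> Cs)" for u v C
    using that(3)
  proof (induction rule: connected_rel_induct)
    case base
    have "u \<in> C" using that(2)[OF connected_rel_refl[OF base]] .
    then have "u \<notin> \<Union>Cs" using that(1) disj by blast
    then show ?case using base by (intro connected_rel_refl) simp
  next
    case (step B y z)
    have "y \<in> W" using step(1) that by blast
    then have "B \<in> Bs" using step disj by blast
    then show ?case using step connected_rel_block connected_rel_trans by metis
  qed
  show ?thesis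
  proof (intro Collect_cong iffI conjI; (elim conjE)?)
    fix C assume C: "C \<in> components (Bs \<union> Cs)" "C \<subseteq> W"
    obtain u where u: "u \<in> C" using component_nonempty[OF C(1)] ..
    have "u \<in> \<Union>(Bs \<union> Cs)" using C(1) u Union_components[of "Bs \<union> Cs"] by blast
    then have "u \<in> \<Union>Bs" using C u disj by auto
    then obtain E where E: "E \<in> components Bs" "u \<in> E" using Union_components[of Bs] by blast
    have "E = C"
    proof
      show "E \<subseteq> C" using components_subset_component[of Bs "Bs \<union> Cs" E] E C u
          partition_on_eqI[OF partition_on_components, of C "Bs \<union> Cs"] by blast
      show "C \<subseteq> E"
        using stay[OF C(2)] component_closed[OF C(1) u] component_connected[OF C(1) u] component_closed[OF E] by blast
    qed
    then show "C \<in> components Bs" using E by simp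
  next
    fix E assume E: "E \<in> components Bs" "E \<subseteq> W"
    then obtain C where C: "C \<in> components (Bs \<union> Cs)" "E \<subseteq> C"
      using components_subset_component[of Bs "Bs \<union> Cs" E] by blast
    obtain u where u: "u \<in> E" using component_nonempty[OF E(1)] ..
    have "v \<in> E" if "(u, v) \<in> connected_rel (Bs \<union> Cs)" for v
      using that
    proof (induction rule: connected_rel_induct)
      case base
      show ?case by (rule u)
    next
      case (step B y z)
      then have "B \<in> Bs" using disj E(2) by blast
      then show ?case using step component_closed[OF E(1)] connected_rel_block by metis
    qed
    then have "C = E" using C u component_connected[OF C(1)] by blast
    then show "E \<in> components (Bs \<union> Cs)" using C by simp
  qed
qed

text \<open>A component inside \<open>W \<union> W'\<close> either lies in \<open>W\<close>, where
  \<open>Cs\<close> has no influence, or leaves a nonempty trace outside \<open>W\<close>. Distinct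
  components have disjoint traces, so the second kind is counted correctly after \<open>W\<close>
  has been eliminated. The associativity of the exponents of \<open>\<delta>\<close> rests on
  this.\<close>

lemma loops_Un:
  assumes fin: "finite (\<Union>(Bs \<union> Cs))" and disj: "\<Union>Cs \<inter> W = {}"
  shows "loops (W \<union> W') (Bs \<union> Cs) = loops W Bs + loops W' (eliminate W Bs \<union> Cs)"
proof -
  let ?D = "components (Bs \<union> Cs)"
  have finD: "finite ?D" using finite_elements[OF fin partition_on_components] .
  have "bij_betw (\<lambda>C. C - W) {C \<in> ?D. C \<subseteq> W \<union> W' \<and> \<not> C \<subseteq> W}
      {C \<in> eliminate W (Bs \<union> Cs). C \<subseteq> W'}"
  proof (rule bij_betwI')
    fix X Y assume X: "X \<in> {C \<in> ?D. C \<subseteq> W \<union> W' \<and> \<not> C \<subseteq> W}"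
      and Y: "Y \<in> {C \<in> ?D. C \<subseteq> W \<union> W' \<and> \<not> C \<subseteq> W}"
    show "(X - W = Y - W) = (X = Y)"
    proof
      assume eq: "X - W = Y - W"
      obtain x where "x \<in> X - W" using X by blast
      then show "X = Y" using eq X Y partition_on_eqI[OF partition_on_components, of X "Bs \<union> Cs" Y x] by blast
    qed simp
  qed (auto simp: eliminate_def)
  then have "card {C \<in> ?D. C \<subseteq> W \<union> W' \<and> \<not> C \<subseteq> W} = loops W' (eliminate W Bs \<union> Cs)"
    unfolding loops_def components_eliminate_Un[OF disj] by (rule bij_betw_same_card)
  moreover have "loops (W \<union> W') (Bs \<union> Cs)
      = card ({C \<in> ?D. C \<subseteq> W} \<union> {C \<in> ?D. C \<subseteq> W \<union> W' \<and> \<not> C \<subseteq> W})"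
    unfolding loops_def by (rule arg_cong[where f = card]) auto
  moreover have "\<dots> = card {C \<in> ?D. C \<subseteq> W} + card {C \<in> ?D. C \<subseteq> W \<union> W' \<and> \<not> C \<subseteq> W}"
    using finD by (intro card_Un_disjoint) auto
  ultimately show ?thesis unfolding loops_def[of W Bs] components_Un_subset[OF disj] by simp
qed

lemma loops_empty [simp]: "loops {} Bs = 0"
  using partition_on_components[of Bs] unfolding loops_def partition_on_def
  by (auto simp: card_eq_0_iff)

lemma eliminate_cong:
  assumes "W \<inter> \<Union>Bs = W' \<inter> \<Union>Bs"
  shows "eliminate W Bs = eliminate W' Bs"
proof -
  have "C - W = C - W'" if "C \<in> components Bs" for C
    using assms Union_upper[OF that] by auto
  then show ?thesis unfolding eliminate_def by simp
qed

lemma loops_cong: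
  assumes "W \<inter> \<Union>Bs = W' \<inter> \<Union>Bs"
  shows "loops W Bs = loops W' Bs"
proof -
  have "C \<subseteq> W \<longleftrightarrow> C \<subseteq> W'" if "C \<in> components Bs" for C
    using assms Union_upper[OF that] by auto
  then show ?thesis unfolding loops_def by (metis (no_types, lifting))
qed

text \<open>Two-step elimination is applied twice: \<open>W \<inter> \<Union>X\<close> does not meet
  \<open>Y\<close>, and \<open>W - \<Union>X\<close> does not meet what is left of \<open>X\<close>.
  The congruence rule replaces \<open>W\<close> by these pieces.\<close>

lemma eliminate_disjoint_Un:
  assumes disj: "\<Union>X \<inter> \<Union>Y = {}"
  shows "eliminate W (X \<union> Y) = eliminate W X \<union> eliminate W Y"
proof -
  have eX: "eliminate (W \<inter> \<Union>X) X = eliminate W X" and eY: "eliminate (W - \<Union>X) Y = eliminate W Y"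
    using disj by (auto intro!: eliminate_cong)
  have W: "W = (W \<inter> \<Union>X) \<union> (W - \<Union>X)" by blast
  have "eliminate W (X \<union> Y) = eliminate (W - \<Union>X) (eliminate W X \<union> Y)"
    using eliminate_eliminate_Un[of Y "W \<inter> \<Union>X" "W - \<Union>X" X] disj eX W by auto
  \<comment> \<open>The added empty set makes the law for eliminating a union applicable from right
    to left, now with \<open>Y\<close> as the part that is reduced first.\<close>
  also have "\<dots> = eliminate ((W - \<Union>X) \<union> {}) (Y \<union> eliminate W X)" by (simp add: Un_commute)
  also have "\<dots> = eliminate {} (eliminate (W - \<Union>X) Y \<union> eliminate W X)"
    by (rule eliminate_eliminate_Un[symmetric]) auto
  also have "\<dots> = eliminate W Y \<union> eliminate W X"
  proof -
    have "partition_on ((\<Union>Y - W) \<union> (\<Union>X - W)) (eliminate W Y \<union> eliminate W X)"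
      using disj by (intro partition_on_Un partition_on_eliminate) blast
    then show ?thesis unfolding eY by (rule eliminate_partition) simp
  qed
  finally show ?thesis by blast
qed

lemma loops_disjoint_Un:
  assumes disj: "\<Union>X \<inter> \<Union>Y = {}" and fin: "finite (\<Union>(X \<union> Y))"
  shows "loops W (X \<union> Y) = loops W X + loops W Y"
proof -
  have eX: "loops (W \<inter> \<Union>X) X = loops W X" and eY: "loops (W - \<Union>X) Y = loops W Y"
    using disj by (auto intro!: loops_cong)
  have W: "W = (W \<inter> \<Union>X) \<union> (W - \<Union>X)" by blast
  have "loops W (X \<union> Y) = loops W X + loops (W - \<Union>X) (eliminate (W \<inter> \<Union>X) X \<union> Y)"
    using loops_Un[OF fin, of "W \<inter> \<Union>X" "W - \<Union>X"] disj eX W by auto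
  moreover have "loops ((W - \<Union>X) \<union> {}) (Y \<union> eliminate (W \<inter> \<Union>X) X)
     = loops (W - \<Union>X) Y + loops {} (eliminate (W - \<Union>X) Y \<union> eliminate (W \<inter> \<Union>X) X)"
    using fin by (intro loops_Un) auto
  ultimately show ?thesis using eY by (simp add: Un_commute)
qed

lemma eliminate_image:
  assumes f: "inj_on f (\<Union>Bs)" and W: "\<And>x. x \<in> \<Union>Bs \<Longrightarrow> f x \<in> W' \<longleftrightarrow> x \<in> W"
  shows "eliminate W' ((`) f ` Bs) = (`) f ` eliminate W Bs"
proof -
  have "f ` C - W' = f ` (C - W)" if "C \<in> components Bs" for C
    using that W Union_components[of Bs] by blast
  then show ?thesis unfolding eliminate_def components_image[OF f] image_image
    by (auto simp: image_iff)
qed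

lemma loops_image:
  assumes f: "inj_on f (\<Union>Bs)" and W: "\<And>x. x \<in> \<Union>Bs \<Longrightarrow> f x \<in> W' \<longleftrightarrow> x \<in> W"
  shows "loops W' ((`) f ` Bs) = loops W Bs"
proof -
  have sub: "f ` C \<subseteq> W' \<longleftrightarrow> C \<subseteq> W" if "C \<in> components Bs" for C
    using that W Union_components[of Bs] by blast
  have "bij_betw ((`) f) {C \<in> components Bs. C \<subseteq> W} {C \<in> components ((`) f ` Bs). C \<subseteq> W'}"
    unfolding bij_betw_def components_image[OF f]
  proof
    have "inj_on ((`) f) (Pow (\<Union>Bs))" using f by (simp add: inj_on_image_Pow)
    then show "inj_on ((`) f) {C \<in> components Bs. C \<subseteq> W}"
      by (rule inj_on_subset) (use Union_components[of Bs] in blast)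
    show "(`) f ` {C \<in> components Bs. C \<subseteq> W} = {C \<in> (`) f ` components Bs. C \<subseteq> W'}"
      using sub by blast
  qed
  then show ?thesis unfolding loops_def by (simp add: bij_betw_same_card)
qed

text \<open>Composing with an identity diagram is the case where each vertex \<open>w\<close> of \<open>W\<close> is joined to a
  fresh vertex \<open>g w\<close>.\<close>

lemma components_connectors:
  assumes Q: "partition_on V Q" and W: "W \<subseteq> V" and g: "inj_on g W" and fresh: "g ` W \<inter> V = {}"
  shows "components ((\<lambda>w. {g w, w}) ` W \<union> Q) = (\<lambda>C. C \<union> g ` (C \<inter> W)) ` Q"
proof (rule components_eqI)
  let ?Bs = "(\<lambda>w. {g w, w}) ` W \<union> Q"
  have un: "\<Union>?Bs = V \<union> g ` W" using Q W by (auto simp: partition_on_def)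
  show "partition_on (\<Union>?Bs) ((\<lambda>C. C \<union> g ` (C \<inter> W)) ` Q)"
    unfolding un
  proof (rule partition_onI)
    show "\<Union>((\<lambda>C. C \<union> g ` (C \<inter> W)) ` Q) = V \<union> g ` W" using Q W by (auto simp: partition_on_def)
    show "{} \<notin> (\<lambda>C. C \<union> g ` (C \<inter> W)) ` Q" using Q by (auto simp: partition_on_def)
    fix p q assume p: "p \<in> (\<lambda>C. C \<union> g ` (C \<inter> W)) ` Q" and q: "q \<in> (\<lambda>C. C \<union> g ` (C \<inter> W)) ` Q" and "p \<noteq> q"
    then obtain C D where CD: "C \<in> Q" "D \<in> Q" "C \<noteq> D" "p = C \<union> g ` (C \<inter> W)" "q = D \<union> g ` (D \<inter> W)" by blast
    have "C \<inter> D = {}" "C \<subseteq> V" "D \<subseteq> V" using CD(1-3) Q by (auto simp: partition_on_def disjoint_def)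
    moreover have "g ` (C \<inter> W) \<inter> g ` (D \<inter> W) = {}"
      using calculation(1) inj_on_image_Int[OF g, of "C \<inter> W" "D \<inter> W"] by auto
    ultimately show "disjnt p q" unfolding CD disjnt_def using fresh by blast
  qed
  show "\<exists>C\<in>(\<lambda>C. C \<union> g ` (C \<inter> W)) ` Q. B \<subseteq> C" if "B \<in> ?Bs" for B
  proof (cases "B \<in> Q")
    case False
    then obtain w where w: "w \<in> W" "B = {g w, w}" using \<open>B \<in> ?Bs\<close> by blast
    then obtain C where "C \<in> Q" "w \<in> C" using Q W by (auto simp: partition_on_def)
    then show ?thesis using w by auto
  qed blast
  show "(u, v) \<in> connected_rel ?Bs" if "C \<in> (\<lambda>C. C \<union> g ` (C \<inter> W)) ` Q" "u \<in> C" "v \<in> C" for C u v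
  proof -
    obtain D where D: "D \<in> Q" "C = D \<union> g ` (D \<inter> W)" using \<open>C \<in> _\<close> by blast
    have retract: "\<exists>x'\<in>D. (x, x') \<in> connected_rel ?Bs" if x: "x \<in> C" for x
    proof (cases "x \<in> D")
      case True
      then show ?thesis using connected_rel_block[of D ?Bs x x] D by (intro bexI[of _ x]) auto
    next
      case False
      then obtain w where "w \<in> W" "w \<in> D" "x = g w" using x D by auto
      then show ?thesis using connected_rel_block[of "{g w, w}" ?Bs x w] by (intro bexI[of _ w]) auto
    qed
    obtain u' where u': "u' \<in> D" "(u, u') \<in> connected_rel ?Bs"
      using retract[OF \<open>u \<in> C\<close>] ..
    obtain v' where v': "v' \<in> D" "(v, v') \<in> connected_rel ?Bs"
      using retract[OF \<open>v \<in> C\<close>] ..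
    have "(u', v') \<in> connected_rel ?Bs"
      by (rule connected_rel_block[of D]) (simp_all add: D u' v')
    from connected_rel_trans[OF connected_rel_trans[OF u'(2) this] connected_rel_sym[OF v'(2)]]
    show ?thesis .
  qed
qed

text \<open>After elimination \<open>g w\<close> stands where \<open>w\<close> stood, so the result
  is \<open>Q\<close> with vertices renamed; every component keeps a vertex, hence
  \<open>loops\<close> counts none. \<open>W'\<close> may exceed \<open>W\<close> because whole
  columns are eliminated, of which only the part \<open>W\<close> occurs in the picture.\<close>

lemma eliminate_connectors:
  assumes Q: "partition_on V Q" and W: "W \<subseteq> V" and g: "inj_on g W" and fresh: "g ` W \<inter> V = {}"
    and W': "W' \<inter> (V \<union> g ` W) = W"
  shows "eliminate W' ((\<lambda>w. {g w, w}) ` W \<union> Q) = (`) (\<lambda>x. if x \<in> W then g x else x) ` Q"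
    and "loops W' ((\<lambda>w. {g w, w}) ` W \<union> Q) = 0"
proof -
  let ?h = "\<lambda>x. if x \<in> W then g x else x"
  have sub: "C \<subseteq> V" "C \<noteq> {}" if "C \<in> Q" for C using that Q by (auto simp: partition_on_def)
  have h: "(C \<union> g ` (C \<inter> W)) - W' = ?h ` C" if "C \<in> Q" for C
  proof -
    have "C \<inter> W' = C \<inter> W" "g ` (C \<inter> W) \<inter> W' = {}" using sub[OF that] W W' fresh by blast+
    then show ?thesis by (auto split: if_splits)
  qed
  have "(\<lambda>C. C - W') ` (\<lambda>C. C \<union> g ` (C \<inter> W)) ` Q = (`) ?h ` Q"
    unfolding image_image by (rule image_cong[OF refl h])
  moreover have "{} \<notin> (`) ?h ` Q" using sub(2) by blast
  ultimately show "eliminate W' ((\<lambda>w. {g w, w}) ` W \<union> Q) = (`) ?h ` Q"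
    unfolding eliminate_def components_connectors[OF Q W g fresh] by simp
  have "\<not> C \<union> g ` (C \<inter> W) \<subseteq> W'" if "C \<in> Q" for C
  proof -
    have "?h ` C \<noteq> {}" unfolding image_is_empty using sub(2)[OF that] .
    then have "C \<union> g ` (C \<inter> W) - W' \<noteq> {}" unfolding h[OF that] .
    then show ?thesis by blast
  qed
  then have "{C \<in> (\<lambda>C. C \<union> g ` (C \<inter> W)) ` Q. C \<subseteq> W'} = {}" by blast
  then show "loops W' ((\<lambda>w. {g w, w}) ` W \<union> Q) = 0"
    unfolding loops_def components_connectors[OF Q W g fresh] by (metis card.empty)
qed

section \<open>Composition of diagrams\<close>

text \<open>Unlike in \<open>place\<close>, the two columns are free: a composite is drawn in
  columns 0 and 2, and a triple product needs columns 0 to 3.\<close>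

definition dot_at :: "nat \<Rightarrow> nat \<Rightarrow> int \<Rightarrow> nat \<times> nat" where
  "dot_at a b i = (if i < 0 then a else b, nat \<bar>i\<bar>)"

definition draw :: "nat \<Rightarrow> nat \<Rightarrow> diagram \<Rightarrow> (nat \<times> nat) set set" where
  "draw a b p = (`) (dot_at a b) ` p"

lemma inj_dot_at: "a \<noteq> b \<Longrightarrow> inj (dot_at a b)"
  unfolding dot_at_def inj_def by (auto split: if_splits)

lemma dot_at_dots: "dot_at a b ` dots n = {a, b} \<times> {1..n}"
proof (intro equalityI subsetI)
  fix x assume x: "x \<in> {a, b} \<times> {1..n}"
  define k where "k = snd x"
  have k: "x = (a, k) \<or> x = (b, k)" "1 \<le> k" "k \<le> n" using x by (auto simp: k_def)
  then have "x = dot_at a b (- int k) \<or> x = dot_at a b (int k)" by (auto simp: dot_at_def)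
  moreover have "- int k \<in> dots n" "int k \<in> dots n" using k by (auto simp: dots_def)
  ultimately show "x \<in> dot_at a b ` dots n" by blast
qed (auto simp: dot_at_def dots_def)

lemma Union_diagram: "p \<in> diagrams n \<Longrightarrow> \<Union>p = dots n"
  by (simp add: diagrams_def partition_on_def)

lemma Union_draw: "p \<in> diagrams n \<Longrightarrow> \<Union>(draw a b p) = {a, b} \<times> {1..n}"
  unfolding draw_def dot_at_dots[symmetric] Union_diagram[symmetric] by auto

lemma partition_on_inj_imageD:
  assumes "partition_on (f ` V) ((`) f ` P)" "inj f"
  shows "partition_on V P"
proof (rule partition_onI)
  have "f ` \<Union>P = f ` V" using assms(1) unfolding image_Union by (simp add: partition_on_def)
  then show "\<Union>P = V" using assms(2) by (simp add: inj_image_eq_iff)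
  show "{} \<notin> P" using assms(1) by (auto simp: partition_on_def)
  show "disjnt p q" if "p \<in> P" "q \<in> P" "p \<noteq> q" for p q
  proof -
    have "f ` p \<noteq> f ` q" using that(3) assms(2) by (simp add: inj_image_eq_iff)
    then have "disjnt (f ` p) (f ` q)" using that assms(1) by (auto simp: partition_on_def pairwise_def)
    then show ?thesis by (auto simp: disjnt_def)
  qed
qed

lemma partition_on_inj_image': "partition_on V P \<Longrightarrow> inj_on f V \<Longrightarrow> partition_on (f ` V) ((`) f ` P)"
proof -
  assume "partition_on V P" "inj_on f V"
  moreover from this have "{} \<notin> (`) f ` P" by (auto simp: partition_on_def)
  ultimately show ?thesis using partition_on_inj_image[of V P f] by simp
qed

lemma partition_on_draw:
  "\<lbrakk>p \<in> diagrams n; a \<noteq> b\<rbrakk> \<Longrightarrow> partition_on ({a, b} \<times> {1..n}) (draw a b p)"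
  unfolding draw_def dot_at_dots[symmetric]
  by (rule partition_on_inj_image') (auto simp: diagrams_def intro: inj_on_subset[OF inj_dot_at])

lemma draw_inject: "a \<noteq> b \<Longrightarrow> draw a b p = draw a b q \<longleftrightarrow> p = q"
  unfolding draw_def by (rule inj_image_eq_iff) (auto intro: injI simp: inj_image_eq_iff[OF inj_dot_at])

lemma stacked_blocks_draw: "stacked_blocks p r = draw 0 1 p \<union> draw 1 2 r"
  unfolding stacked_blocks_def draw_def place_def dot_at_def One_nat_def numeral_2_eq_2 ..

lemma middle_count_loops: "middle_count p r = loops ({1} \<times> UNIV) (draw 0 1 p \<union> draw 1 2 r)"
  unfolding middle_count_def loops_def stacked_blocks_draw ..

text \<open>\<open>outer_dots\<close> is the preimage under \<open>dot_at 0 2\<close>. Drawing it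
  again cuts a component down to columns 0 and 2, which removes exactly column 1.\<close>

lemma draw_diagram_comp_0_2:
  assumes "p \<in> diagrams n" "r \<in> diagrams n"
  shows "draw 0 2 (diagram_comp p r) = eliminate ({1} \<times> UNIV) (draw 0 1 p \<union> draw 1 2 r)"
proof -
  have "dot_at 0 2 ` outer_dots C = C - {1} \<times> UNIV" if "C \<in> components (stacked_blocks p r)" for C
  proof -
    have "C \<subseteq> {0, 1, 2} \<times> {1..n}"
      using Union_upper[OF that] Union_draw[OF assms(1), of 0 1] Union_draw[OF assms(2), of 1 2]
      by (auto simp: stacked_blocks_draw)
    moreover have outer: "outer_dots C = dot_at 0 2 -` C" by (auto simp: outer_dots_def dot_at_def)
    moreover have "{0, 2} \<times> {1..n} \<subseteq> range (dot_at 0 2)" using dot_at_dots[of 0 2 n] by blast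
    moreover have "range (dot_at 0 2) \<inter> {1} \<times> UNIV = {}" by (auto simp: dot_at_def split: if_splits)
    ultimately show ?thesis unfolding outer image_vimage_eq by auto
  qed
  then have "(\<lambda>C. dot_at 0 2 ` outer_dots C) ` components (stacked_blocks p r)
      = (\<lambda>C. C - {1} \<times> UNIV) ` components (stacked_blocks p r)" by (rule image_cong[OF refl])
  moreover have "(`) (dot_at 0 2) ` (X - {{}}) = (`) (dot_at 0 2) ` X - {{}}" for X by auto
  ultimately show ?thesis
    unfolding draw_def diagram_comp_def eliminate_def stacked_blocks_draw[symmetric, unfolded draw_def]
    by (simp add: image_image)
qed

lemma
  assumes p: "p \<in> diagrams n" and r: "r \<in> diagrams n" and abc: "a \<noteq> b" "b \<noteq> c" "a \<noteq> c"
  shows draw_diagram_comp: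
      "draw a c (diagram_comp p r) = eliminate ({b} \<times> UNIV) (draw a b p \<union> draw b c r)"
    and middle_count_draw: "middle_count p r = loops ({b} \<times> UNIV) (draw a b p \<union> draw b c r)"
proof -
  \<comment> \<open>Columns 0, 1, 2 are renamed \<open>a\<close>, \<open>b\<close>,
    \<open>c\<close>; injectivity is needed only on these three, since no other column
    occurs.\<close>
  let ?f = "\<lambda>(x :: nat, k :: nat). (if x = 0 then a else if x = 1 then b else c, k)"
  let ?Bs = "draw 0 1 p \<union> draw 1 2 r"
  have f: "(`) ?f ` draw x y q = draw (fst (?f (x, 0))) (fst (?f (y, 0))) q" for x y q
    unfolding draw_def image_image dot_at_def by (auto intro!: image_cong)
  then have eq: "(`) ?f ` ?Bs = draw a b p \<union> draw b c r" and eq2: "(`) ?f ` draw 0 2 q = draw a c q" for q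
    by (simp_all add: image_Un)
  have un: "\<Union>?Bs = {0, 1, 2} \<times> {1..n}" using Union_draw[OF p, of 0 1] Union_draw[OF r, of 1 2] by auto
  have inj: "inj_on ?f (\<Union>?Bs)" unfolding un using abc by (auto simp: inj_on_def)
  have W: "?f x \<in> {b} \<times> UNIV \<longleftrightarrow> x \<in> {1} \<times> UNIV" if "x \<in> \<Union>?Bs" for x
    using that abc unfolding un by auto
  show "draw a c (diagram_comp p r) = eliminate ({b} \<times> UNIV) (draw a b p \<union> draw b c r)"
    using eliminate_image[OF inj W] eq eq2 draw_diagram_comp_0_2[OF p r] by metis
  show "middle_count p r = loops ({b} \<times> UNIV) (draw a b p \<union> draw b c r)"
    using loops_image[OF inj W] eq middle_count_loops by metis
qed

lemma diagram_comp_closed: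
  assumes "p \<in> diagrams n" "r \<in> diagrams n"
  shows "diagram_comp p r \<in> diagrams n"
proof -
  have "{0, 2} \<times> {1..n} = \<Union>(draw 0 1 p \<union> draw 1 2 r) - {1} \<times> UNIV"
    using Union_draw[OF assms(1), of 0 1] Union_draw[OF assms(2), of 1 2] by auto
  then have "partition_on (dot_at 0 2 ` dots n) ((`) (dot_at 0 2) ` diagram_comp p r)"
    using partition_on_eliminate[of "draw 0 1 p \<union> draw 1 2 r" "{1} \<times> UNIV"]
    unfolding dot_at_dots draw_diagram_comp_0_2[OF assms, symmetric] draw_def[of 0 2] by metis
  then have "partition_on (dots n) (diagram_comp p r)"
    by (rule partition_on_inj_imageD) (simp add: inj_dot_at)
  then show ?thesis by (simp add: diagrams_def)
qed

text \<open>Both bracketings eliminate columns 1 and 2 from the same four-column picture, in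
  opposite orders. The diagram left out of the first elimination misses the column removed there, so
  two-step elimination applies, and the total number of closed components does not depend on the
  order either.\<close>

lemma
  assumes "p \<in> diagrams n" "q \<in> diagrams n" "r \<in> diagrams n"
  shows diagram_comp_assoc: "diagram_comp (diagram_comp p q) r = diagram_comp p (diagram_comp q r)"
    and middle_count_assoc: "middle_count p q + middle_count (diagram_comp p q) r
      = middle_count q r + middle_count p (diagram_comp q r)"
proof -
  let ?P = "draw 0 1 p" and ?Q = "draw 1 2 q" and ?R = "draw 2 3 r"
  let ?W1 = "{1} \<times> UNIV" and ?W2 = "{2} \<times> UNIV"
  note closed = diagram_comp_closed[OF assms(1,2)] diagram_comp_closed[OF assms(2,3)]
  note un = Union_draw[OF assms(1)] Union_draw[OF assms(2)] Union_draw[OF assms(3)]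
  have pq: "draw 0 2 (diagram_comp p q) = eliminate ?W1 (?P \<union> ?Q)"
    and qr: "draw 1 3 (diagram_comp q r) = eliminate ?W2 (?Q \<union> ?R)"
    using assms by (simp_all add: draw_diagram_comp)
  have disj: "\<Union>?R \<inter> ?W1 = {}" "\<Union>?P \<inter> ?W2 = {}" unfolding un by auto
  have fin: "finite (\<Union>(?P \<union> ?Q \<union> ?R))" "finite (\<Union>(?Q \<union> ?R \<union> ?P))" by (simp_all only: Union_Un_distrib un) auto
  have "draw 0 3 (diagram_comp (diagram_comp p q) r) = eliminate ?W2 (eliminate ?W1 (?P \<union> ?Q) \<union> ?R)"
    using closed assms pq by (simp add: draw_diagram_comp[where b = 2])
  also have "\<dots> = eliminate (?W2 \<union> ?W1) (?Q \<union> ?R \<union> ?P)"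
    unfolding eliminate_eliminate_Un[OF disj(1)] by (simp add: Un_ac)
  also have "\<dots> = eliminate ?W1 (eliminate ?W2 (?Q \<union> ?R) \<union> ?P)"
    unfolding eliminate_eliminate_Un[OF disj(2)] ..
  also have "\<dots> = draw 0 3 (diagram_comp p (diagram_comp q r))"
    using closed assms qr by (simp add: draw_diagram_comp[where b = 1] Un_commute)
  finally show "diagram_comp (diagram_comp p q) r = diagram_comp p (diagram_comp q r)"
    by (simp add: draw_inject)
  have "middle_count p q + middle_count (diagram_comp p q) r
      = loops ?W1 (?P \<union> ?Q) + loops ?W2 (eliminate ?W1 (?P \<union> ?Q) \<union> ?R)"
    using closed assms pq
    by (simp add: middle_count_draw[of p n q 0 1 2] middle_count_draw[of _ n r 0 2 3])
  also have "\<dots> = loops (?W2 \<union> ?W1) (?Q \<union> ?R \<union> ?P)"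
    unfolding loops_Un[OF fin(1) disj(1), symmetric] by (simp add: Un_ac)
  also have "\<dots> = loops ?W2 (?Q \<union> ?R) + loops ?W1 (?P \<union> eliminate ?W2 (?Q \<union> ?R))"
    unfolding loops_Un[OF fin(2) disj(2)] by (simp add: Un_commute)
  also have "\<dots> = middle_count q r + middle_count p (diagram_comp q r)"
    using closed assms qr
    by (simp add: middle_count_draw[of q n r 1 2 3] middle_count_draw[of p n _ 0 1 3])
  finally show "middle_count p q + middle_count (diagram_comp p q) r
      = middle_count q r + middle_count p (diagram_comp q r)" .
qed

section \<open>Identity diagrams as units\<close>

lemma id_diagram_image: "id_diagram n = (\<lambda>i. {- i, i}) ` {1..int n}"
  unfolding id_diagram_def by auto

lemma id_diagram_closed: "id_diagram n \<in> diagrams n"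
  unfolding diagrams_def mem_Collect_eq
proof (rule partition_onI)
  show "\<Union>(id_diagram n) = dots n"
  proof (intro equalityI subsetI)
    fix x assume "x \<in> dots n"
    then have "x \<in> {- \<bar>x\<bar>, \<bar>x\<bar>}" "\<bar>x\<bar> \<in> {1..int n}" by (auto simp: dots_def)
    then show "x \<in> \<Union>(id_diagram n)" unfolding id_diagram_image by blast
  qed (auto simp: id_diagram_image dots_def)
qed (auto simp: id_diagram_image disjnt_def)

lemma draw_id_diagram: "draw a b (id_diagram n) = (\<lambda>k. {(a, k), (b, k)}) ` {1..n}"
proof -
  have "{1..int n} = int ` {1..n}" by (simp add: image_int_atLeastAtMost)
  then show ?thesis unfolding draw_def id_diagram_image
    by (auto simp: image_image dot_at_def intro!: image_cong)
qed

text \<open>The strands of the identity extend column \<open>b\<close> to a fresh column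
  \<open>c\<close>, so eliminating \<open>b\<close> merely renames it. Since \<open>b\<close> may be
  either column of \<open>p\<close>, this serves both unit laws.\<close>

lemma
  assumes p: "p \<in> diagrams n" and cols: "x \<noteq> y" "b = x \<or> b = y" "c \<noteq> x" "c \<noteq> y"
  defines "Bs \<equiv> draw c b (id_diagram n) \<union> draw x y p"
  shows eliminate_draw_id: "eliminate ({b} \<times> UNIV) Bs = draw (if x = b then c else x) (if y = b then c else y) p"
    and loops_draw_id: "loops ({b} \<times> UNIV) Bs = 0"
proof -
  let ?V = "{x, y} \<times> {1..n}" and ?W = "{b} \<times> {1..n}"
  let ?g = "\<lambda>(i :: nat, k :: nat). (c, k)"
  have Bs: "Bs = (\<lambda>w. {?g w, w}) ` ?W \<union> draw x y p"
    unfolding Bs_def draw_id_diagram by (auto simp: image_iff)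
  have g: "?W \<subseteq> ?V" "inj_on ?g ?W" "?g ` ?W \<inter> ?V = {}" "({b} \<times> UNIV) \<inter> (?V \<union> ?g ` ?W) = ?W"
    using cols by (auto simp: inj_on_def)
  note * = eliminate_connectors[OF partition_on_draw[OF p cols(1)] g]
  have "(if dot_at x y i \<in> ?W then ?g (dot_at x y i) else dot_at x y i)
      = dot_at (if x = b then c else x) (if y = b then c else y) i" if "i \<in> dots n" for i
    using that by (auto simp: dot_at_def dots_def)
  then have "(`) (\<lambda>v. if v \<in> ?W then ?g v else v) ` draw x y p
      = draw (if x = b then c else x) (if y = b then c else y) p"
    unfolding draw_def image_image using Union_diagram[OF p] by (intro image_cong refl) blast
  then show "eliminate ({b} \<times> UNIV) Bs = draw (if x = b then c else x) (if y = b then c else y) p"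
    unfolding Bs *(1) .
  show "loops ({b} \<times> UNIV) Bs = 0" unfolding Bs by (rule *(2))
qed

lemma draw_id_swap: "draw a b (id_diagram n) = draw b a (id_diagram n)"
  unfolding draw_id_diagram by (simp add: insert_commute)

lemma
  assumes p: "p \<in> diagrams n"
  shows diagram_comp_id_left: "diagram_comp (id_diagram n) p = p"
    and middle_count_id_left: "middle_count (id_diagram n) p = 0"
    and diagram_comp_id_right: "diagram_comp p (id_diagram n) = p"
    and middle_count_id_right: "middle_count p (id_diagram n) = 0"
proof -
  have "draw 0 2 (diagram_comp (id_diagram n) p) = draw 0 2 p"
    using eliminate_draw_id[OF p, of 1 2 1 0] draw_diagram_comp_0_2[OF id_diagram_closed p] by simp
  then show "diagram_comp (id_diagram n) p = p" by (simp add: draw_inject)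
  have "draw 0 2 (diagram_comp p (id_diagram n)) = draw 0 2 p"
    using eliminate_draw_id[OF p, of 0 1 1 2] draw_diagram_comp_0_2[OF p id_diagram_closed]
    by (simp add: Un_commute draw_id_swap[of 2 "Suc 0"])
  then show "diagram_comp p (id_diagram n) = p" by (simp add: draw_inject)
  show "middle_count (id_diagram n) p = 0"
    using loops_draw_id[OF p, of 1 2 1 0] by (simp add: middle_count_loops)
  show "middle_count p (id_diagram n) = 0"
    using loops_draw_id[OF p, of 0 1 1 2] by (simp add: middle_count_loops Un_commute draw_id_swap[of 2 "Suc 0"])
qed

section \<open>Stacking diagrams\<close>

lemma inj_shift_dot: "inj (shift_dot a)"
  unfolding inj_def shift_dot_def by (auto split: if_splits)

lemma dots_add: "dots (a + b) = dots a \<union> shift_dot a ` dots b"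
proof (intro equalityI subsetI)
  fix x assume x: "x \<in> dots (a + b)"
  show "x \<in> dots a \<union> shift_dot a ` dots b"
  proof (cases "x \<in> dots a")
    case False
    let ?y = "if x < 0 then x + int a else x - int a"
    have "x = shift_dot a ?y" "?y \<in> dots b" using x False by (auto simp: shift_dot_def dots_def)
    then show ?thesis by blast
  qed simp
qed (auto simp: shift_dot_def dots_def)

lemma diagram_on_top_closed:
  assumes "p \<in> diagrams a" "q \<in> diagrams b"
  shows "diagram_on_top a p q \<in> diagrams (a + b)"
proof -
  have "partition_on (shift_dot a ` dots b) ((`) (shift_dot a) ` q)"
    using assms(2) inj_shift_dot
    by (intro partition_on_inj_image') (auto simp: diagrams_def intro: inj_on_subset)
  moreover have "dots a \<inter> shift_dot a ` dots b = {}" by (auto simp: dots_def shift_dot_def)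
  ultimately show ?thesis using assms(1)
    by (simp add: diagrams_def diagram_on_top_def dots_add partition_on_Un)
qed

lemma diagram_on_top_assoc:
  "diagram_on_top (a + b) (diagram_on_top a p q) r = diagram_on_top a p (diagram_on_top b q r)"
proof -
  have "shift_dot a (shift_dot b i) = shift_dot (a + b) i" for i by (simp add: shift_dot_def)
  then show ?thesis by (simp add: diagram_on_top_def image_Un image_image Un_assoc)
qed

lemma diagrams_0: "diagrams 0 = {{}}"
  by (auto simp: diagrams_def dots_def partition_on_empty)

lemma diagram_on_top_empty: "diagram_on_top a p {} = p"
  by (simp add: diagram_on_top_def)

lemma diagram_on_top_id: "diagram_on_top a (id_diagram a) (id_diagram b) = id_diagram (a + b)"
proof -
  have 1: "(\<lambda>i. {- i, i}) ` ((\<lambda>i. i + int a) ` {1..int b}) = (`) (shift_dot a) ` id_diagram b"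
    unfolding id_diagram_image image_image by (rule image_cong) (auto simp: shift_dot_def)
  have 2: "{1..int (a + b)} = {1..int a} \<union> (\<lambda>i. i + int a) ` {1..int b}"
    unfolding image_add_atLeastAtMost' by auto
  show ?thesis
    unfolding diagram_on_top_def id_diagram_image[of "a + b"] 2 image_Un 1 id_diagram_image[of a] ..
qed

text \<open>Stacked pictures occupy disjoint ranges of heights, 1 to \<open>a\<close> and beyond
  \<open>a\<close>, so eliminations and loop counts split. On pictures, \<open>shift_dot a\<close>
  becomes the map \<open>?s\<close> that adds \<open>a\<close> to the height.\<close>

lemma
  assumes p: "p \<in> diagrams a" "p' \<in> diagrams a" and q: "q \<in> diagrams b" "q' \<in> diagrams b"
  shows diagram_comp_on_top: "diagram_comp (diagram_on_top a p q) (diagram_on_top a p' q')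
      = diagram_on_top a (diagram_comp p p') (diagram_comp q q')"
    and middle_count_on_top: "middle_count (diagram_on_top a p q) (diagram_on_top a p' q')
      = middle_count p p' + middle_count q q'"
proof -
  let ?s = "\<lambda>(c :: nat, k :: nat). (c, k + a)"
  let ?X = "draw 0 1 p \<union> draw 1 2 p'" and ?Y = "draw 0 1 q \<union> draw 1 2 q'"
  let ?W = "{1} \<times> UNIV"
  have draw_top: "draw c d (diagram_on_top a r t) = draw c d r \<union> (`) ?s ` draw c d t" for c d r t
  proof -
    have "dot_at c d (shift_dot a i) = ?s (dot_at c d i)" for i
      by (auto simp: dot_at_def shift_dot_def)
    then show ?thesis by (simp add: draw_def diagram_on_top_def image_Un image_image)
  qed
  have inj: "inj_on ?s (\<Union>?Y)" by (auto simp: inj_on_def)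
  have W: "?s x \<in> ?W \<longleftrightarrow> x \<in> ?W" for x by (cases x) auto
  note un = Union_draw[OF p(1)] Union_draw[OF p(2)] Union_draw[OF q(1)] Union_draw[OF q(2)]
  have unX: "\<Union>?X \<subseteq> {0, 1, 2} \<times> {1..a}" and unY: "\<Union>?Y \<subseteq> {0, 1, 2} \<times> {1..b}"
    unfolding Union_Un_distrib un by auto
  have unsY: "\<Union>((`) ?s ` ?Y) = ?s ` \<Union>?Y" by auto
  have disj: "\<Union>?X \<inter> \<Union>((`) ?s ` ?Y) = {}"
    unfolding unsY using unX unY by fastforce
  have fin: "finite (\<Union>(?X \<union> (`) ?s ` ?Y))"
    unfolding Union_Un_distrib[of ?X] unsY
    using finite_subset[OF unX] finite_subset[OF unY] by simp
  have stack: "draw 0 1 (diagram_on_top a p q) \<union> draw 1 2 (diagram_on_top a p' q') = ?X \<union> (`) ?s ` ?Y"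
    unfolding draw_top by (simp add: image_Un Un_ac)
  have "draw 0 2 (diagram_comp (diagram_on_top a p q) (diagram_on_top a p' q')) = eliminate ?W (?X \<union> (`) ?s ` ?Y)"
    using diagram_on_top_closed[OF p(1) q(1)] diagram_on_top_closed[OF p(2) q(2)]
    by (simp only: draw_diagram_comp_0_2 stack)
  also have "\<dots> = eliminate ?W ?X \<union> (`) ?s ` eliminate ?W ?Y"
    unfolding eliminate_disjoint_Un[OF disj] eliminate_image[OF inj W] ..
  also have "\<dots> = draw 0 2 (diagram_on_top a (diagram_comp p p') (diagram_comp q q'))"
    unfolding draw_top draw_diagram_comp_0_2[OF p] draw_diagram_comp_0_2[OF q] ..
  finally show "diagram_comp (diagram_on_top a p q) (diagram_on_top a p' q')
      = diagram_on_top a (diagram_comp p p') (diagram_comp q q')" by (simp add: draw_inject)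
  show "middle_count (diagram_on_top a p q) (diagram_on_top a p' q') = middle_count p p' + middle_count q q'"
    unfolding middle_count_loops stack loops_disjoint_Un[OF disj fin] loops_image[OF inj W] ..
qed

section \<open>Identity strands and permutation diagrams\<close>

lemma permutation_on_top_id_left:
  assumes q: "q \<in> diagrams b"
  shows "permutation_diagram (a + b) (diagram_on_top a (id_diagram a) q) \<longleftrightarrow> permutation_diagram b q"
proof
  assume L: "permutation_diagram (a + b) (diagram_on_top a (id_diagram a) q)"
  show "permutation_diagram b q"
    unfolding permutation_diagram_def
  proof (intro conjI ballI q)
    fix B assume B: "B \<in> q"
    then have "shift_dot a ` B \<in> diagram_on_top a (id_diagram a) q" by (auto simp: diagram_on_top_def)
    then obtain i j where ij: "i \<in> {1..int (a + b)}" "j \<in> {1..int (a + b)}" "shift_dot a ` B = {- i, j}"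
      using L unfolding permutation_diagram_def by meson
    have "B \<subseteq> dots b" using B Union_diagram[OF q] by blast
    \<comment> \<open>Shifting pushes all dots beyond \<open>a\<close>, so \<open>i\<close> and
      \<open>j\<close> exceed \<open>a\<close> and can be shifted back.\<close>
    then have "\<And>x. x \<in> shift_dot a ` B \<Longrightarrow> \<bar>x\<bar> > int a" by (auto simp: shift_dot_def dots_def)
    from this[of "- i"] this[of j] ij have big: "i > int a" "j > int a" by auto
    then have "shift_dot a ` B = shift_dot a ` {- (i - int a), j - int a}"
      using ij by (simp add: shift_dot_def insert_commute)
    then have "B = {- (i - int a), j - int a}" using inj_image_eq_iff[OF inj_shift_dot] by metis
    then show "\<exists>i\<in>{1..int b}. \<exists>j\<in>{1..int b}. B = {- i, j}"
      using big ij by (intro bexI[of _ "i - int a"] bexI[of _ "j - int a"]) auto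
  qed
next
  assume R: "permutation_diagram b q"
  show "permutation_diagram (a + b) (diagram_on_top a (id_diagram a) q)"
    unfolding permutation_diagram_def
  proof (intro conjI ballI)
    show "diagram_on_top a (id_diagram a) q \<in> diagrams (a + b)"
      using q id_diagram_closed by (rule diagram_on_top_closed[rotated])
    fix B assume "B \<in> diagram_on_top a (id_diagram a) q"
    then consider i where "i \<in> {1..int a}" "B = {- i, i}" | C where "C \<in> q" "B = shift_dot a ` C"
      by (auto simp: diagram_on_top_def id_diagram_image)
    then show "\<exists>i\<in>{1..int (a + b)}. \<exists>j\<in>{1..int (a + b)}. B = {- i, j}"
    proof cases
      case 1
      then show ?thesis by (intro bexI[of _ i]) auto
    next
      case 2
      then obtain i j where "i \<in> {1..int b}" "j \<in> {1..int b}" "C = {- i, j}"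
        using R unfolding permutation_diagram_def by meson
      then show ?thesis using 2
        by (intro bexI[of _ "i + int a"] bexI[of _ "j + int a"]) (auto simp: shift_dot_def)
    qed
  qed
qed

lemma permutation_on_top_id_right:
  assumes p: "p \<in> diagrams a"
  shows "permutation_diagram (a + b) (diagram_on_top a p (id_diagram b)) \<longleftrightarrow> permutation_diagram a p"
proof
  assume L: "permutation_diagram (a + b) (diagram_on_top a p (id_diagram b))"
  show "permutation_diagram a p"
    unfolding permutation_diagram_def
  proof (intro conjI ballI p)
    fix B assume B: "B \<in> p"
    then obtain i j where ij: "i \<in> {1..int (a + b)}" "j \<in> {1..int (a + b)}" "B = {- i, j}"
      using L unfolding permutation_diagram_def diagram_on_top_def by (metis UnI1)
    have "B \<subseteq> dots a" using B Union_diagram[OF p] by blast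
    then show "\<exists>i\<in>{1..int a}. \<exists>j\<in>{1..int a}. B = {- i, j}"
      using ij by (intro bexI[of _ i] bexI[of _ j]) (auto simp: dots_def)
  qed
next
  assume R: "permutation_diagram a p"
  show "permutation_diagram (a + b) (diagram_on_top a p (id_diagram b))"
    unfolding permutation_diagram_def
  proof (intro conjI ballI)
    show "diagram_on_top a p (id_diagram b) \<in> diagrams (a + b)"
      using p id_diagram_closed by (rule diagram_on_top_closed)
    fix B assume "B \<in> diagram_on_top a p (id_diagram b)"
    then consider i where "i \<in> {1..int b}" "B = shift_dot a ` {- i, i}" | "B \<in> p"
      by (auto simp: diagram_on_top_def id_diagram_image)
    then show "\<exists>i\<in>{1..int (a + b)}. \<exists>j\<in>{1..int (a + b)}. B = {- i, j}"
    proof cases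
      case 1
      then show ?thesis
        by (intro bexI[of _ "i + int a"]) (auto simp: shift_dot_def)
    next
      case 2
      then obtain i j where "i \<in> {1..int a}" "j \<in> {1..int a}" "B = {- i, j}"
        using R unfolding permutation_diagram_def by meson
      then show ?thesis by (intro bexI[of _ i] bexI[of _ j]) auto
    qed
  qed
qed

lemma finite_diagrams: "finite (diagrams n)"
  unfolding diagrams_def by (rule finitely_many_partition_on) (simp add: dots_def)

section \<open>Brauer and Temperley--Lieb diagrams\<close>

text \<open>The crossing condition is separated from the set of dots, because pictures on a line
  with some pairs already glued have to satisfy it as well.\<close>

definition noncrossing :: "int set set \<Rightarrow> bool" where
  "noncrossing Q \<longleftrightarrow> \<not> (\<exists>a b c d. {a, b} \<in> Q \<and> {c, d} \<in> Q \<and> a < c \<and> c < b \<and> b < d)"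

definition matching_on :: "'a set \<Rightarrow> 'a set set \<Rightarrow> bool" where
  "matching_on V Q \<longleftrightarrow> partition_on V Q \<and> (\<forall>B\<in>Q. card B = 2)"

lemma brauer_diagrams_matching: "brauer_diagrams n = {d. matching_on (dots n) d}"
  by (auto simp: brauer_diagrams_def diagrams_def matching_on_def)

lemma tl_diagrams_noncrossing: "tl_diagrams n = {d \<in> brauer_diagrams n. noncrossing d}"
  by (auto simp: tl_diagrams_def noncrossing_def)

lemma matching_partner:
  assumes "matching_on V Q" "u \<in> V"
  obtains u' where "{u, u'} \<in> Q" "u' \<noteq> u" "u' \<in> V"
proof -
  obtain B where B: "B \<in> Q" "u \<in> B" "card B = 2" "B \<subseteq> V"
    using assms by (auto simp: matching_on_def partition_on_def)
  then obtain x y where "B = {x, y}" "x \<noteq> y" by (auto simp: card_2_iff)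
  then have "{u, if u = x then y else x} = B" "(if u = x then y else x) \<noteq> u" using B by auto
  moreover from this(1) have "(if u = x then y else x) \<in> V" using B(4) by blast
  ultimately show ?thesis using B(1) by (intro that) simp_all
qed

lemma matching_unique:
  assumes "matching_on V Q" "{a, b} \<in> Q" "{a, c} \<in> Q"
  shows "b = c"
proof -
  have "{a, b} = {a, c}" using assms partition_on_eqI[of V Q "{a, b}" "{a, c}" a] by (simp add: matching_on_def)
  moreover have "card {a, b} = 2" using assms by (simp add: matching_on_def)
  ultimately show ?thesis by (auto simp: doubleton_eq_iff)
qed

text \<open>Distinct blocks of a matching share no endpoint, so an end of one block strictly between
  the ends of another forces its second end to be there too. This form passes from a point to its
  partner, which is how gluing is handled.\<close>

lemma noncrossing_iff:
  assumes "matching_on V Q"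
  shows "noncrossing Q \<longleftrightarrow> (\<forall>x y c d. {x, y} \<in> Q \<longrightarrow> {c, d} \<in> Q \<longrightarrow> {x, y} \<noteq> {c, d} \<longrightarrow>
    (c < x \<and> x < d \<longrightarrow> c < y \<and> y < d))"
proof
  assume nc: "noncrossing Q"
  show "\<forall>x y c d. {x, y} \<in> Q \<longrightarrow> {c, d} \<in> Q \<longrightarrow> {x, y} \<noteq> {c, d} \<longrightarrow> (c < x \<and> x < d \<longrightarrow> c < y \<and> y < d)"
  proof (intro allI impI)
    fix x y c d assume *: "{x, y} \<in> Q" "{c, d} \<in> Q" "{x, y} \<noteq> {c, d}" "c < x \<and> x < d"
    have "y \<noteq> c" using * matching_unique[OF assms, of y x d] by (auto simp: insert_commute)
    moreover have "y \<noteq> d" using * matching_unique[OF assms, of y x c] by (auto simp: insert_commute)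
    moreover have "\<not> y < c" using * nc unfolding noncrossing_def by (metis insert_commute)
    moreover have "\<not> d < y" using * nc unfolding noncrossing_def by (metis insert_commute)
    ultimately show "c < y \<and> y < d" by linarith
  qed
next
  assume inside: "\<forall>x y c d. {x, y} \<in> Q \<longrightarrow> {c, d} \<in> Q \<longrightarrow> {x, y} \<noteq> {c, d} \<longrightarrow> (c < x \<and> x < d \<longrightarrow> c < y \<and> y < d)"
  show "noncrossing Q"
    unfolding noncrossing_def
  proof (intro notI, elim exE conjE)
    fix a b c d assume *: "{a, b} \<in> Q" "{c, d} \<in> Q" "a < c" "c < b" "b < d"
    have "{b, a} \<noteq> {c, d}" using * by (auto simp: doubleton_eq_iff)
    then show False using inside[rule_format, of b a c d] * by (auto simp: insert_commute)
  qed
qed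

lemma noncrossing_subset: "\<lbrakk>noncrossing Q; S \<subseteq> Q\<rbrakk> \<Longrightarrow> noncrossing S"
  unfolding noncrossing_def by (meson subsetD)

lemma partition_on_Diff: "partition_on V Q \<Longrightarrow> S \<subseteq> Q \<Longrightarrow> partition_on (V - \<Union>S) (Q - S)"
  unfolding partition_on_def disjoint_def by (auto 4 4)

section \<open>Gluing two points of a matching\<close>

lemma eliminate_pair_Un:
  assumes "partition_on V Q" "S \<subseteq> Q" "u \<in> \<Union>S" "v \<in> \<Union>S"
  shows "eliminate {u, v} (insert {u, v} Q) = eliminate {u, v} (insert {u, v} S) \<union> (Q - S)"
proof -
  have P: "partition_on (V - \<Union>S) (Q - S)" using partition_on_Diff assms(1,2) by metis
  then have un: "\<Union>(Q - S) = V - \<Union>S" by (simp add: partition_on_def)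
  have "insert {u, v} Q = insert {u, v} S \<union> (Q - S)" using assms(2) by auto
  moreover have "\<Union>(insert {u, v} S) \<inter> \<Union>(Q - S) = {}" unfolding un using assms(3,4) by auto
  moreover have "eliminate {u, v} (Q - S) = Q - S"
    using eliminate_partition[OF P] assms(3,4) by auto
  ultimately show ?thesis by (metis eliminate_disjoint_Un)
qed

lemma eliminate_pair_block:
  assumes "partition_on V Q" "{u, v} \<in> Q"
  shows "eliminate {u, v} (insert {u, v} Q) = Q - {{u, v}}"
proof -
  have "components {{u, v}} = {{u, v}}" by (rule components_partition[of "{u, v}"]) (simp add: partition_on_def)
  then have "eliminate {u, v} {{u, v}} = {}" by (simp add: eliminate_def)
  then show ?thesis using eliminate_pair_Un[OF assms(1), of "{{u, v}}" u v] assms(2) by simp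
qed

text \<open>Only the three blocks meeting \<open>u\<close> or \<open>v\<close> interact: they form a
  path from \<open>u'\<close> over \<open>u\<close> and \<open>v\<close> to \<open>v'\<close>, of
  which the two ends remain.\<close>

lemma eliminate_pair_join:
  assumes "partition_on V Q" "{u, u'} \<in> Q" "{v, v'} \<in> Q" "u' \<notin> {u, v}" "v' \<notin> {u, v}"
  shows "eliminate {u, v} (insert {u, v} Q) = insert {u', v'} (Q - {{u, u'}, {v, v'}})"
proof -
  let ?Bs = "{{u, v}, {u, u'}, {v, v'}}" and ?C = "{u, v, u', v'}"
  have "components ?Bs = {?C}"
  proof (rule components_eqI)
    have "\<Union>?Bs = ?C" by auto
    then show "partition_on (\<Union>?Bs) {?C}" by (simp add: partition_on_space)
    have uv: "(u, v) \<in> connected_rel ?Bs" by (rule connected_rel_block[of "{u, v}"]) auto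
    have uu: "(u, u') \<in> connected_rel ?Bs" by (rule connected_rel_block[of "{u, u'}"]) auto
    have vv: "(v, v') \<in> connected_rel ?Bs" by (rule connected_rel_block[of "{v, v'}"]) auto
    have root: "(u, x) \<in> connected_rel ?Bs" if "x \<in> ?C" for x
      using that uu uv connected_rel_trans[OF uv vv] connected_rel_refl[of u ?Bs] by auto
    show "(x, y) \<in> connected_rel ?Bs" if "C \<in> {?C}" "x \<in> C" "y \<in> C" for C x y
      using that connected_rel_trans[OF connected_rel_sym[OF root] root, of x y] by auto
  qed auto
  then have "eliminate {u, v} ?Bs = {{u', v'}}"
    using assms(4,5) by (auto simp: eliminate_def)
  then show ?thesis
    using eliminate_pair_Un[OF assms(1), of "{{u, u'}, {v, v'}}" u v] assms(2,3) by auto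
qed

text \<open>If \<open>u\<close> and \<open>v\<close> are partners, their block closes up and
  disappears; otherwise their partners become partners of each other. Planarity survives because no
  third point of \<open>V\<close> lies between \<open>u\<close> and \<open>v\<close>, which is what
  the disjunction in the second part expresses.\<close>

lemma
  assumes Q: "matching_on V Q" and uv: "u \<in> V" "v \<in> V" "u \<noteq> v"
  shows matching_on_eliminate_pair: "matching_on (V - {u, v}) (eliminate {u, v} (insert {u, v} Q))"
    and noncrossing_eliminate_pair:
      "\<lbrakk>noncrossing Q; \<And>x. x \<in> V \<Longrightarrow> x < u \<or> v < x \<or> x \<in> {u, v}; u < v\<rbrakk>
       \<Longrightarrow> noncrossing (eliminate {u, v} (insert {u, v} Q))"
proof -
  let ?E = "eliminate {u, v} (insert {u, v} Q)"
  have P: "partition_on V Q" using Q by (simp add: matching_on_def)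
  have "V - {u, v} = \<Union>(insert {u, v} Q) - {u, v}" using P by (auto simp: partition_on_def)
  then have PE: "partition_on (V - {u, v}) ?E" using partition_on_eliminate by metis
  obtain u' where u': "{u, u'} \<in> Q" "u' \<noteq> u" "u' \<in> V" using matching_partner[OF Q uv(1)] .
  obtain v' where v': "{v, v'} \<in> Q" "v' \<noteq> v" "v' \<in> V" using matching_partner[OF Q uv(2)] .
  have "matching_on (V - {u, v}) ?E \<and> (noncrossing Q \<longrightarrow>
      (\<forall>x\<in>V. x < u \<or> v < x \<or> x \<in> {u, v}) \<longrightarrow> u < v \<longrightarrow> noncrossing ?E)"
  proof (cases "u' = v")
    case True
    then have E: "?E = Q - {{u, v}}" using eliminate_pair_block[OF P] u'(1) by simp
    have "matching_on (V - {u, v}) ?E" using PE Q unfolding E matching_on_def by simp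
    moreover have "noncrossing Q \<Longrightarrow> noncrossing ?E"
      unfolding E by (rule noncrossing_subset) auto
    ultimately show ?thesis by simp
  next
    case False
    have "v' \<noteq> u"
      using matching_unique[OF Q, of u u' v] u'(1) v'(1) False by (auto simp: insert_commute)
    have neq: "{u, u'} \<noteq> {v, v'}" using False uv by (auto simp: doubleton_eq_iff)
    then have "u' \<noteq> v'"
      using partition_on_eqI[OF P u'(1) v'(1), of u'] by auto
    have E: "?E = insert {u', v'} (Q - {{u, u'}, {v, v'}})"
      using eliminate_pair_join[OF P u'(1) v'(1)] False \<open>v' \<noteq> u\<close> u' v' by simp
    have ME: "matching_on (V - {u, v}) ?E"
      using PE Q \<open>u' \<noteq> v'\<close> unfolding matching_on_def E by simp
    moreover have "noncrossing ?E"
      if nc: "noncrossing Q" and adj: "\<forall>x\<in>V. x < u \<or> v < x \<or> x \<in> {u, v}" and "u < v"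
    proof -
      have in_V: "x \<in> V" if "{x, y} \<in> Q" for x y using that P by (auto simp: partition_on_def)
      have iff: "c < x \<and> x < d \<longleftrightarrow> c < y \<and> y < d"
        if *: "{x, y} \<in> Q" "{c, d} \<in> Q" "{x, y} \<noteq> {c, d}" for x y c d
      proof -
        have inside: "c < s \<and> s < d \<Longrightarrow> c < t \<and> t < d" if "{s, t} \<in> Q" "{s, t} \<noteq> {c, d}" for s t
          using nc that *(2) unfolding noncrossing_iff[OF Q] by simp
        have "{y, x} \<in> Q" "{y, x} \<noteq> {c, d}" using * by (simp_all add: insert_commute)
        then show ?thesis using inside[OF *(1,3)] inside by blast
      qed
      text \<open>A chord disjoint from the adjacent points \<open>u\<close> and \<open>v\<close> has both of them on the same side,
        hence also their partners.\<close>
      have same_side: "c < u' \<and> u' < d \<longleftrightarrow> c < v' \<and> v' < d"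
        if cd: "{c, d} \<in> Q" "{c, d} \<noteq> {u, u'}" "{c, d} \<noteq> {v, v'}" for c d
      proof -
        have "c \<notin> {u, v}" "d \<notin> {u, v}"
          using cd partition_on_eqI[OF P cd(1) u'(1)] partition_on_eqI[OF P cd(1) v'(1)] by auto
        then have "c < u \<or> v < c" "d < u \<or> v < d"
          using adj in_V[OF cd(1)] in_V[of d c] cd(1) by (auto simp: insert_commute)
        then have "c < u \<and> u < d \<longleftrightarrow> c < v \<and> v < d" using \<open>u < v\<close> by linarith
        then show ?thesis using iff[OF u'(1) cd(1)] iff[OF v'(1) cd(1)] cd(2,3)[symmetric] by simp
      qed
      show ?thesis unfolding noncrossing_def
      proof (intro notI, elim exE conjE)
        fix a b c d assume ab: "{a, b} \<in> ?E" and cd: "{c, d} \<in> ?E" and lt: "a < c" "c < b" "b < d"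
        have "{a, b} \<noteq> {c, d}" using lt by (auto simp: doubleton_eq_iff)
        \<comment> \<open>At most one of two crossing blocks is the new block
          \<open>{u', v'}\<close>, and the other one was not among the removed blocks, so
          \<open>same_side\<close> applies to it.\<close>
        then consider "{a, b} \<in> Q" "{c, d} \<in> Q"
          | "{a, b} = {u', v'}" "{c, d} \<in> Q" "{c, d} \<noteq> {u, u'}" "{c, d} \<noteq> {v, v'}"
          | "{c, d} = {u', v'}" "{a, b} \<in> Q" "{a, b} \<noteq> {u, u'}" "{a, b} \<noteq> {v, v'}"
          using ab cd lt unfolding E insert_iff Diff_iff empty_iff by metis
        then show False
        proof cases
          case 1
          then show ?thesis using nc lt unfolding noncrossing_def by blast
        next
          case 2
          then show ?thesis using same_side[OF 2(2-4)] lt by (auto simp: doubleton_eq_iff)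
        next
          case 3
          then show ?thesis using same_side[OF 3(2-4)] lt by (auto simp: doubleton_eq_iff)
        qed
      qed
    qed
    ultimately show ?thesis by blast
  qed
  then show "matching_on (V - {u, v}) ?E"
    and "\<lbrakk>noncrossing Q; \<And>x. x \<in> V \<Longrightarrow> x < u \<or> v < x \<or> x \<in> {u, v}; u < v\<rbrakk> \<Longrightarrow> noncrossing ?E"
    by blast+
qed

text \<open>The innermost pair \<open>{-1, 1}\<close> is glued first: after the pairs \<open>{-s, s}\<close> with \<open>s < t\<close> are gone,
  \<open>-t\<close> and \<open>t\<close> are adjacent.\<close>

lemma
  fixes V :: "int set"
  assumes Q: "matching_on V Q" and V: "0 \<notin> V" "\<And>s. s \<in> {1..int t} \<Longrightarrow> - s \<in> V \<and> s \<in> V"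
  shows matching_on_glue:
      "matching_on (V - {- int t..int t}) (eliminate {- int t..int t} (Q \<union> (\<lambda>s. {- s, s}) ` {1..int t}))"
    and noncrossing_glue: "noncrossing Q \<Longrightarrow>
      noncrossing (eliminate {- int t..int t} (Q \<union> (\<lambda>s. {- s, s}) ` {1..int t}))"
proof -
  have "matching_on (V - {- int t..int t}) (eliminate {- int t..int t} (Q \<union> (\<lambda>s. {- s, s}) ` {1..int t})) \<and>
    (noncrossing Q \<longrightarrow> noncrossing (eliminate {- int t..int t} (Q \<union> (\<lambda>s. {- s, s}) ` {1..int t})))"
    using V(2)
  proof (induction t)
    case 0
    \<comment> \<open>For \<open>t = 0\<close> the interval is \<open>{0}\<close> rather than empty;
      nothing happens because 0 is not a point of \<open>V\<close>.\<close>
    have "eliminate {0} Q = Q" using Q V(1) by (intro eliminate_partition[of V]) (auto simp: matching_on_def)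
    then show ?case using Q V(1) by simp
  next
    case (Suc t)
    let ?C = "\<lambda>t. (\<lambda>s. {- s, s}) ` {1..int t}" and ?I = "\<lambda>t. {- int t..int t}"
    let ?u = "- int (Suc t)" and ?v = "int (Suc t)"
    let ?E = "eliminate (?I t) (Q \<union> ?C t)"
    have IH: "matching_on (V - ?I t) ?E" "noncrossing Q \<longrightarrow> noncrossing ?E"
      using Suc by auto
    have "{1..int (Suc t)} = insert ?v {1..int t}" by auto
    then have C: "Q \<union> ?C (Suc t) = (Q \<union> ?C t) \<union> {{?u, ?v}}" by auto
    have I: "?I (Suc t) = ?I t \<union> {?u, ?v}" by auto
    \<comment> \<open>The block added in this round avoids the interval eliminated so far, as
      two-step elimination requires.\<close>
    have "eliminate (?I (Suc t)) (Q \<union> ?C (Suc t)) = eliminate {?u, ?v} (?E \<union> {{?u, ?v}})"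
      unfolding C I by (rule eliminate_eliminate_Un[symmetric]) auto
    then have step: "eliminate (?I (Suc t)) (Q \<union> ?C (Suc t)) = eliminate {?u, ?v} (insert {?u, ?v} ?E)" by simp
    have uv: "?u \<in> V - ?I t" "?v \<in> V - ?I t" "?u \<noteq> ?v" using Suc.prems[of ?v] by auto
    have "V - ?I (Suc t) = (V - ?I t) - {?u, ?v}" unfolding I by blast
    moreover have nc: "noncrossing Q \<longrightarrow> noncrossing (eliminate {?u, ?v} (insert {?u, ?v} ?E))"
    proof
      assume "noncrossing Q"
      then show "noncrossing (eliminate {?u, ?v} (insert {?u, ?v} ?E))"
        using IH(2) by (intro noncrossing_eliminate_pair[OF IH(1) uv]) auto
    qed
    ultimately show ?case
      using matching_on_eliminate_pair[OF IH(1) uv] nc unfolding step by simp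
  qed
  then show "matching_on (V - {- int t..int t}) (eliminate {- int t..int t} (Q \<union> (\<lambda>s. {- s, s}) ` {1..int t}))"
    and "noncrossing Q \<Longrightarrow> noncrossing (eliminate {- int t..int t} (Q \<union> (\<lambda>s. {- s, s}) ` {1..int t}))"
    by blast+
qed

text \<open>All dots of a stacked picture are put on a line, with \<open>p\<close> to the left of \<open>r\<close>, so that dot
  \<open>k\<close> of \<open>p\<close> and dot \<open>-k\<close> of \<open>r\<close> become the opposite numbers \<open>k - n - 1\<close> and \<open>n + 1 - k\<close>.\<close>

lemma diagram_comp_on_line:
  assumes p: "p \<in> diagrams n" and r: "r \<in> diagrams n"
  defines "N \<equiv> int n + 1"
  shows "(`) (\<lambda>i. if i < 0 then i - N else i + N) ` diagram_comp p r
    = eliminate {- int n..int n}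
        (((`) (\<lambda>i. i - N) ` p \<union> (`) (\<lambda>i. i + N) ` r) \<union> (\<lambda>s. {- s, s}) ` {1..int n})"
proof -
  \<comment> \<open>The middle column is sent to the positions of the right dots of
    \<open>p\<close>. The left dots of \<open>r\<close> stand at the opposite positions and reach
    them through the connectors.\<close>
  define f :: "nat \<times> nat \<Rightarrow> int" where
    "f = (\<lambda>(c, k). if c = 0 then - int k - N else if c = 1 then int k - N else int k + N)"
  let ?p = "(`) (\<lambda>i. i - N) ` p" and ?r = "(`) (\<lambda>i. i + N) ` r"
  let ?conn = "(\<lambda>s. {- s, s}) ` {1..int n}"
  have f_draw: "(`) f ` draw a b q = (`) (\<lambda>i. f (dot_at a b i)) ` q" for a b q
    by (simp add: draw_def image_image)
  have p_line: "(`) f ` draw 0 1 p = ?p"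
    unfolding f_draw by (intro image_cong refl) (auto simp: f_def dot_at_def)
  let ?V = "(\<lambda>i. i + N) ` dots n"
  have Q: "partition_on ?V ?r"
    using r by (intro partition_on_inj_image') (auto simp: diagrams_def inj_on_def)
  have V: "?V = {1..int n} \<union> {N + 1..N + int n}"
  proof (intro equalityI subsetI)
    fix x assume "x \<in> {1..int n} \<union> {N + 1..N + int n}"
    then have "x - N \<in> dots n" by (auto simp: dots_def N_def)
    then show "x \<in> ?V" by (intro image_eqI[of _ _ "x - N"]) auto
  qed (auto simp: dots_def N_def)
  \<comment> \<open>Eliminating the positive ends of the connectors first reflects the left dots of
    \<open>r\<close> to the negative side and so produces the three-column picture. The rest of the
    interval, \<open>{- int n..0}\<close>, then plays the part of its middle column; nothing sits at
    0.\<close>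
  have "eliminate {1..int n} (?conn \<union> ?r) = (`) (\<lambda>x. if x \<in> {1..int n} then - x else x) ` ?r"
    using Q[unfolded V] by (rule eliminate_connectors(1)) (auto simp: N_def inj_on_def)
  also have "\<dots> = (`) f ` draw 1 2 r"
  proof -
    have eq: "(if i + N \<in> {1..int n} then - (i + N) else i + N) = f (dot_at 1 2 i)" if "i \<in> dots n" for i
      using that by (auto simp: f_def dot_at_def dots_def N_def)
    have "(\<lambda>i. if i + N \<in> {1..int n} then - (i + N) else i + N) ` B = (\<lambda>i. f (dot_at 1 2 i)) ` B" if "B \<in> r" for B
      using that Union_diagram[OF r] by (intro image_cong refl eq) blast
    then show ?thesis unfolding f_draw image_image by (rule image_cong[OF refl])
  qed
  finally have r_line: "eliminate {1..int n} (?conn \<union> ?r) = (`) f ` draw 1 2 r" .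
  have un: "\<Union>(draw 0 1 p \<union> draw 1 2 r) = {0, 1, 2} \<times> {1..n}"
    using Union_draw[OF p, of 0 1] Union_draw[OF r, of 1 2] by auto
  have un_p: "\<Union>?p = (\<lambda>i. i - N) ` dots n" unfolding Union_diagram[OF p, symmetric] by blast
  have inj: "inj_on f (\<Union>(draw 0 1 p \<union> draw 1 2 r))"
    unfolding un by (auto simp: inj_on_def f_def N_def)
  have W: "f x \<in> {- int n..0} \<longleftrightarrow> x \<in> {1} \<times> UNIV" if "x \<in> \<Union>(draw 0 1 p \<union> draw 1 2 r)" for x
    using that unfolding un by (auto simp: f_def N_def)
  have out: "(`) f ` draw 0 2 q = (`) (\<lambda>i. if i < 0 then i - N else i + N) ` q" for q
    unfolding f_draw by (intro image_cong refl) (auto simp: f_def dot_at_def)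
  have "eliminate {- int n..int n} ((?p \<union> ?r) \<union> ?conn)
      = eliminate ({1..int n} \<union> {- int n..0}) ((?conn \<union> ?r) \<union> ?p)"
    by (rule arg_cong2[where f = eliminate]) auto
  also have "\<dots> = eliminate {- int n..0} (eliminate {1..int n} (?conn \<union> ?r) \<union> ?p)"
  proof (rule eliminate_eliminate_Un[symmetric])
    show "\<Union>?p \<inter> {1..int n} = {}" unfolding un_p by (auto simp: dots_def N_def)
  qed
  also have "\<dots> = eliminate {- int n..0} ((`) f ` (draw 0 1 p \<union> draw 1 2 r))"
    unfolding r_line p_line[symmetric] by (simp add: image_Un Un_commute)
  also have "\<dots> = (`) f ` draw 0 2 (diagram_comp p r)"
    unfolding draw_diagram_comp_0_2[OF p r] by (rule eliminate_image[OF inj W])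
  finally show ?thesis unfolding out ..
qed

section \<open>Closure of Brauer and Temperley-Lieb diagrams under composition and stacking\<close>

lemma noncrossing_image_iff:
  assumes f: "strict_mono_on V f" and Q: "\<Union>Q \<subseteq> V"
  shows "noncrossing ((`) f ` Q) \<longleftrightarrow> noncrossing Q"
proof
  have inj: "inj_on f V" using f by (rule strict_mono_on_imp_inj_on)
  assume nc: "noncrossing ((`) f ` Q)"
  show "noncrossing Q" unfolding noncrossing_def
  proof (intro notI, elim exE conjE)
    fix a b c d assume *: "{a, b} \<in> Q" "{c, d} \<in> Q" "a < c" "c < b" "b < d"
    then have "a \<in> V" "b \<in> V" "c \<in> V" "d \<in> V" using Q by auto
    then have "f a < f c" "f c < f b" "f b < f d" using * f by (auto simp: strict_mono_on_def)
    moreover have "{f a, f b} \<in> (`) f ` Q" "{f c, f d} \<in> (`) f ` Q"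
      using *(1,2) by (auto intro!: image_eqI[of _ _ "{_, _}"])
    ultimately show False using nc unfolding noncrossing_def by blast
  qed
next
  assume nc: "noncrossing Q"
  show "noncrossing ((`) f ` Q)" unfolding noncrossing_def
  proof (intro notI, elim exE conjE)
    fix a b c d assume *: "{a, b} \<in> (`) f ` Q" "{c, d} \<in> (`) f ` Q" "a < c" "c < b" "b < d"
    have pre: "\<exists>x y. {x, y} \<in> Q \<and> f x = a \<and> f y = b" if image: "{a, b} \<in> (`) f ` Q" for a b
    proof -
      obtain B where B: "B \<in> Q" "{a, b} = f ` B" using image by blast
      obtain x y where xy: "x \<in> B" "y \<in> B" "f x = a" "f y = b" using B(2) by (metis imageE insertCI)
      have "B \<subseteq> {x, y}"
      proof
        fix z assume z: "z \<in> B"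
        then have "f z = f x \<or> f z = f y" using B(2) xy by blast
        moreover have "B \<subseteq> V" using B Q by blast
        ultimately show "z \<in> {x, y}" using strict_mono_on_imp_inj_on[OF f] z xy by (auto simp: inj_on_def)
      qed
      then have "B = {x, y}" using xy by blast
      then show ?thesis using B xy by blast
    qed
    obtain x y where xy: "{x, y} \<in> Q" "f x = a" "f y = b" using pre[OF *(1)] by blast
    obtain z w where zw: "{z, w} \<in> Q" "f z = c" "f w = d" using pre[OF *(2)] by blast
    have "x \<in> V" "y \<in> V" "z \<in> V" "w \<in> V" using xy zw Q by auto
    then have "x < z" "z < y" "y < w" using * xy zw strict_mono_on_less[OF f] by auto
    then show False using nc xy zw unfolding noncrossing_def by blast
  qed
qed

lemma matching_on_image: "\<lbrakk>matching_on V Q; inj_on f V\<rbrakk> \<Longrightarrow> matching_on (f ` V) ((`) f ` Q)"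
proof -
  assume Q: "matching_on V Q" and f: "inj_on f V"
  have "card (f ` B) = 2" if "B \<in> Q" for B
  proof -
    have "B \<subseteq> V" "card B = 2" using Q that by (auto simp: matching_on_def partition_on_def)
    then show ?thesis using card_image[OF inj_on_subset[OF f]] by simp
  qed
  then show ?thesis using Q f by (auto simp: matching_on_def intro: partition_on_inj_image')
qed

lemma matching_on_Un:
  "\<lbrakk>matching_on V P; matching_on W Q; V \<inter> W = {}\<rbrakk> \<Longrightarrow> matching_on (V \<union> W) (P \<union> Q)"
  by (auto simp: matching_on_def partition_on_Un)

text \<open>The two alternatives are the two ways of combining diagrams: side by side on the line
  for composition, and one around the other for stacking, where the second family lies outside
  \<open>[- m, m]\<close>.\<close>

lemma noncrossing_Un:
  assumes "noncrossing P" "noncrossing Q"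
    and sep: "(\<forall>x\<in>\<Union>P. \<forall>y\<in>\<Union>Q. x < y) \<or> (\<exists>m. (\<forall>x\<in>\<Union>P. \<bar>x\<bar> \<le> m) \<and> (\<forall>y\<in>\<Union>Q. m < \<bar>y\<bar>))"
  shows "noncrossing (P \<union> Q)"
  unfolding noncrossing_def
proof (intro notI, elim exE conjE)
  fix a b c d assume *: "{a, b} \<in> P \<union> Q" "{c, d} \<in> P \<union> Q" "a < c" "c < b" "b < d"
  have "\<not> ({a, b} \<in> P \<and> {c, d} \<in> P)" "\<not> ({a, b} \<in> Q \<and> {c, d} \<in> Q)"
    using assms(1,2) * unfolding noncrossing_def by blast+
  then consider "{a, b} \<subseteq> \<Union>P" "{c, d} \<subseteq> \<Union>Q" | "{a, b} \<subseteq> \<Union>Q" "{c, d} \<subseteq> \<Union>P" using * by blast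
  then show False
  proof cases
    case 1
    then have "a \<in> \<Union>P" "b \<in> \<Union>P" "c \<in> \<Union>Q" by simp_all
    then have "b < c \<or> (\<exists>m. \<bar>a\<bar> \<le> m \<and> \<bar>b\<bar> \<le> m \<and> m < \<bar>c\<bar>)" using sep by metis
    then show ?thesis using * by auto
  next
    case 2
    then have "c \<in> \<Union>P" "d \<in> \<Union>P" "a \<in> \<Union>Q" "b \<in> \<Union>Q" by simp_all
    then have "c < a \<or> (\<exists>m. \<bar>c\<bar> \<le> m \<and> \<bar>d\<bar> \<le> m \<and> m < \<bar>b\<bar>)" using sep by metis
    then show ?thesis using * by auto
  qed
qed

text \<open>Spread apart by a strictly increasing map, the blocks of the composite are those of the
  glued line picture, so block sizes and planarity can be read off there.\<close>

lemma
  assumes p: "p \<in> brauer_diagrams n" and r: "r \<in> brauer_diagrams n"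
  shows brauer_diagram_comp_closed: "diagram_comp p r \<in> brauer_diagrams n"
    and noncrossing_diagram_comp:
      "\<lbrakk>noncrossing p; noncrossing r\<rbrakk> \<Longrightarrow> noncrossing (diagram_comp p r)"
proof -
  define N where "N = int n + 1"
  let ?g = "\<lambda>i. if i < 0 then i - N else i + N"
  let ?p = "(`) (\<lambda>i. i - N) ` p" and ?r = "(`) (\<lambda>i. i + N) ` r"
  have mp: "matching_on (dots n) p" and mr: "matching_on (dots n) r"
    using p r by (simp_all add: brauer_diagrams_matching)
  have d: "p \<in> diagrams n" "r \<in> diagrams n" using p r by (simp_all add: brauer_diagrams_def)
  let ?V = "(\<lambda>i. i - N) ` dots n \<union> (\<lambda>i. i + N) ` dots n"
  have Q: "matching_on ?V (?p \<union> ?r)"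
    by (intro matching_on_Un matching_on_image mp mr) (auto simp: inj_on_def dots_def N_def)
  have in_V: "- s \<in> ?V \<and> s \<in> ?V" if s: "s \<in> {1..int n}" for s
  proof -
    have "- s + N \<in> dots n" "s - N \<in> dots n" using s by (auto simp: dots_def N_def)
    then have "(- s + N) - N \<in> ?V" "(s - N) + N \<in> ?V" by blast+
    then show ?thesis by simp
  qed
  have V0: "0 \<notin> ?V" by (auto simp: dots_def N_def)
  note line = diagram_comp_on_line[OF d, folded N_def]
  have "matching_on (?V - {- int n..int n}) ((`) ?g ` diagram_comp p r)"
    unfolding line using matching_on_glue[OF Q V0 in_V] .
  moreover have g: "inj_on ?g (dots n)" "strict_mono_on (dots n) ?g"
    by (auto simp: inj_on_def strict_mono_on_def dots_def N_def)
  moreover have "\<Union>(diagram_comp p r) = dots n" using Union_diagram[OF diagram_comp_closed[OF d]] .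
  ultimately have "card B = 2" if "B \<in> diagram_comp p r" for B
    using that card_image[of ?g B] inj_on_subset[OF g(1), of B] Union_upper[OF that]
    by (auto simp: matching_on_def)
  then show "diagram_comp p r \<in> brauer_diagrams n"
    using diagram_comp_closed[OF d] by (simp add: brauer_diagrams_def)
  assume nc: "noncrossing p" "noncrossing r"
  have "noncrossing ?p" "noncrossing ?r"
    using nc by (simp_all add: noncrossing_image_iff[of UNIV] strict_mono_on_def)
  moreover have "\<Union>?p = (\<lambda>i. i - N) ` dots n" "\<Union>?r = (\<lambda>i. i + N) ` dots n"
    using Union_diagram[OF d(1)] Union_diagram[OF d(2)] by (simp_all flip: image_Union)
  \<comment> \<open>The offset \<open>N = int n + 1\<close> puts all dots of \<open>p\<close> below
    0 and all dots of \<open>r\<close> above 0.\<close>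
  ultimately have "noncrossing (?p \<union> ?r)"
    by (intro noncrossing_Un disjI1) (auto simp: dots_def N_def)
  then have "noncrossing ((`) ?g ` diagram_comp p r)"
    unfolding line using noncrossing_glue[OF Q V0 in_V] by blast
  then show "noncrossing (diagram_comp p r)"
    using noncrossing_image_iff[OF g(2), of "diagram_comp p r"] Union_diagram[OF diagram_comp_closed[OF d]]
    by simp
qed

lemma tl_diagram_comp_closed:
  "\<lbrakk>p \<in> tl_diagrams n; r \<in> tl_diagrams n\<rbrakk> \<Longrightarrow> diagram_comp p r \<in> tl_diagrams n"
  unfolding tl_diagrams_noncrossing using brauer_diagram_comp_closed noncrossing_diagram_comp by blast

lemma brauer_diagram_on_top_closed:
  assumes "p \<in> brauer_diagrams a" "q \<in> brauer_diagrams b"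
  shows "diagram_on_top a p q \<in> brauer_diagrams (a + b)"
  using assms unfolding brauer_diagrams_matching diagram_on_top_def dots_add mem_Collect_eq
  by (intro matching_on_Un matching_on_image)
     (auto simp: dots_def shift_dot_def intro: inj_on_subset[OF inj_shift_dot])

text \<open>In the order of the integers the lower diagram surrounds the upper one: its dots have
  absolute value larger than \<open>a\<close>.\<close>

lemma tl_diagram_on_top_closed:
  assumes "p \<in> tl_diagrams a" "q \<in> tl_diagrams b"
  shows "diagram_on_top a p q \<in> tl_diagrams (a + b)"
proof -
  have br: "p \<in> brauer_diagrams a" "q \<in> brauer_diagrams b" and nc: "noncrossing p" "noncrossing q"
    using assms by (simp_all add: tl_diagrams_noncrossing)
  then have un: "\<Union>p = dots a" "\<Union>q = dots b"
    by (simp_all add: brauer_diagrams_def Union_diagram)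
  have un': "\<Union>((`) (shift_dot a) ` q) = shift_dot a ` dots b" unfolding un[symmetric] by blast
  have "noncrossing ((`) (shift_dot a) ` q)"
    using nc noncrossing_image_iff[of UNIV "shift_dot a" q]
    by (auto simp: strict_mono_on_def shift_dot_def)
  then have "noncrossing (diagram_on_top a p q)"
    unfolding diagram_on_top_def using nc un un'
    by (intro noncrossing_Un disjI2 exI[of _ "int a"]) (auto simp: dots_def shift_dot_def)
  then show ?thesis using brauer_diagram_on_top_closed[OF br] by (simp add: tl_diagrams_noncrossing)
qed

lemma id_diagram_brauer: "id_diagram n \<in> brauer_diagrams n"
  using id_diagram_closed by (auto simp: brauer_diagrams_def id_diagram_image)

lemma id_diagram_tl: "id_diagram n \<in> tl_diagrams n"
  using id_diagram_brauer
  by (auto simp: tl_diagrams_noncrossing noncrossing_def id_diagram_image doubleton_eq_iff)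

section \<open>Quotient modules, free modules and tensor products with the ground ring\<close>

lemma (in module) submodule_module_span:
  assumes "S \<subseteq> carrier M"
  shows "submodule (module_span R M S) R M"
proof -
  let ?Hs = "{H. submodule H R M \<and> S \<subseteq> H}"
  have car: "carrier M \<in> ?Hs" using assms carrier_is_submodule by simp
  show ?thesis
    unfolding module_span_def
  proof (rule submoduleI)
    show "\<Inter>?Hs \<subseteq> carrier M" using car by blast
    show "\<zero>\<^bsub>M\<^esub> \<in> \<Inter>?Hs"
    proof (rule InterI)
      fix H assume "H \<in> ?Hs"
      then have "subgroup H (add_monoid M)" using submodule.axioms(1) by auto
      then show "\<zero>\<^bsub>M\<^esub> \<in> H" using subgroup.one_closed by force
    qed
  qed (auto dest: submoduleE)
qed

lemma module_span_superset: "S \<subseteq> module_span R M S"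
  unfolding module_span_def by blast

lemma module_span_least: "\<lbrakk>submodule H R M; S \<subseteq> H\<rbrakk> \<Longrightarrow> module_span R M S \<subseteq> H"
  unfolding module_span_def by blast

lemma (in module) submodule_zero: "submodule H R M \<Longrightarrow> \<zero>\<^bsub>M\<^esub> \<in> H"
  using subgroup.one_closed[OF submodule.axioms(1)] by force

lemma (in module) submoduleI':
  assumes "H \<subseteq> carrier M" "\<zero>\<^bsub>M\<^esub> \<in> H"
    and "\<And>a b. \<lbrakk>a \<in> H; b \<in> H\<rbrakk> \<Longrightarrow> a \<oplus>\<^bsub>M\<^esub> b \<in> H"
    and "\<And>a x. \<lbrakk>a \<in> carrier R; x \<in> H\<rbrakk> \<Longrightarrow> a \<odot>\<^bsub>M\<^esub> x \<in> H"
  shows "submodule H R M"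
proof (rule submoduleI)
  fix a assume "a \<in> H"
  moreover from this have "a \<in> carrier M" using assms(1) by blast
  ultimately show "\<ominus>\<^bsub>M\<^esub> a \<in> H"
    using assms(4)[of "\<ominus> \<one>" a] smult_l_minus[of \<one> a] by simp
qed (use assms in blast)+

lemma
  fixes f :: "'m \<Rightarrow> 'n"
  assumes M: "module R M" and N: "module R N"
    and closed: "\<And>x. x \<in> carrier M \<Longrightarrow> f x \<in> carrier N"
    and add: "\<And>x y. \<lbrakk>x \<in> carrier M; y \<in> carrier M\<rbrakk> \<Longrightarrow> f (x \<oplus>\<^bsub>M\<^esub> y) = f x \<oplus>\<^bsub>N\<^esub> f y"
    and smult: "\<And>a x. \<lbrakk>a \<in> carrier R; x \<in> carrier M\<rbrakk> \<Longrightarrow> f (a \<odot>\<^bsub>M\<^esub> x) = a \<odot>\<^bsub>N\<^esub> f x"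
  shows module_map_zero: "f \<zero>\<^bsub>M\<^esub> = \<zero>\<^bsub>N\<^esub>"
    and module_map_minus: "\<lbrakk>x \<in> carrier M; y \<in> carrier M\<rbrakk> \<Longrightarrow> f (x \<ominus>\<^bsub>M\<^esub> y) = f x \<ominus>\<^bsub>N\<^esub> f y"
proof -
  interpret M: module R M by (rule M)
  interpret N: module R N by (rule N)
  show "f \<zero>\<^bsub>M\<^esub> = \<zero>\<^bsub>N\<^esub>"
    using smult[of "\<zero>\<^bsub>R\<^esub>" "\<zero>\<^bsub>M\<^esub>"] closed[of "\<zero>\<^bsub>M\<^esub>"] by simp
  assume xy: "x \<in> carrier M" "y \<in> carrier M"
  have "\<ominus>\<^bsub>M\<^esub> y = (\<ominus>\<^bsub>R\<^esub> \<one>\<^bsub>R\<^esub>) \<odot>\<^bsub>M\<^esub> y" using M.smult_l_minus[of "\<one>\<^bsub>R\<^esub>" y] xy by simp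
  then have "f (\<ominus>\<^bsub>M\<^esub> y) = \<ominus>\<^bsub>N\<^esub> f y"
    using smult[of "\<ominus>\<^bsub>R\<^esub> \<one>\<^bsub>R\<^esub>" y] N.smult_l_minus[of "\<one>\<^bsub>R\<^esub>" "f y"] xy closed by simp
  then show "f (x \<ominus>\<^bsub>M\<^esub> y) = f x \<ominus>\<^bsub>N\<^esub> f y" using xy add[of x "\<ominus>\<^bsub>M\<^esub> y"] by (simp add: a_minus_def)
qed

lemma (in module) smult_minus_right:
  "\<lbrakk>a \<in> carrier R; x \<in> carrier M; y \<in> carrier M\<rbrakk> \<Longrightarrow> a \<odot>\<^bsub>M\<^esub> (x \<ominus>\<^bsub>M\<^esub> y) = a \<odot>\<^bsub>M\<^esub> x \<ominus>\<^bsub>M\<^esub> a \<odot>\<^bsub>M\<^esub> y"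
  by (simp add: a_minus_def smult_r_distr smult_r_minus)

lemma (in module) a_coset_eq_iff:
  assumes N: "submodule N R M" and "x \<in> carrier M" "y \<in> carrier M"
  shows "N +>\<^bsub>M\<^esub> x = N +>\<^bsub>M\<^esub> y \<longleftrightarrow> x \<ominus>\<^bsub>M\<^esub> y \<in> N"
proof -
  interpret S: abelian_subgroup N M
    using abelian_subgroupI2[OF a_comm_group submodule.axioms(1)[OF N]] .
  show ?thesis
    using S.a_rcos_module[OF assms(3,2)] S.a_rcos_self[OF assms(2)]
      S.a_repr_independence'[OF _ assms(3), of x] by (auto simp: a_minus_def)
qed

lemma (in module)
  assumes N: "submodule N R M"
  shows carrier_quotient_module: "carrier (quotient_module M N) = (\<lambda>x. N +>\<^bsub>M\<^esub> x) ` carrier M"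
    and quotient_module_add: "\<lbrakk>x \<in> carrier M; y \<in> carrier M\<rbrakk> \<Longrightarrow>
      (N +>\<^bsub>M\<^esub> x) \<oplus>\<^bsub>quotient_module M N\<^esub> (N +>\<^bsub>M\<^esub> y) = N +>\<^bsub>M\<^esub> (x \<oplus>\<^bsub>M\<^esub> y)"
    and quotient_module_smult: "\<lbrakk>a \<in> carrier R; x \<in> carrier M\<rbrakk> \<Longrightarrow>
      a \<odot>\<^bsub>quotient_module M N\<^esub> (N +>\<^bsub>M\<^esub> x) = N +>\<^bsub>M\<^esub> (a \<odot>\<^bsub>M\<^esub> x)"
    and quotient_module_zero: "\<zero>\<^bsub>quotient_module M N\<^esub> = N +>\<^bsub>M\<^esub> \<zero>\<^bsub>M\<^esub>"
proof -
  interpret S: abelian_subgroup N M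
    using abelian_subgroupI2[OF a_comm_group submodule.axioms(1)[OF N]] .
  show "carrier (quotient_module M N) = (\<lambda>x. N +>\<^bsub>M\<^esub> x) ` carrier M"
    by (auto simp: quotient_module_def A_RCOSETS_def RCOSETS_def a_r_coset_def)
  show "(N +>\<^bsub>M\<^esub> x) \<oplus>\<^bsub>quotient_module M N\<^esub> (N +>\<^bsub>M\<^esub> y) = N +>\<^bsub>M\<^esub> (x \<oplus>\<^bsub>M\<^esub> y)"
    if "x \<in> carrier M" "y \<in> carrier M"
    using S.a_rcos_sum[OF that] by (simp add: quotient_module_def)
  show "\<zero>\<^bsub>quotient_module M N\<^esub> = N +>\<^bsub>M\<^esub> \<zero>\<^bsub>M\<^esub>"
    using S.a_rcos_const[OF submodule_zero[OF N]] by (simp add: quotient_module_def)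
  show "a \<odot>\<^bsub>quotient_module M N\<^esub> (N +>\<^bsub>M\<^esub> x) = N +>\<^bsub>M\<^esub> (a \<odot>\<^bsub>M\<^esub> x)"
    if a: "a \<in> carrier R" and x: "x \<in> carrier M"
  proof -
    \<comment> \<open>The scalar multiple of a coset is defined as a union over its elements. All
      members of that union are the same coset, because \<open>N\<close> is closed under
      scalars.\<close>
    have const: "N +>\<^bsub>M\<^esub> (a \<odot>\<^bsub>M\<^esub> y) = N +>\<^bsub>M\<^esub> (a \<odot>\<^bsub>M\<^esub> x)" if y: "y \<in> N +>\<^bsub>M\<^esub> x" for y
    proof -
      have "y \<in> carrier M" using S.a_elemrcos_carrier[OF x y] .
      moreover have "y \<ominus>\<^bsub>M\<^esub> x \<in> N" unfolding a_minus_def using S.a_rcos_module_imp[OF x y] .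
      ultimately have "a \<odot>\<^bsub>M\<^esub> y \<ominus>\<^bsub>M\<^esub> a \<odot>\<^bsub>M\<^esub> x \<in> N"
        using submodule.smult_closed[OF N a, of "y \<ominus>\<^bsub>M\<^esub> x"] smult_minus_right[OF a _ x, of y] by metis
      then show ?thesis
        using a_coset_eq_iff[OF N] smult_closed[OF a] x \<open>y \<in> carrier M\<close> by metis
    qed
    have "N +>\<^bsub>M\<^esub> x \<noteq> {}" using S.a_rcos_self[OF x] by blast
    then have "(\<Union>y\<in>N +>\<^bsub>M\<^esub> x. N +>\<^bsub>M\<^esub> (a \<odot>\<^bsub>M\<^esub> y)) = N +>\<^bsub>M\<^esub> (a \<odot>\<^bsub>M\<^esub> x)"
      using const by (rule SUP_eq_const)
    then show ?thesis by (simp add: quotient_module_def)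
  qed
qed

lemma (in module) module_quotient_module:
  assumes N: "submodule N R M"
  shows "module R (quotient_module M N)"
proof (rule moduleI)
  note Q = carrier_quotient_module[OF N] quotient_module_add[OF N] quotient_module_smult[OF N]
    quotient_module_zero[OF N]
  show "cring R" by (rule R.is_cring)
  show "abelian_group (quotient_module M N)"
  proof (rule abelian_groupI)
    fix x assume "x \<in> carrier (quotient_module M N)"
    then obtain a where "a \<in> carrier M" "x = N +>\<^bsub>M\<^esub> a" unfolding Q(1) by blast
    then show "\<exists>y\<in>carrier (quotient_module M N). y \<oplus>\<^bsub>quotient_module M N\<^esub> x = \<zero>\<^bsub>quotient_module M N\<^esub>"
      by (intro bexI[of _ "N +>\<^bsub>M\<^esub> (\<ominus>\<^bsub>M\<^esub> a)"]) (simp_all add: Q M.l_neg)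
  qed (auto simp: Q M.a_ac)
qed (auto simp: carrier_quotient_module[OF N] quotient_module_add[OF N] quotient_module_smult[OF N]
    smult_l_distr smult_r_distr smult_assoc1)

section \<open>Free modules and linear extension\<close>

lemma free_module_simps [simp]:
  "\<zero>\<^bsub>free_module R S\<^esub> = (\<lambda>s. \<zero>\<^bsub>R\<^esub>)"
  "x \<oplus>\<^bsub>free_module R S\<^esub> y = (\<lambda>s. x s \<oplus>\<^bsub>R\<^esub> y s)"
  "a \<odot>\<^bsub>free_module R S\<^esub> x = (\<lambda>s. a \<otimes>\<^bsub>R\<^esub> x s)"
  by (simp_all add: free_module_def)

lemma carrier_free_module:
  "carrier (free_module R S) = {x. (\<forall>s\<in>S. x s \<in> carrier R) \<and> (\<forall>s. s \<notin> S \<longrightarrow> x s = \<zero>\<^bsub>R\<^esub>)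
    \<and> finite {s. x s \<noteq> \<zero>\<^bsub>R\<^esub>}}"
  by (simp add: free_module_def)

context cring
begin

lemma free_module_value [simp]: "x \<in> carrier (free_module R S) \<Longrightarrow> x s \<in> carrier R"
  by (cases "s \<in> S") (auto simp: carrier_free_module)

lemma free_module_support: "x \<in> carrier (free_module R S) \<Longrightarrow> finite {s. x s \<noteq> \<zero>}"
  and free_module_outside: "x \<in> carrier (free_module R S) \<Longrightarrow> s \<notin> S \<Longrightarrow> x s = \<zero>"
  unfolding carrier_free_module by blast+

lemma basis_vec_closed [simp]: "s \<in> S \<Longrightarrow> basis_vec R s \<in> carrier (free_module R S)"
proof -
  assume "s \<in> S"
  have "{t. basis_vec R s t \<noteq> \<zero>} \<subseteq> {s}" by (auto simp: basis_vec_def)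
  then have "finite {t. basis_vec R s t \<noteq> \<zero>}" by (rule finite_subset) simp
  then show ?thesis using \<open>s \<in> S\<close> unfolding carrier_free_module basis_vec_def by simp
qed

lemma basis_vec_value [simp]: "basis_vec R s t \<in> carrier R"
  by (simp add: basis_vec_def)

lemma module_free_module: "module R (free_module R S)"
proof (rule moduleI)
  have add: "(\<lambda>s. x s \<oplus> y s) \<in> carrier (free_module R S)"
    if "x \<in> carrier (free_module R S)" "y \<in> carrier (free_module R S)" for x y
  proof -
    have "{s. x s \<oplus> y s \<noteq> \<zero>} \<subseteq> {s. x s \<noteq> \<zero>} \<union> {s. y s \<noteq> \<zero>}" by auto
    moreover have "finite ({s. x s \<noteq> \<zero>} \<union> {s. y s \<noteq> \<zero>})" using that by (simp add: free_module_support)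
    ultimately have "finite {s. x s \<oplus> y s \<noteq> \<zero>}" by (rule finite_subset)
    then show ?thesis using that by (simp add: carrier_free_module del: free_module_value)
  qed
  have smult: "(\<lambda>s. a \<otimes> x s) \<in> carrier (free_module R S)"
    if "a \<in> carrier R" "x \<in> carrier (free_module R S)" for a x
  proof -
    have "{s. a \<otimes> x s \<noteq> \<zero>} \<subseteq> {s. x s \<noteq> \<zero>}" using that(1) by auto
    then have "finite {s. a \<otimes> x s \<noteq> \<zero>}" using free_module_support[OF that(2)] by (rule finite_subset)
    then show ?thesis using that by (simp add: carrier_free_module del: free_module_value)
  qed
  show "cring R" by (rule is_cring)
  show "abelian_group (free_module R S)"
  proof (rule abelian_groupI)
    show "\<zero>\<^bsub>free_module R S\<^esub> \<in> carrier (free_module R S)" by (simp add: carrier_free_module del: free_module_value)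
    fix x assume x: "x \<in> carrier (free_module R S)"
    show "\<exists>y\<in>carrier (free_module R S). y \<oplus>\<^bsub>free_module R S\<^esub> x = \<zero>\<^bsub>free_module R S\<^esub>"
      using x smult[of "\<ominus> \<one>" x]
      by (intro bexI[of _ "\<lambda>s. (\<ominus> \<one>) \<otimes> x s"]) (simp_all add: l_minus l_neg)
  qed (auto simp: add a_ac)
  show "a \<odot>\<^bsub>free_module R S\<^esub> x \<in> carrier (free_module R S)"
    if "a \<in> carrier R" "x \<in> carrier (free_module R S)" for a x
    using smult[OF that] by simp
qed (auto simp: l_distr r_distr m_assoc)

lemma free_module_induct [consumes 1, case_names zero basis add smult]:
  assumes x: "x \<in> carrier (free_module R S)"
    and zero: "P (\<lambda>s. \<zero>)"
    and basis: "\<And>s. s \<in> S \<Longrightarrow> P (basis_vec R s)"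
    and add: "\<And>x y. \<lbrakk>x \<in> carrier (free_module R S); y \<in> carrier (free_module R S); P x; P y\<rbrakk>
      \<Longrightarrow> P (\<lambda>s. x s \<oplus> y s)"
    and smult: "\<And>a x. \<lbrakk>a \<in> carrier R; x \<in> carrier (free_module R S); P x\<rbrakk> \<Longrightarrow> P (\<lambda>s. a \<otimes> x s)"
  shows "P x"
proof -
  interpret F: module R "free_module R S" by (rule module_free_module)
  \<comment> \<open>The induction runs over a finite set containing the support, with
    \<open>x\<close> arbitrary, so that one coordinate can be cleared at a time.\<close>
  have "\<forall>x\<in>carrier (free_module R S). {s. x s \<noteq> \<zero>} \<subseteq> T \<longrightarrow> P x" if "finite T" for T
    using that
  proof (induction T rule: finite_induct)
    case empty
    show ?case
    proof (intro ballI impI)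
      fix x assume "x \<in> carrier (free_module R S)" "{s. x s \<noteq> \<zero>} \<subseteq> {}"
      then have "x = (\<lambda>s. \<zero>)" by auto
      then show "P x" using zero by simp
    qed
  next
    case (insert t T)
    show ?case
    proof (intro ballI impI)
      fix x assume x: "x \<in> carrier (free_module R S)" and sub: "{s. x s \<noteq> \<zero>} \<subseteq> insert t T"
      show "P x"
      proof (cases "t \<in> S")
        case False
        then have "{s. x s \<noteq> \<zero>} \<subseteq> T" using x sub by (auto simp: carrier_free_module simp del: free_module_value)
        then show ?thesis using insert.IH x by blast
      next
        case True
        let ?y = "x(t := \<zero>)" and ?z = "\<lambda>s. x t \<otimes> basis_vec R t s"
        have "{s. ?y s \<noteq> \<zero>} \<subseteq> T" using sub by auto
        moreover have y: "?y \<in> carrier (free_module R S)"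
          using x finite_subset[OF \<open>{s. ?y s \<noteq> \<zero>} \<subseteq> T\<close> insert.hyps(1)] by (auto simp: carrier_free_module simp del: free_module_value)
        ultimately have "P ?y" using insert.IH by blast
        moreover have z: "?z \<in> carrier (free_module R S)"
          using F.smult_closed[of "x t" "basis_vec R t"] x True by simp
        moreover have "P ?z" using smult[OF _ _ basis[OF True], of "x t"] x True by simp
        ultimately have "P (\<lambda>s. ?y s \<oplus> ?z s)" using add y by blast
        moreover have "(\<lambda>s. ?y s \<oplus> ?z s) = x"
          using x by (auto simp: basis_vec_def fun_eq_iff)
        ultimately show ?thesis by simp
      qed
    qed
  qed
  then show ?thesis using x free_module_support[OF x] by blast
qed

end

text \<open>The map given by the universal property of the free module. The sum runs over the
  support because the basis used for tensor products, all pairs of a module element and a scalar,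
  need not be finite. \<open>linear_extension_eq\<close> enlarges the range of summation when
  several supports have to be compared.\<close>

definition (in module) linear_extension :: "('s \<Rightarrow> 'c) \<Rightarrow> ('s \<Rightarrow> 'a) \<Rightarrow> 'c" where
  "linear_extension g f = (\<Oplus>\<^bsub>M\<^esub>s\<in>{s. f s \<noteq> \<zero>}. f s \<odot>\<^bsub>M\<^esub> g s)"

context module
begin

lemma linear_extension_eq:
  assumes f: "f \<in> carrier (free_module R S)" and g: "g \<in> S \<rightarrow> carrier M"
    and T: "finite T" "{s. f s \<noteq> \<zero>} \<subseteq> T" "T \<subseteq> S"
  shows "linear_extension g f = (\<Oplus>\<^bsub>M\<^esub>s\<in>T. f s \<odot>\<^bsub>M\<^esub> g s)"
  unfolding linear_extension_def using T f g
  by (intro M.add.finprod_mono_neutral_cong_left) (auto simp: Pi_iff)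

lemma free_module_support_subset: "f \<in> carrier (free_module R S) \<Longrightarrow> {s. f s \<noteq> \<zero>} \<subseteq> S"
  by (auto simp: carrier_free_module simp del: free_module_value)

lemma linear_extension_closed:
  "\<lbrakk>f \<in> carrier (free_module R S); g \<in> S \<rightarrow> carrier M\<rbrakk> \<Longrightarrow> linear_extension g f \<in> carrier M"
  unfolding linear_extension_def
  using free_module_support_subset[of f S] by (intro M.finsum_closed) (auto simp: Pi_iff)

lemma linear_extension_add:
  assumes f: "f \<in> carrier (free_module R S)" and f': "f' \<in> carrier (free_module R S)"
    and g: "g \<in> S \<rightarrow> carrier M"
  shows "linear_extension g (\<lambda>s. f s \<oplus> f' s) = linear_extension g f \<oplus>\<^bsub>M\<^esub> linear_extension g f'"
proof -
  interpret F: module R "free_module R S" by (rule R.module_free_module)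
  let ?T = "{s. f s \<noteq> \<zero>} \<union> {s. f' s \<noteq> \<zero>}"
  have sum: "(\<lambda>s. f s \<oplus> f' s) \<in> carrier (free_module R S)" using F.add.m_closed[OF f f'] by simp
  have T: "finite ?T" "?T \<subseteq> S"
    using f f' R.free_module_support free_module_support_subset by blast+
  have vals: "(\<lambda>s. f s \<odot>\<^bsub>M\<^esub> g s) \<in> ?T \<rightarrow> carrier M" "(\<lambda>s. f' s \<odot>\<^bsub>M\<^esub> g s) \<in> ?T \<rightarrow> carrier M"
    using f f' g T(2) by (auto simp: Pi_iff)
  have "linear_extension g (\<lambda>s. f s \<oplus> f' s) = (\<Oplus>\<^bsub>M\<^esub>s\<in>?T. (f s \<oplus> f' s) \<odot>\<^bsub>M\<^esub> g s)"
    using T by (intro linear_extension_eq[OF sum g]) auto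
  also have "\<dots> = (\<Oplus>\<^bsub>M\<^esub>s\<in>?T. f s \<odot>\<^bsub>M\<^esub> g s \<oplus>\<^bsub>M\<^esub> f' s \<odot>\<^bsub>M\<^esub> g s)"
    using f f' g T(2) by (intro M.finsum_cong') (auto simp: smult_l_distr Pi_iff)
  also have "\<dots> = linear_extension g f \<oplus>\<^bsub>M\<^esub> linear_extension g f'"
    unfolding linear_extension_eq[OF f g T(1) _ T(2), OF Un_upper1]
      linear_extension_eq[OF f' g T(1) _ T(2), OF Un_upper2]
    by (rule M.finsum_addf[OF vals])
  finally show ?thesis .
qed

lemma linear_extension_smult:
  assumes a: "a \<in> carrier R" and f: "f \<in> carrier (free_module R S)" and g: "g \<in> S \<rightarrow> carrier M"
  shows "linear_extension g (\<lambda>s. a \<otimes> f s) = a \<odot>\<^bsub>M\<^esub> linear_extension g f"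
proof -
  interpret F: module R "free_module R S" by (rule R.module_free_module)
  let ?T = "{s. f s \<noteq> \<zero>}"
  have prod: "(\<lambda>s. a \<otimes> f s) \<in> carrier (free_module R S)" using F.smult_closed[OF a f] by simp
  have T: "finite ?T" "?T \<subseteq> S" using f R.free_module_support free_module_support_subset by blast+
  have "linear_extension g (\<lambda>s. a \<otimes> f s) = (\<Oplus>\<^bsub>M\<^esub>s\<in>?T. (a \<otimes> f s) \<odot>\<^bsub>M\<^esub> g s)"
    using T a by (intro linear_extension_eq[OF prod g]) auto
  also have "\<dots> = (\<Oplus>\<^bsub>M\<^esub>s\<in>?T. a \<odot>\<^bsub>M\<^esub> (f s \<odot>\<^bsub>M\<^esub> g s))"
    using a f g T(2) by (intro M.finsum_cong') (auto simp: smult_assoc1 Pi_iff)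
  also have "\<dots> = a \<odot>\<^bsub>M\<^esub> linear_extension g f"
    unfolding linear_extension_def
    using a f g T by (intro finsum_smult_ldistr[symmetric]) (auto simp: Pi_iff)
  finally show ?thesis .
qed

lemma linear_extension_basis_vec:
  assumes "s \<in> S" "g \<in> S \<rightarrow> carrier M"
  shows "linear_extension g (basis_vec R s) = g s"
proof -
  have gs: "g s \<in> carrier M" using assms by auto
  have "linear_extension g (basis_vec R s) = (\<Oplus>\<^bsub>M\<^esub>t\<in>{s}. basis_vec R s t \<odot>\<^bsub>M\<^esub> g t)"
    using assms by (intro linear_extension_eq[of _ S] R.basis_vec_closed) (auto simp: basis_vec_def)
  then show ?thesis using gs by (simp add: basis_vec_def)
qed

end

lemma ring_as_module_simps [simp]:
  "carrier (ring_as_module R) = carrier R" "x \<oplus>\<^bsub>ring_as_module R\<^esub> y = x \<oplus>\<^bsub>R\<^esub> y"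
  "a \<odot>\<^bsub>ring_as_module R\<^esub> x = a \<otimes>\<^bsub>R\<^esub> x"
  by (simp_all add: ring_as_module_def)

text \<open>Every element of \<open>M \<otimes>\<^sub>B R\<close> is of the form \<open>x \<otimes> 1\<close>, so this tensor product is a quotient of
  \<open>M\<close>.\<close>

locale tensor_with_ring = module R M for R (structure) and M (structure) +
  fixes B :: "('a, 'alg, 'more) module_scheme" and rho :: "'c \<Rightarrow> 'alg \<Rightarrow> 'c" and lam :: "'alg \<Rightarrow> 'a \<Rightarrow> 'a"
  assumes rho_closed: "\<lbrakk>x \<in> carrier M; a \<in> carrier B\<rbrakk> \<Longrightarrow> rho x a \<in> carrier M"
    and lam_closed: "\<lbrakk>a \<in> carrier B; y \<in> carrier R\<rbrakk> \<Longrightarrow> lam a y \<in> carrier R"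
begin

abbreviation "F \<equiv> free_module R (carrier M \<times> carrier R)"
abbreviation "K \<equiv> tensor_kernel R B M rho (ring_as_module R) lam"
abbreviation "T \<equiv> pure_tensor R B M rho (ring_as_module R) lam"
abbreviation "TP \<equiv> tensor_product R B M rho (ring_as_module R) lam"

sublocale F: module R F by (rule R.module_free_module)

lemma tensor_relations_closed:
  "tensor_relations R B M rho (ring_as_module R) lam \<subseteq> carrier F"
proof -
  have e: "basis_vec R (x, y) \<in> carrier F" if "x \<in> carrier M" "y \<in> carrier R" for x y
    using that by (intro R.basis_vec_closed) simp
  note closed = F.minus_closed F.add.m_closed F.smult_closed e M.add.m_closed R.add.m_closed
    smult_closed R.m_closed rho_closed lam_closed
  show ?thesis
    unfolding tensor_relations_def Let_def ring_as_module_simps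
  proof (rule subsetI, elim UnE CollectE exE conjE)
  qed (hypsubst, rule F.minus_closed; simp only: closed)+
qed

lemma submodule_K: "submodule K R F"
  unfolding tensor_kernel_def ring_as_module_simps
  by (rule F.submodule_module_span) (rule tensor_relations_closed)

lemma pure_tensor_eq: "T x y = K +>\<^bsub>F\<^esub> basis_vec R (x, y)"
  by (simp add: pure_tensor_def)

lemma TP_eq: "TP = quotient_module F K"
  by (simp add: tensor_product_def)

lemma module_TP: "module R TP"
  unfolding TP_eq by (rule F.module_quotient_module[OF submodule_K])

lemma relation_in_K: "x \<in> tensor_relations R B M rho (ring_as_module R) lam \<Longrightarrow> x \<in> K"
  unfolding tensor_kernel_def by (rule subsetD[OF module_span_superset])

lemma pure_tensor_closed: "\<lbrakk>x \<in> carrier M; y \<in> carrier R\<rbrakk> \<Longrightarrow> T x y \<in> carrier TP"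
  unfolding TP_eq pure_tensor_eq F.carrier_quotient_module[OF submodule_K] by simp

lemma pure_tensor_add:
  assumes "x \<in> carrier M" "x' \<in> carrier M" "y \<in> carrier R"
  shows "T (x \<oplus>\<^bsub>M\<^esub> x') y = T x y \<oplus>\<^bsub>TP\<^esub> T x' y"
proof -
  have "basis_vec R (x \<oplus>\<^bsub>M\<^esub> x', y) \<ominus>\<^bsub>F\<^esub> (basis_vec R (x, y) \<oplus>\<^bsub>F\<^esub> basis_vec R (x', y)) \<in> K"
    using assms by (intro relation_in_K) (unfold tensor_relations_def Let_def ring_as_module_simps, blast)
  then show ?thesis
    unfolding pure_tensor_eq TP_eq using assms
    by (subst F.quotient_module_add[OF submodule_K])
       (simp_all add: F.a_coset_eq_iff[OF submodule_K] del: free_module_simps)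
qed

lemma pure_tensor_smult:
  assumes "r \<in> carrier R" "x \<in> carrier M" "y \<in> carrier R"
  shows "T (r \<odot>\<^bsub>M\<^esub> x) y = r \<odot>\<^bsub>TP\<^esub> T x y"
proof -
  have "basis_vec R (r \<odot>\<^bsub>M\<^esub> x, y) \<ominus>\<^bsub>F\<^esub> (r \<odot>\<^bsub>F\<^esub> basis_vec R (x, y)) \<in> K"
    using assms by (intro relation_in_K) (unfold tensor_relations_def Let_def ring_as_module_simps, blast)
  then show ?thesis
    unfolding pure_tensor_eq TP_eq using assms
    by (subst F.quotient_module_smult[OF submodule_K])
       (simp_all add: F.a_coset_eq_iff[OF submodule_K] del: free_module_simps)
qed

lemma pure_tensor_scalar:
  assumes "x \<in> carrier M" "y \<in> carrier R"
  shows "T x y = T (y \<odot>\<^bsub>M\<^esub> x) \<one>"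
proof -
  have "basis_vec R (x, y \<otimes> \<one>) \<ominus>\<^bsub>F\<^esub> (y \<odot>\<^bsub>F\<^esub> basis_vec R (x, \<one>)) \<in> K"
    using assms R.one_closed
    by (intro relation_in_K) (unfold tensor_relations_def Let_def ring_as_module_simps, blast)
  then have "T x y = K +>\<^bsub>F\<^esub> (y \<odot>\<^bsub>F\<^esub> basis_vec R (x, \<one>))"
    unfolding pure_tensor_eq using assms
    by (simp add: F.a_coset_eq_iff[OF submodule_K] del: free_module_simps)
  also have "\<dots> = y \<odot>\<^bsub>TP\<^esub> T x \<one>"
    unfolding pure_tensor_eq TP_eq using assms
    by (subst F.quotient_module_smult[OF submodule_K]) simp_all
  finally show ?thesis using assms by (simp add: pure_tensor_smult)
qed

lemma pure_tensor_balanced: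
  assumes "a \<in> carrier B" "x \<in> carrier M"
  shows "T (rho x a) \<one> = T (lam a \<one> \<odot>\<^bsub>M\<^esub> x) \<one>"
proof -
  have "basis_vec R (rho x a, \<one>) \<ominus>\<^bsub>F\<^esub> basis_vec R (x, lam a \<one>) \<in> K"
    using assms R.one_closed
    by (intro relation_in_K) (unfold tensor_relations_def Let_def ring_as_module_simps, blast)
  then have "T (rho x a) \<one> = T x (lam a \<one>)"
    unfolding pure_tensor_eq using assms rho_closed lam_closed
    by (simp add: F.a_coset_eq_iff[OF submodule_K] del: free_module_simps)
  also have "\<dots> = T (lam a \<one> \<odot>\<^bsub>M\<^esub> x) \<one>"
    using assms lam_closed by (intro pure_tensor_scalar) simp_all
  finally show ?thesis .
qed

lemma pure_tensor_zero: "T \<zero>\<^bsub>M\<^esub> \<one> = \<zero>\<^bsub>TP\<^esub>"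
proof -
  interpret TP: module R TP by (rule module_TP)
  have "T \<zero>\<^bsub>M\<^esub> \<one> \<in> carrier TP" by (intro pure_tensor_closed) simp_all
  then have "\<zero> \<odot>\<^bsub>TP\<^esub> T \<zero>\<^bsub>M\<^esub> \<one> = \<zero>\<^bsub>TP\<^esub>" by (rule TP.smult_l_null)
  moreover have "T (\<zero> \<odot>\<^bsub>M\<^esub> \<zero>\<^bsub>M\<^esub>) \<one> = \<zero> \<odot>\<^bsub>TP\<^esub> T \<zero>\<^bsub>M\<^esub> \<one>" by (intro pure_tensor_smult) simp_all
  ultimately show ?thesis by simp
qed

text \<open>The generators have this form by \<open>pure_tensor_scalar\<close>, and the form is
  stable under sums and scalar multiples.\<close>

lemma pure_tensor_surj:
  assumes "X \<in> carrier TP"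
  shows "\<exists>x\<in>carrier M. X = T x \<one>"
proof -
  obtain f where f: "f \<in> carrier F" "X = K +>\<^bsub>F\<^esub> f"
    using assms unfolding TP_eq F.carrier_quotient_module[OF submodule_K] by blast
  from f(1) have "\<exists>x\<in>carrier M. K +>\<^bsub>F\<^esub> f = T x \<one>"
  proof (induction rule: R.free_module_induct)
    case zero
    then show ?case
      using pure_tensor_zero F.quotient_module_zero[OF submodule_K]
      by (intro bexI[of _ "\<zero>\<^bsub>M\<^esub>"]) (simp_all add: TP_eq)
  next
    case (basis s)
    then show ?case using pure_tensor_scalar[of "fst s" "snd s"]
      by (intro bexI[of _ "snd s \<odot>\<^bsub>M\<^esub> fst s"]) (auto simp: pure_tensor_eq)
  next
    case (add f g)
    then obtain x y where "x \<in> carrier M" "y \<in> carrier M" "K +>\<^bsub>F\<^esub> f = T x \<one>" "K +>\<^bsub>F\<^esub> g = T y \<one>" by blast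
    then show ?case
      using F.quotient_module_add[OF submodule_K add(1,2)] pure_tensor_add[of x y \<one>]
      by (intro bexI[of _ "x \<oplus>\<^bsub>M\<^esub> y"]) (simp_all add: TP_eq)
  next
    case (smult a f)
    then obtain x where "x \<in> carrier M" "K +>\<^bsub>F\<^esub> f = T x \<one>" by blast
    then show ?case
      using F.quotient_module_smult[OF submodule_K smult(1,2)] pure_tensor_smult[of a x \<one>] smult(1)
      by (intro bexI[of _ "a \<odot>\<^bsub>M\<^esub> x"]) (simp_all add: TP_eq)
  qed
  then show ?thesis using f(2) by simp
qed

text \<open>Behind this is the map \<open>M \<otimes>\<^sub>B R \<rightarrow> M / J\<close> sending
  x \<otimes> r to the class of rx. Instead of passing to quotients, the linear map
  \<open>\<phi>\<close> on the free module takes values in \<open>M\<close> and is tested for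
  membership in \<open>J\<close>. The hypothesis on \<open>lam\<close> makes the image of a
  balancing relation a multiple of one of the given elements of \<open>J\<close>.\<close>

lemma pure_tensor_eqD:
  assumes J: "submodule J R M"
    and lam: "\<And>a y. \<lbrakk>a \<in> carrier B; y \<in> carrier R\<rbrakk> \<Longrightarrow> lam a y = lam a \<one> \<otimes> y"
    and gen: "\<And>x a. \<lbrakk>x \<in> carrier M; a \<in> carrier B\<rbrakk> \<Longrightarrow> rho x a \<ominus>\<^bsub>M\<^esub> lam a \<one> \<odot>\<^bsub>M\<^esub> x \<in> J"
    and x: "x \<in> carrier M" "x' \<in> carrier M" and eq: "T x \<one> = T x' \<one>"
  shows "x \<ominus>\<^bsub>M\<^esub> x' \<in> J"
proof -
  let ?S = "carrier M \<times> carrier R"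
  define \<phi> where "\<phi> = linear_extension (\<lambda>(x, r). r \<odot>\<^bsub>M\<^esub> x)"
  have g: "(\<lambda>(x, r). r \<odot>\<^bsub>M\<^esub> x) \<in> ?S \<rightarrow> carrier M" by auto
  have closed: "\<phi> f \<in> carrier M" if "f \<in> carrier F" for f
    unfolding \<phi>_def using linear_extension_closed[OF that g] .
  have add: "\<phi> (f \<oplus>\<^bsub>F\<^esub> f') = \<phi> f \<oplus>\<^bsub>M\<^esub> \<phi> f'" if "f \<in> carrier F" "f' \<in> carrier F" for f f'
    unfolding \<phi>_def using linear_extension_add[OF that g] by simp
  have smult: "\<phi> (a \<odot>\<^bsub>F\<^esub> f) = a \<odot>\<^bsub>M\<^esub> \<phi> f" if "a \<in> carrier R" "f \<in> carrier F" for a f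
    unfolding \<phi>_def using linear_extension_smult[OF that g] by simp
  have basis: "\<phi> (basis_vec R (x, r)) = r \<odot>\<^bsub>M\<^esub> x" if "x \<in> carrier M" "r \<in> carrier R" for x r
    unfolding \<phi>_def using linear_extension_basis_vec[OF _ g, of "(x, r)"] that by simp
  note zero = module_map_zero[where f = \<phi>, OF F.module_axioms module_axioms closed add smult]
  note minus = module_map_minus[where f = \<phi>, OF F.module_axioms module_axioms closed add smult]
  \<comment> \<open>The preimage of \<open>J\<close>: being a submodule, it contains the whole
    kernel \<open>K\<close> as soon as it contains the defining relations.\<close>
  let ?H = "{f \<in> carrier F. \<phi> f \<in> J}"
  have H: "submodule ?H R F"
    using submoduleE[OF J] submodule_zero[OF J]
    by (intro F.submoduleI') (auto simp: zero add smult simp del: free_module_simps)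
  \<comment> \<open>The first four kinds of relations only express bilinearity and are sent to zero
    by \<open>\<phi>\<close>; just the balancing relations use \<open>gen\<close>.\<close>
  have J0: "z \<ominus>\<^bsub>M\<^esub> z' \<in> J" if "z = z'" "z' \<in> carrier M" for z z'
    using that submodule_zero[OF J] by (simp add: a_minus_def M.r_neg)
  have "\<phi> f \<in> J" if "f \<in> tensor_relations R B M rho (ring_as_module R) lam" for f
    using that unfolding tensor_relations_def Let_def ring_as_module_simps
  proof (elim UnE CollectE exE conjE)
    fix x x' y assume f: "f = basis_vec R (x \<oplus>\<^bsub>M\<^esub> x', y) \<ominus>\<^bsub>F\<^esub> (basis_vec R (x, y) \<oplus>\<^bsub>F\<^esub> basis_vec R (x', y))"
      and c: "x \<in> carrier M" "x' \<in> carrier M" "y \<in> carrier R"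
    then have "\<phi> f = y \<odot>\<^bsub>M\<^esub> (x \<oplus>\<^bsub>M\<^esub> x') \<ominus>\<^bsub>M\<^esub> (y \<odot>\<^bsub>M\<^esub> x \<oplus>\<^bsub>M\<^esub> y \<odot>\<^bsub>M\<^esub> x')"
      by (simp add: minus add basis del: free_module_simps)
    then show ?thesis using c J0 by (simp add: smult_r_distr)
  next
    fix x y y' assume f: "f = basis_vec R (x, y \<oplus> y') \<ominus>\<^bsub>F\<^esub> (basis_vec R (x, y) \<oplus>\<^bsub>F\<^esub> basis_vec R (x, y'))"
      and c: "x \<in> carrier M" "y \<in> carrier R" "y' \<in> carrier R"
    then have "\<phi> f = (y \<oplus> y') \<odot>\<^bsub>M\<^esub> x \<ominus>\<^bsub>M\<^esub> (y \<odot>\<^bsub>M\<^esub> x \<oplus>\<^bsub>M\<^esub> y' \<odot>\<^bsub>M\<^esub> x)"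
      by (simp add: minus add basis del: free_module_simps)
    then show ?thesis using c J0 by (simp add: smult_l_distr)
  next
    fix r x y assume f: "f = basis_vec R (r \<odot>\<^bsub>M\<^esub> x, y) \<ominus>\<^bsub>F\<^esub> (r \<odot>\<^bsub>F\<^esub> basis_vec R (x, y))"
      and c: "r \<in> carrier R" "x \<in> carrier M" "y \<in> carrier R"
    then have "\<phi> f = y \<odot>\<^bsub>M\<^esub> (r \<odot>\<^bsub>M\<^esub> x) \<ominus>\<^bsub>M\<^esub> r \<odot>\<^bsub>M\<^esub> (y \<odot>\<^bsub>M\<^esub> x)"
      by (simp add: minus smult basis del: free_module_simps)
    then show ?thesis using c J0 by (simp add: smult_assoc1[symmetric] m_comm)
  next
    fix r x y assume f: "f = basis_vec R (x, r \<otimes> y) \<ominus>\<^bsub>F\<^esub> (r \<odot>\<^bsub>F\<^esub> basis_vec R (x, y))"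
      and c: "r \<in> carrier R" "x \<in> carrier M" "y \<in> carrier R"
    then have "\<phi> f = (r \<otimes> y) \<odot>\<^bsub>M\<^esub> x \<ominus>\<^bsub>M\<^esub> r \<odot>\<^bsub>M\<^esub> (y \<odot>\<^bsub>M\<^esub> x)"
      by (simp add: minus smult basis del: free_module_simps)
    then show ?thesis using c J0 by (simp add: smult_assoc1)
  next
    fix a x y assume f: "f = basis_vec R (rho x a, y) \<ominus>\<^bsub>F\<^esub> basis_vec R (x, lam a y)"
      and c: "a \<in> carrier B" "x \<in> carrier M" "y \<in> carrier R"
    note cl = rho_closed[OF c(2,1)] lam_closed[OF c(1,3)] lam_closed[OF c(1) R.one_closed]
    have "\<phi> f = y \<odot>\<^bsub>M\<^esub> rho x a \<ominus>\<^bsub>M\<^esub> lam a y \<odot>\<^bsub>M\<^esub> x"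
      using f c cl by (simp add: minus basis del: free_module_simps)
    also have "\<dots> = y \<odot>\<^bsub>M\<^esub> (rho x a \<ominus>\<^bsub>M\<^esub> lam a \<one> \<odot>\<^bsub>M\<^esub> x)"
      using c cl lam[OF c(1,3)] by (simp add: smult_minus_right smult_assoc1[symmetric] m_comm)
    finally show ?thesis using submodule.smult_closed[OF J c(3) gen[OF c(2,1)]] by simp
  qed
  then have "tensor_relations R B M rho (ring_as_module R) lam \<subseteq> ?H"
    using tensor_relations_closed by blast
  then have "K \<subseteq> ?H" unfolding tensor_kernel_def ring_as_module_simps by (rule module_span_least[OF H])
  moreover have "basis_vec R (x, \<one>) \<ominus>\<^bsub>F\<^esub> basis_vec R (x', \<one>) \<in> K"
    using eq x unfolding pure_tensor_eq
    by (simp add: F.a_coset_eq_iff[OF submodule_K] del: free_module_simps)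
  ultimately have "\<phi> (basis_vec R (x, \<one>) \<ominus>\<^bsub>F\<^esub> basis_vec R (x', \<one>)) \<in> J" by blast
  then show ?thesis using x by (simp add: minus basis del: free_module_simps)
qed

end

section \<open>The category of a sequence of stackable algebras\<close>

text \<open>These are the properties of the diagram algebras from which the category is built. The
  action on \<open>\<one>\<close> is the character of the trivial module; the last two laws say that
  identity strands above or below an element do not change its value.\<close>

locale stackable_algebras = cring R for R (structure) +
  fixes A :: "nat \<Rightarrow> ('a, diagram \<Rightarrow> 'a) module"
  assumes ring_A: "ring (A n)"
    and module_A: "module R (A n)"
    and smult_mult_left: "\<lbrakk>r \<in> carrier R; x \<in> carrier (A n); y \<in> carrier (A n)\<rbrakk>
      \<Longrightarrow> (r \<odot>\<^bsub>A n\<^esub> x) \<otimes>\<^bsub>A n\<^esub> y = r \<odot>\<^bsub>A n\<^esub> (x \<otimes>\<^bsub>A n\<^esub> y)"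
    and smult_mult_right: "\<lbrakk>r \<in> carrier R; x \<in> carrier (A n); y \<in> carrier (A n)\<rbrakk>
      \<Longrightarrow> x \<otimes>\<^bsub>A n\<^esub> (r \<odot>\<^bsub>A n\<^esub> y) = r \<odot>\<^bsub>A n\<^esub> (x \<otimes>\<^bsub>A n\<^esub> y)"
    and on_top_closed: "\<lbrakk>x \<in> carrier (A a); y \<in> carrier (A b)\<rbrakk> \<Longrightarrow> on_top R a b x y \<in> carrier (A (a + b))"
    and on_top_add_left: "\<lbrakk>x \<in> carrier (A a); x' \<in> carrier (A a); y \<in> carrier (A b)\<rbrakk>
      \<Longrightarrow> on_top R a b (x \<oplus>\<^bsub>A a\<^esub> x') y = on_top R a b x y \<oplus>\<^bsub>A (a + b)\<^esub> on_top R a b x' y"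
    and on_top_smult_left: "\<lbrakk>r \<in> carrier R; x \<in> carrier (A a); y \<in> carrier (A b)\<rbrakk>
      \<Longrightarrow> on_top R a b (r \<odot>\<^bsub>A a\<^esub> x) y = r \<odot>\<^bsub>A (a + b)\<^esub> on_top R a b x y"
    and on_top_one: "on_top R a b \<one>\<^bsub>A a\<^esub> \<one>\<^bsub>A b\<^esub> = \<one>\<^bsub>A (a + b)\<^esub>"
    and on_top_mult: "\<lbrakk>x \<in> carrier (A a); x' \<in> carrier (A a); y \<in> carrier (A b); y' \<in> carrier (A b)\<rbrakk>
      \<Longrightarrow> on_top R a b (x \<otimes>\<^bsub>A a\<^esub> x') (y \<otimes>\<^bsub>A b\<^esub> y')
        = on_top R a b x y \<otimes>\<^bsub>A (a + b)\<^esub> on_top R a b x' y'"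
    and on_top_assoc: "\<lbrakk>x \<in> carrier (A a); y \<in> carrier (A b); z \<in> carrier (A c)\<rbrakk>
      \<Longrightarrow> on_top R (a + b) c (on_top R a b x y) z = on_top R a (b + c) x (on_top R b c y z)"
    and on_top_0: "x \<in> carrier (A a) \<Longrightarrow> on_top R a 0 x \<one>\<^bsub>A 0\<^esub> = x"
    and trivial_action_closed: "\<lbrakk>d \<in> carrier (A k); r \<in> carrier R\<rbrakk> \<Longrightarrow> trivial_action R k d r \<in> carrier R"
    and trivial_action_scalar: "\<lbrakk>d \<in> carrier (A k); r \<in> carrier R\<rbrakk>
      \<Longrightarrow> trivial_action R k d r = trivial_action R k d \<one> \<otimes> r"
    and trivial_action_on_top_left: "d \<in> carrier (A b)
      \<Longrightarrow> trivial_action R (a + b) (on_top R a b \<one>\<^bsub>A a\<^esub> d) \<one> = trivial_action R b d \<one>"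
    and trivial_action_on_top_right: "d \<in> carrier (A a)
      \<Longrightarrow> trivial_action R (a + b) (on_top R a b d \<one>\<^bsub>A b\<^esub>) \<one> = trivial_action R a d \<one>"
begin

lemma one_closed' [simp]: "\<one>\<^bsub>A n\<^esub> \<in> carrier (A n)"
  using ring_A by (rule ring.ring_simprules)

lemma mult_closed [simp]: "\<lbrakk>x \<in> carrier (A n); y \<in> carrier (A n)\<rbrakk> \<Longrightarrow> x \<otimes>\<^bsub>A n\<^esub> y \<in> carrier (A n)"
  using ring_A by (rule ring.ring_simprules)

lemma add_closed [simp]: "\<lbrakk>x \<in> carrier (A n); y \<in> carrier (A n)\<rbrakk> \<Longrightarrow> x \<oplus>\<^bsub>A n\<^esub> y \<in> carrier (A n)"
  using ring_A by (rule ring.ring_simprules)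

lemma minus_closed' [simp]: "\<lbrakk>x \<in> carrier (A n); y \<in> carrier (A n)\<rbrakk> \<Longrightarrow> x \<ominus>\<^bsub>A n\<^esub> y \<in> carrier (A n)"
  using ring_A by (rule ring.ring_simprules)

lemma smult_closed' [simp]: "\<lbrakk>r \<in> carrier R; x \<in> carrier (A n)\<rbrakk> \<Longrightarrow> r \<odot>\<^bsub>A n\<^esub> x \<in> carrier (A n)"
  using module_A by (rule module.smult_closed)

lemma mult_assoc: "\<lbrakk>x \<in> carrier (A n); y \<in> carrier (A n); z \<in> carrier (A n)\<rbrakk>
    \<Longrightarrow> x \<otimes>\<^bsub>A n\<^esub> y \<otimes>\<^bsub>A n\<^esub> z = x \<otimes>\<^bsub>A n\<^esub> (y \<otimes>\<^bsub>A n\<^esub> z)"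
  using ring_A by (rule ring.ring_simprules)

definition compose :: "nat \<Rightarrow> nat \<Rightarrow> (diagram \<Rightarrow> 'a) \<Rightarrow> (diagram \<Rightarrow> 'a) \<Rightarrow> diagram \<Rightarrow> 'a" where
  "compose m n x y = x \<otimes>\<^bsub>A n\<^esub> on_top R m (n - m) y \<one>\<^bsub>A (n - m)\<^esub>"

lemma on_top_closed': "\<lbrakk>m \<le> n; x \<in> carrier (A m); y \<in> carrier (A (n - m))\<rbrakk>
    \<Longrightarrow> on_top R m (n - m) x y \<in> carrier (A n)"
  using on_top_closed[of x m y "n - m"] by simp

lemma on_top_assoc':
  assumes "l \<le> m" "m \<le> n" "x \<in> carrier (A l)" "y \<in> carrier (A (m - l))" "z \<in> carrier (A (n - m))"
  shows "on_top R m (n - m) (on_top R l (m - l) x y) z = on_top R l (n - l) x (on_top R (m - l) (n - m) y z)"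
  using on_top_assoc[of x l y "m - l" z "n - m"] assms by simp

lemma on_top_mult':
  assumes "m \<le> n" "x \<in> carrier (A m)" "x' \<in> carrier (A m)" "y \<in> carrier (A (n - m))" "y' \<in> carrier (A (n - m))"
  shows "on_top R m (n - m) (x \<otimes>\<^bsub>A m\<^esub> x') (y \<otimes>\<^bsub>A (n - m)\<^esub> y')
    = on_top R m (n - m) x y \<otimes>\<^bsub>A n\<^esub> on_top R m (n - m) x' y'"
  using on_top_mult[of x m x' y "n - m" y'] assms by simp

lemma on_top_one': "m \<le> n \<Longrightarrow> on_top R m (n - m) \<one>\<^bsub>A m\<^esub> \<one>\<^bsub>A (n - m)\<^esub> = \<one>\<^bsub>A n\<^esub>"
  using on_top_one[of m "n - m"] by simp

lemma mult_one_left [simp]: "x \<in> carrier (A n) \<Longrightarrow> \<one>\<^bsub>A n\<^esub> \<otimes>\<^bsub>A n\<^esub> x = x"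
  using ring_A by (rule ring.ring_simprules)

lemma mult_one_right [simp]: "x \<in> carrier (A n) \<Longrightarrow> x \<otimes>\<^bsub>A n\<^esub> \<one>\<^bsub>A n\<^esub> = x"
  using ring.is_monoid[OF ring_A] by (rule monoid.r_one)

lemma compose_closed [simp]:
  "\<lbrakk>m \<le> n; x \<in> carrier (A n); y \<in> carrier (A m)\<rbrakk> \<Longrightarrow> compose m n x y \<in> carrier (A n)"
  unfolding compose_def by (simp add: on_top_closed')

lemma compose_add_left:
  assumes "m \<le> n" "x \<in> carrier (A n)" "x' \<in> carrier (A n)" "y \<in> carrier (A m)"
  shows "compose m n (x \<oplus>\<^bsub>A n\<^esub> x') y = compose m n x y \<oplus>\<^bsub>A n\<^esub> compose m n x' y"
  unfolding compose_def using assms on_top_closed'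
  by (intro ring.ring_simprules(13)[OF ring_A]) simp_all

lemma compose_add_right:
  assumes "m \<le> n" "x \<in> carrier (A n)" "y \<in> carrier (A m)" "y' \<in> carrier (A m)"
  shows "compose m n x (y \<oplus>\<^bsub>A m\<^esub> y') = compose m n x y \<oplus>\<^bsub>A n\<^esub> compose m n x y'"
proof -
  have "on_top R m (n - m) (y \<oplus>\<^bsub>A m\<^esub> y') \<one>\<^bsub>A (n - m)\<^esub>
      = on_top R m (n - m) y \<one>\<^bsub>A (n - m)\<^esub> \<oplus>\<^bsub>A n\<^esub> on_top R m (n - m) y' \<one>\<^bsub>A (n - m)\<^esub>"
    using assms on_top_add_left[of y m y' "\<one>\<^bsub>A (n - m)\<^esub>" "n - m"] by simp
  then show ?thesis unfolding compose_def using assms on_top_closed'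
    by (simp add: ring.ring_simprules(23)[OF ring_A])
qed

lemma compose_smult_left:
  assumes "m \<le> n" "r \<in> carrier R" "x \<in> carrier (A n)" "y \<in> carrier (A m)"
  shows "compose m n (r \<odot>\<^bsub>A n\<^esub> x) y = r \<odot>\<^bsub>A n\<^esub> compose m n x y"
  unfolding compose_def using assms by (simp add: smult_mult_left on_top_closed')

lemma compose_smult_right:
  assumes "m \<le> n" "r \<in> carrier R" "x \<in> carrier (A n)" "y \<in> carrier (A m)"
  shows "compose m n x (r \<odot>\<^bsub>A m\<^esub> y) = r \<odot>\<^bsub>A n\<^esub> compose m n x y"
proof -
  have "on_top R m (n - m) (r \<odot>\<^bsub>A m\<^esub> y) \<one>\<^bsub>A (n - m)\<^esub> = r \<odot>\<^bsub>A n\<^esub> on_top R m (n - m) y \<one>\<^bsub>A (n - m)\<^esub>"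
    using assms on_top_smult_left[of r y m "\<one>\<^bsub>A (n - m)\<^esub>" "n - m"] by simp
  then show ?thesis unfolding compose_def using assms by (simp add: smult_mult_right on_top_closed')
qed

text \<open>Stacking is multiplicative, and adding identity strands to \<open>z\<close> in two
  portions amounts to adding them at once. What remains is associativity in
  \<open>A n\<close>.\<close>

lemma compose_assoc:
  assumes "l \<le> m" "m \<le> n" "x \<in> carrier (A n)" "y \<in> carrier (A m)" "z \<in> carrier (A l)"
  shows "compose m n x (compose l m y z) = compose l n (compose m n x y) z"
proof -
  let ?y = "on_top R m (n - m) y \<one>\<^bsub>A (n - m)\<^esub>"
  let ?z = "on_top R l (n - l) z \<one>\<^bsub>A (n - l)\<^esub>"
  have "\<one>\<^bsub>A (n - l)\<^esub> = on_top R (m - l) (n - m) \<one>\<^bsub>A (m - l)\<^esub> \<one>\<^bsub>A (n - m)\<^esub>"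
    using on_top_one[of "m - l" "n - m"] assms by simp
  then have z: "on_top R m (n - m) (on_top R l (m - l) z \<one>\<^bsub>A (m - l)\<^esub>) \<one>\<^bsub>A (n - m)\<^esub> = ?z"
    using assms by (simp add: on_top_assoc')
  have "on_top R m (n - m) (compose l m y z) \<one>\<^bsub>A (n - m)\<^esub> = ?y \<otimes>\<^bsub>A n\<^esub> ?z"
    using on_top_mult'[of m n y "on_top R l (m - l) z \<one>\<^bsub>A (m - l)\<^esub>" "\<one>\<^bsub>A (n - m)\<^esub>" "\<one>\<^bsub>A (n - m)\<^esub>"]
      assms z by (simp add: compose_def on_top_closed')
  then show ?thesis unfolding compose_def[of m n] compose_def[of l n]
    using assms by (simp add: mult_assoc on_top_closed')
qed

section \<open>The submodule that becomes zero in a hom module\<close>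

definition trivial_relations :: "nat \<Rightarrow> nat \<Rightarrow> (diagram \<Rightarrow> 'a) set" where
  "trivial_relations m n = {x \<otimes>\<^bsub>A n\<^esub> on_top R m (n - m) \<one>\<^bsub>A m\<^esub> d
      \<ominus>\<^bsub>A n\<^esub> trivial_action R (n - m) d \<one> \<odot>\<^bsub>A n\<^esub> x | x d.
      x \<in> carrier (A n) \<and> d \<in> carrier (A (n - m))}"

text \<open>The kernel of \<open>ten m n\<close>; the two inclusions are \<open>ten_eqD\<close> and
  \<open>ten_eqI\<close>.\<close>

definition trivial_kernel :: "nat \<Rightarrow> nat \<Rightarrow> (diagram \<Rightarrow> 'a) set" where
  "trivial_kernel m n = module_span R (A n) (trivial_relations m n)"

lemma trivial_relations_closed:
  assumes "m \<le> n"
  shows "trivial_relations m n \<subseteq> carrier (A n)"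
  unfolding trivial_relations_def using assms by (auto simp: on_top_closed' trivial_action_closed)

lemma submodule_trivial_kernel: "m \<le> n \<Longrightarrow> submodule (trivial_kernel m n) R (A n)"
  unfolding trivial_kernel_def
  by (intro module.submodule_module_span[OF module_A] trivial_relations_closed)

lemma trivial_kernelI:
  "\<lbrakk>x \<in> carrier (A n); d \<in> carrier (A (n - m))\<rbrakk> \<Longrightarrow>
    x \<otimes>\<^bsub>A n\<^esub> on_top R m (n - m) \<one>\<^bsub>A m\<^esub> d \<ominus>\<^bsub>A n\<^esub> trivial_action R (n - m) d \<one> \<odot>\<^bsub>A n\<^esub> x \<in> trivial_kernel m n"
  unfolding trivial_kernel_def
  by (rule subsetD[OF module_span_superset]) (auto simp: trivial_relations_def)

text \<open>A linear map respects these submodules once it does so on generators. The hypothesis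
  \<open>gen\<close> already has the image of a generator expanded by linearity, so each application
  only has to recognise a generator of the target.\<close>

lemma trivial_kernel_map:
  assumes mn: "m \<le> n" and lk: "l \<le> k"
    and closed: "\<And>x. x \<in> carrier (A n) \<Longrightarrow> f x \<in> carrier (A k)"
    and add: "\<And>x y. \<lbrakk>x \<in> carrier (A n); y \<in> carrier (A n)\<rbrakk> \<Longrightarrow> f (x \<oplus>\<^bsub>A n\<^esub> y) = f x \<oplus>\<^bsub>A k\<^esub> f y"
    and smult: "\<And>r x. \<lbrakk>r \<in> carrier R; x \<in> carrier (A n)\<rbrakk> \<Longrightarrow> f (r \<odot>\<^bsub>A n\<^esub> x) = r \<odot>\<^bsub>A k\<^esub> f x"
    and gen: "\<And>x d. \<lbrakk>x \<in> carrier (A n); d \<in> carrier (A (n - m))\<rbrakk> \<Longrightarrow>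
      f (x \<otimes>\<^bsub>A n\<^esub> on_top R m (n - m) \<one>\<^bsub>A m\<^esub> d) \<ominus>\<^bsub>A k\<^esub> trivial_action R (n - m) d \<one> \<odot>\<^bsub>A k\<^esub> f x \<in> trivial_kernel l k"
    and x: "x \<in> trivial_kernel m n"
  shows "f x \<in> trivial_kernel l k"
proof -
  interpret An: module R "A n" by (rule module_A)
  interpret Ak: module R "A k" by (rule module_A)
  note J = submodule_trivial_kernel[OF lk]
  note zero = module_map_zero[where f = f, OF module_A module_A closed add smult]
  note minus = module_map_minus[where f = f, OF module_A module_A closed add smult]
  let ?H = "{x \<in> carrier (A n). f x \<in> trivial_kernel l k}"
  have "submodule ?H R (A n)"
    using Ak.submoduleE[OF J] Ak.submodule_zero[OF J]
    by (intro An.submoduleI') (auto simp: zero add smult)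
  moreover have "trivial_relations m n \<subseteq> ?H"
  proof
    fix z assume z: "z \<in> trivial_relations m n"
    then obtain x d where xd: "x \<in> carrier (A n)" "d \<in> carrier (A (n - m))"
      and z_eq: "z = x \<otimes>\<^bsub>A n\<^esub> on_top R m (n - m) \<one>\<^bsub>A m\<^esub> d \<ominus>\<^bsub>A n\<^esub> trivial_action R (n - m) d \<one> \<odot>\<^bsub>A n\<^esub> x"
      unfolding trivial_relations_def by blast
    have "f z = f (x \<otimes>\<^bsub>A n\<^esub> on_top R m (n - m) \<one>\<^bsub>A m\<^esub> d) \<ominus>\<^bsub>A k\<^esub> trivial_action R (n - m) d \<one> \<odot>\<^bsub>A k\<^esub> f x"
      unfolding z_eq using xd mn by (simp add: minus smult on_top_closed' trivial_action_closed)
    then show "z \<in> ?H" using gen[OF xd] z trivial_relations_closed[OF mn] by auto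
  qed
  ultimately show ?thesis using x module_span_least unfolding trivial_kernel_def by blast
qed

lemma compose_trivial_kernel_left:
  assumes lm: "l \<le> m" and mn: "m \<le> n" and x: "x \<in> trivial_kernel m n" and y: "y \<in> carrier (A m)"
  shows "compose m n x y \<in> trivial_kernel l n"
proof (rule trivial_kernel_map[where f = "\<lambda>x. compose m n x y", OF mn _ _ _ _ _ x])
  fix x d assume x: "x \<in> carrier (A n)" and d: "d \<in> carrier (A (n - m))"
  let ?d = "on_top R m (n - m) \<one>\<^bsub>A m\<^esub> d" and ?y = "on_top R m (n - m) y \<one>\<^bsub>A (n - m)\<^esub>"
  \<comment> \<open>The element \<open>d\<close> below \<open>m - l\<close> identity strands: seen
    from \<open>l\<close>, the \<open>m\<close> strands above \<open>d\<close> split into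
    \<open>l\<close> and \<open>m - l\<close>.\<close>
  let ?d' = "on_top R (m - l) (n - m) \<one>\<^bsub>A (m - l)\<^esub> d"
  have d': "?d' \<in> carrier (A (n - l))" using on_top_closed[OF one_closed' d, of "m - l"] lm mn by simp
  have "\<one>\<^bsub>A m\<^esub> = on_top R l (m - l) \<one>\<^bsub>A l\<^esub> \<one>\<^bsub>A (m - l)\<^esub>" using on_top_one' lm by simp
  then have "?d = on_top R l (n - l) \<one>\<^bsub>A l\<^esub> ?d'" using lm mn d by (simp add: on_top_assoc')
  \<comment> \<open>By the interchange law both products equal \<open>y\<close> on top of
    \<open>d\<close>.\<close>
  moreover have "?d \<otimes>\<^bsub>A n\<^esub> ?y = ?y \<otimes>\<^bsub>A n\<^esub> ?d" and "?d \<in> carrier (A n)" "?y \<in> carrier (A n)"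
    using on_top_mult'[OF mn one_closed' y d one_closed'] on_top_mult'[OF mn y one_closed' one_closed' d] y d mn
    by (simp_all add: on_top_closed')
  ultimately have "compose m n (x \<otimes>\<^bsub>A n\<^esub> ?d) y = compose m n x y \<otimes>\<^bsub>A n\<^esub> on_top R l (n - l) \<one>\<^bsub>A l\<^esub> ?d'"
    unfolding compose_def using x mult_assoc by metis
  moreover have "trivial_action R (n - l) ?d' \<one> = trivial_action R (n - m) d \<one>"
    using trivial_action_on_top_left[OF d, of "m - l"] lm mn by simp
  ultimately show "compose m n (x \<otimes>\<^bsub>A n\<^esub> ?d) y \<ominus>\<^bsub>A n\<^esub> trivial_action R (n - m) d \<one> \<odot>\<^bsub>A n\<^esub> compose m n x y
      \<in> trivial_kernel l n"
    using trivial_kernelI[OF compose_closed[OF mn x y] d'] by simp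
qed (use lm mn y in \<open>simp_all add: compose_add_left compose_smult_left\<close>)

lemma compose_trivial_kernel_right:
  assumes lm: "l \<le> m" and mn: "m \<le> n" and x: "x \<in> carrier (A n)" and y: "y \<in> trivial_kernel l m"
  shows "compose m n x y \<in> trivial_kernel l n"
proof (rule trivial_kernel_map[where f = "compose m n x", OF lm _ _ _ _ _ y])
  fix y d assume y: "y \<in> carrier (A m)" and d: "d \<in> carrier (A (m - l))"
  let ?d = "on_top R l (m - l) \<one>\<^bsub>A l\<^esub> d" and ?y = "on_top R m (n - m) y \<one>\<^bsub>A (n - m)\<^esub>"
  \<comment> \<open>This time the identity strands come from padding up to \<open>n\<close> and
    stand below \<open>d\<close>, again giving an element of \<open>A (n - l)\<close>.\<close>
  let ?d' = "on_top R (m - l) (n - m) d \<one>\<^bsub>A (n - m)\<^esub>"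
  have d': "?d' \<in> carrier (A (n - l))" using on_top_closed[OF d one_closed', of "n - m"] lm mn by simp
  have dd: "?d \<in> carrier (A m)" using lm d by (simp add: on_top_closed')
  have "on_top R m (n - m) (y \<otimes>\<^bsub>A m\<^esub> ?d) \<one>\<^bsub>A (n - m)\<^esub> = ?y \<otimes>\<^bsub>A n\<^esub> on_top R m (n - m) ?d \<one>\<^bsub>A (n - m)\<^esub>"
    using on_top_mult'[OF mn y dd one_closed' one_closed'] by simp
  also have "on_top R m (n - m) ?d \<one>\<^bsub>A (n - m)\<^esub> = on_top R l (n - l) \<one>\<^bsub>A l\<^esub> ?d'"
    using lm mn d by (simp add: on_top_assoc')
  finally have "compose m n x (y \<otimes>\<^bsub>A m\<^esub> ?d) = compose m n x y \<otimes>\<^bsub>A n\<^esub> on_top R l (n - l) \<one>\<^bsub>A l\<^esub> ?d'"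
    unfolding compose_def using x y d' lm mn by (simp add: mult_assoc on_top_closed')
  moreover have "trivial_action R (n - l) ?d' \<one> = trivial_action R (m - l) d \<one>"
    using trivial_action_on_top_right[OF d, of "n - m"] lm mn by simp
  ultimately show "compose m n x (y \<otimes>\<^bsub>A m\<^esub> ?d) \<ominus>\<^bsub>A n\<^esub> trivial_action R (m - l) d \<one> \<odot>\<^bsub>A n\<^esub> compose m n x y
      \<in> trivial_kernel l n"
    using trivial_kernelI[OF compose_closed[OF mn x y] d'] by simp
qed (use lm mn x in \<open>simp_all add: compose_add_right compose_smult_right\<close>)

section \<open>Morphisms as classes of algebra elements\<close>

lemma tensor_with_ring_A:
  assumes "m \<le> n"
  shows "tensor_with_ring R (A n) (A (n - m)) (restricted_action R A m n) (trivial_action R (n - m))"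
  unfolding tensor_with_ring_def tensor_with_ring_axioms_def restricted_action_def right_embedding_def
  using assms by (simp add: module_A trivial_action_closed on_top_closed')

abbreviation "ten m n x \<equiv> cat_tensor R A m n x \<one>"

lemma
  assumes mn: "m \<le> n"
  shows cat_tensor_scalar: "\<lbrakk>x \<in> carrier (A n); r \<in> carrier R\<rbrakk> \<Longrightarrow> cat_tensor R A m n x r = ten m n (r \<odot>\<^bsub>A n\<^esub> x)"
    and ten_closed: "x \<in> carrier (A n) \<Longrightarrow> ten m n x \<in> carrier (cat_hom R A m n)"
    and ten_add: "\<lbrakk>x \<in> carrier (A n); y \<in> carrier (A n)\<rbrakk> \<Longrightarrow>
      ten m n (x \<oplus>\<^bsub>A n\<^esub> y) = ten m n x \<oplus>\<^bsub>cat_hom R A m n\<^esub> ten m n y"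
    and ten_smult: "\<lbrakk>r \<in> carrier R; x \<in> carrier (A n)\<rbrakk> \<Longrightarrow>
      ten m n (r \<odot>\<^bsub>A n\<^esub> x) = r \<odot>\<^bsub>cat_hom R A m n\<^esub> ten m n x"
    and ten_surj: "X \<in> carrier (cat_hom R A m n) \<Longrightarrow> \<exists>x\<in>carrier (A n). X = ten m n x"
    and module_cat_hom_le: "module R (cat_hom R A m n)"
proof -
  interpret T: tensor_with_ring R "A n" "A (n - m)" "restricted_action R A m n" "trivial_action R (n - m)"
    using mn by (rule tensor_with_ring_A)
  have hom: "cat_hom R A m n = T.TP" using mn by (simp add: cat_hom_def)
  have ten: "cat_tensor R A m n x r = T.T x r" for x r by (simp add: cat_tensor_def)
  show "\<lbrakk>x \<in> carrier (A n); r \<in> carrier R\<rbrakk> \<Longrightarrow> cat_tensor R A m n x r = ten m n (r \<odot>\<^bsub>A n\<^esub> x)"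
    unfolding ten by (rule T.pure_tensor_scalar)
  show "x \<in> carrier (A n) \<Longrightarrow> ten m n x \<in> carrier (cat_hom R A m n)"
    unfolding ten hom by (rule T.pure_tensor_closed) simp_all
  show "\<lbrakk>x \<in> carrier (A n); y \<in> carrier (A n)\<rbrakk> \<Longrightarrow>
      ten m n (x \<oplus>\<^bsub>A n\<^esub> y) = ten m n x \<oplus>\<^bsub>cat_hom R A m n\<^esub> ten m n y"
    unfolding ten hom by (rule T.pure_tensor_add) simp_all
  show "\<lbrakk>r \<in> carrier R; x \<in> carrier (A n)\<rbrakk> \<Longrightarrow>
      ten m n (r \<odot>\<^bsub>A n\<^esub> x) = r \<odot>\<^bsub>cat_hom R A m n\<^esub> ten m n x"
    unfolding ten hom by (rule T.pure_tensor_smult) simp_all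
  show "X \<in> carrier (cat_hom R A m n) \<Longrightarrow> \<exists>x\<in>carrier (A n). X = ten m n x"
    unfolding ten hom by (rule T.pure_tensor_surj)
  show "module R (cat_hom R A m n)" unfolding hom by (rule T.module_TP)
qed

lemma ten_eqD:
  assumes mn: "m \<le> n" and x: "x \<in> carrier (A n)" "x' \<in> carrier (A n)" and eq: "ten m n x = ten m n x'"
  shows "x \<ominus>\<^bsub>A n\<^esub> x' \<in> trivial_kernel m n"
proof -
  interpret T: tensor_with_ring R "A n" "A (n - m)" "restricted_action R A m n" "trivial_action R (n - m)"
    using mn by (rule tensor_with_ring_A)
  show ?thesis
  proof (rule T.pure_tensor_eqD[OF submodule_trivial_kernel[OF mn] _ _ x])
    show "T.T x \<one> = T.T x' \<one>" using eq by (simp add: cat_tensor_def)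
    show "restricted_action R A m n x a \<ominus>\<^bsub>A n\<^esub> trivial_action R (n - m) a \<one> \<odot>\<^bsub>A n\<^esub> x \<in> trivial_kernel m n"
      if "x \<in> carrier (A n)" "a \<in> carrier (A (n - m))" for x a
      using trivial_kernelI[OF that] by (simp add: restricted_action_def right_embedding_def)
  qed (rule trivial_action_scalar)
qed

text \<open>The elements sent to zero form a submodule, and it contains the generators of
  \<open>trivial_kernel m n\<close> by the balancing relation of the tensor product.\<close>

lemma ten_eqI:
  assumes mn: "m \<le> n" and x: "x \<in> carrier (A n)" "x' \<in> carrier (A n)" and eq: "x \<ominus>\<^bsub>A n\<^esub> x' \<in> trivial_kernel m n"
  shows "ten m n x = ten m n x'"
proof -
  interpret T: tensor_with_ring R "A n" "A (n - m)" "restricted_action R A m n" "trivial_action R (n - m)"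
    using mn by (rule tensor_with_ring_A)
  interpret TP: module R T.TP by (rule T.module_TP)
  have closed: "T.T y \<one> \<in> carrier T.TP" if "y \<in> carrier (A n)" for y
    using that by (rule T.pure_tensor_closed) simp
  have minus: "T.T (y \<ominus>\<^bsub>A n\<^esub> z) \<one> = T.T y \<one> \<ominus>\<^bsub>T.TP\<^esub> T.T z \<one>" if "y \<in> carrier (A n)" "z \<in> carrier (A n)" for y z
    using that closed
    by (intro module_map_minus[where f = "\<lambda>x. T.T x \<one>", OF module_A T.module_TP])
       (simp_all add: T.pure_tensor_add T.pure_tensor_smult)
  let ?H = "{y \<in> carrier (A n). T.T y \<one> = \<zero>\<^bsub>T.TP\<^esub>}"
  have "submodule ?H R (A n)"
  proof (rule T.submoduleI')
    show "a \<oplus>\<^bsub>A n\<^esub> b \<in> ?H" if "a \<in> ?H" "b \<in> ?H" for a b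
      using that T.pure_tensor_add[of a b \<one>] by simp
    show "a \<odot>\<^bsub>A n\<^esub> b \<in> ?H" if "a \<in> carrier R" "b \<in> ?H" for a b
      using that T.pure_tensor_smult[of a b \<one>] by simp
  qed (auto simp: T.pure_tensor_zero)
  moreover have "trivial_relations m n \<subseteq> ?H"
  proof
    fix z assume z: "z \<in> trivial_relations m n"
    then obtain y d where yd: "y \<in> carrier (A n)" "d \<in> carrier (A (n - m))"
      and z_eq: "z = restricted_action R A m n y d \<ominus>\<^bsub>A n\<^esub> trivial_action R (n - m) d \<one> \<odot>\<^bsub>A n\<^esub> y"
      unfolding trivial_relations_def restricted_action_def right_embedding_def by blast
    have "T.T z \<one> = T.T (restricted_action R A m n y d) \<one> \<ominus>\<^bsub>T.TP\<^esub> T.T (trivial_action R (n - m) d \<one> \<odot>\<^bsub>A n\<^esub> y) \<one>"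
      unfolding z_eq using yd T.rho_closed trivial_action_closed by (intro minus) simp_all
    also have "\<dots> = \<zero>\<^bsub>T.TP\<^esub>"
      using T.pure_tensor_balanced[OF yd(2,1)] closed[OF T.rho_closed[OF yd]]
      by (simp add: a_minus_def TP.M.r_neg)
    finally show "z \<in> ?H" using z trivial_relations_closed[OF mn] by auto
  qed
  ultimately have "trivial_kernel m n \<subseteq> ?H" unfolding trivial_kernel_def by (rule module_span_least)
  then have "T.T (x \<ominus>\<^bsub>A n\<^esub> x') \<one> = \<zero>\<^bsub>T.TP\<^esub>" using eq by auto
  moreover have "x = (x \<ominus>\<^bsub>A n\<^esub> x') \<oplus>\<^bsub>A n\<^esub> x'"
    using x by (simp add: a_minus_def T.M.add.m_assoc T.M.l_neg)
  ultimately have "T.T x \<one> = T.T x' \<one>"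
    using T.pure_tensor_add[of "x \<ominus>\<^bsub>A n\<^esub> x'" x' \<one>] closed[OF x(2)] x by simp
  then show ?thesis by (simp add: cat_tensor_def)
qed

lemma compose_minus_left:
  assumes "m \<le> n" "x \<in> carrier (A n)" "x' \<in> carrier (A n)" "y \<in> carrier (A m)"
  shows "compose m n (x \<ominus>\<^bsub>A n\<^esub> x') y = compose m n x y \<ominus>\<^bsub>A n\<^esub> compose m n x' y"
  using assms
  by (intro module_map_minus[where f = "\<lambda>x. compose m n x y", OF module_A module_A])
     (simp_all add: compose_add_left compose_smult_left)

lemma compose_minus_right:
  assumes "m \<le> n" "x \<in> carrier (A n)" "y \<in> carrier (A m)" "y' \<in> carrier (A m)"
  shows "compose m n x (y \<ominus>\<^bsub>A m\<^esub> y') = compose m n x y \<ominus>\<^bsub>A n\<^esub> compose m n x y'"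
  using assms
  by (intro module_map_minus[where f = "compose m n x", OF module_A module_A])
     (simp_all add: compose_add_right compose_smult_right)

text \<open>The arguments are changed one at a time; linearity turns each change into an element of
  a kernel that composition respects.\<close>

lemma ten_compose_cong:
  assumes lm: "l \<le> m" and mn: "m \<le> n"
    and x: "x \<in> carrier (A n)" "x' \<in> carrier (A n)" and y: "y \<in> carrier (A m)" "y' \<in> carrier (A m)"
    and eq: "ten m n x = ten m n x'" "ten l m y = ten l m y'"
  shows "ten l n (compose m n x y) = ten l n (compose m n x' y')"
proof -
  have "ten l n (compose m n x y) = ten l n (compose m n x' y)"
    using compose_trivial_kernel_left[OF lm mn ten_eqD[OF mn x eq(1)] y(1)] lm mn x y
    by (intro ten_eqI) (simp_all add: compose_minus_left)
  also have "\<dots> = ten l n (compose m n x' y')"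
    using compose_trivial_kernel_right[OF lm mn x(2) ten_eqD[OF lm y eq(2)]] lm mn x y
    by (intro ten_eqI) (simp_all add: compose_minus_right)
  finally show ?thesis .
qed

section \<open>Composition of morphisms and the category axioms\<close>

definition rep :: "nat \<Rightarrow> nat \<Rightarrow> ((diagram \<Rightarrow> 'a) \<times> 'a \<Rightarrow> 'a) set \<Rightarrow> diagram \<Rightarrow> 'a" where
  "rep m n f = (SOME x. x \<in> carrier (A n) \<and> f = ten m n x)"

text \<open>If the chain \<open>l \<le> m \<le> n\<close> breaks, one of the factors comes from a
  zero module and bilinearity forces the value zero. Otherwise the choice made by \<open>rep\<close>
  is harmless by \<open>ten_compose_cong\<close>, and composites are computed with
  \<open>cat_comp_ten\<close>.\<close>

definition cat_comp :: "nat \<Rightarrow> nat \<Rightarrow> nat \<Rightarrow> ((diagram \<Rightarrow> 'a) \<times> 'a \<Rightarrow> 'a) set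
    \<Rightarrow> ((diagram \<Rightarrow> 'a) \<times> 'a \<Rightarrow> 'a) set \<Rightarrow> ((diagram \<Rightarrow> 'a) \<times> 'a \<Rightarrow> 'a) set" where
  "cat_comp l m n f g = (if l \<le> m \<and> m \<le> n then ten l n (compose m n (rep m n f) (rep l m g))
     else \<zero>\<^bsub>cat_hom R A l n\<^esub>)"

lemma cat_comp_ten:
  assumes "l \<le> m" "m \<le> n" "x \<in> carrier (A n)" "y \<in> carrier (A m)"
  shows "cat_comp l m n (ten m n x) (ten l m y) = ten l n (compose m n x y)"
proof -
  have rep: "rep i j (ten i j z) \<in> carrier (A j) \<and> ten i j z = ten i j (rep i j (ten i j z))"
    if "z \<in> carrier (A j)" for i j z
    unfolding rep_def by (rule someI[of _ z]) (simp add: that)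
  show ?thesis unfolding cat_comp_def
    using ten_compose_cong[OF assms(1,2,3) _ assms(4), of "rep m n (ten m n x)" "rep l m (ten l m y)"]
      rep[OF assms(3), of m] rep[OF assms(4), of l] assms by simp
qed

lemma module_cat_hom: "module R (cat_hom R A m n)"
proof (cases "m \<le> n")
  case False
  have "module R (zero_module :: ('a, ((diagram \<Rightarrow> 'a) \<times> 'a \<Rightarrow> 'a) set) module)"
    by (rule moduleI) (auto intro!: abelian_groupI simp: zero_module_def is_cring)
  then show ?thesis using False by (simp add: cat_hom_def)
qed (rule module_cat_hom_le)

lemma cat_hom_gt: "\<not> m \<le> n \<Longrightarrow> X \<in> carrier (cat_hom R A m n) \<Longrightarrow> X = \<zero>\<^bsub>cat_hom R A m n\<^esub>"
  by (simp add: cat_hom_def zero_module_def)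

theorem module_enriched_category_cat_hom:
  "module_enriched_category R (UNIV :: nat set) (cat_hom R A) cat_comp (\<lambda>n. ten n n \<one>\<^bsub>A n\<^esub>)"
proof -
  interpret H: module R "cat_hom R A m n" for m n by (rule module_cat_hom)
  have closed: "cat_comp l m n f g \<in> carrier (cat_hom R A l n)"
    if f: "f \<in> carrier (cat_hom R A m n)" and g: "g \<in> carrier (cat_hom R A l m)" for l m n f g
  proof (cases "l \<le> m \<and> m \<le> n")
    case True
    then obtain x y where "x \<in> carrier (A n)" "f = ten m n x" "y \<in> carrier (A m)" "g = ten l m y"
      using ten_surj f g by meson
    then show ?thesis using True by (simp add: cat_comp_ten ten_closed)
  qed (auto simp: cat_comp_def)
  have add_left: "cat_comp l m n (f \<oplus>\<^bsub>cat_hom R A m n\<^esub> f') g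
      = cat_comp l m n f g \<oplus>\<^bsub>cat_hom R A l n\<^esub> cat_comp l m n f' g"
    if f: "f \<in> carrier (cat_hom R A m n)" and f': "f' \<in> carrier (cat_hom R A m n)"
      and g: "g \<in> carrier (cat_hom R A l m)" for l m n f f' g
  proof (cases "l \<le> m \<and> m \<le> n")
    case True
    then obtain x x' y where "x \<in> carrier (A n)" "f = ten m n x" "x' \<in> carrier (A n)" "f' = ten m n x'"
      "y \<in> carrier (A m)" "g = ten l m y"
      using ten_surj f f' g by meson
    then show ?thesis using True
      by (simp add: cat_comp_ten compose_add_left ten_add[symmetric])
  qed (auto simp: cat_comp_def)
  have add_right: "cat_comp l m n f (g \<oplus>\<^bsub>cat_hom R A l m\<^esub> g')
      = cat_comp l m n f g \<oplus>\<^bsub>cat_hom R A l n\<^esub> cat_comp l m n f g'"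
    if f: "f \<in> carrier (cat_hom R A m n)" and g: "g \<in> carrier (cat_hom R A l m)"
      and g': "g' \<in> carrier (cat_hom R A l m)" for l m n f g g'
  proof (cases "l \<le> m \<and> m \<le> n")
    case True
    then obtain x y y' where "x \<in> carrier (A n)" "f = ten m n x" "y \<in> carrier (A m)" "g = ten l m y"
      "y' \<in> carrier (A m)" "g' = ten l m y'"
      using ten_surj f g g' by meson
    then show ?thesis using True
      by (simp add: cat_comp_ten compose_add_right ten_add[symmetric])
  qed (auto simp: cat_comp_def)
  have smult_left: "cat_comp l m n (r \<odot>\<^bsub>cat_hom R A m n\<^esub> f) g = r \<odot>\<^bsub>cat_hom R A l n\<^esub> cat_comp l m n f g"
    if r: "r \<in> carrier R" and f: "f \<in> carrier (cat_hom R A m n)" and g: "g \<in> carrier (cat_hom R A l m)"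
    for l m n r f g
  proof (cases "l \<le> m \<and> m \<le> n")
    case True
    then obtain x y where "x \<in> carrier (A n)" "f = ten m n x" "y \<in> carrier (A m)" "g = ten l m y"
      using ten_surj f g by meson
    then show ?thesis using True r
      by (simp add: cat_comp_ten compose_smult_left ten_smult[symmetric])
  qed (use r in \<open>auto simp: cat_comp_def\<close>)
  have smult_right: "cat_comp l m n f (r \<odot>\<^bsub>cat_hom R A l m\<^esub> g) = r \<odot>\<^bsub>cat_hom R A l n\<^esub> cat_comp l m n f g"
    if r: "r \<in> carrier R" and f: "f \<in> carrier (cat_hom R A m n)" and g: "g \<in> carrier (cat_hom R A l m)"
    for l m n r f g
  proof (cases "l \<le> m \<and> m \<le> n")
    case True
    then obtain x y where "x \<in> carrier (A n)" "f = ten m n x" "y \<in> carrier (A m)" "g = ten l m y"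
      using ten_surj f g by meson
    then show ?thesis using True r
      by (simp add: cat_comp_ten compose_smult_right ten_smult[symmetric])
  qed (use r in \<open>auto simp: cat_comp_def\<close>)
  \<comment> \<open>The zero morphism is 0 times itself, so homogeneity suffices. Together with
    \<open>zero_right\<close> this settles associativity when an intermediate hom module vanishes,
    even though the hom module from \<open>k\<close> to \<open>n\<close> may be nonzero.\<close>
  have zero_left: "cat_comp l m n \<zero>\<^bsub>cat_hom R A m n\<^esub> g = \<zero>\<^bsub>cat_hom R A l n\<^esub>"
    if "g \<in> carrier (cat_hom R A l m)" for l m n g
    using smult_left[of \<zero> "\<zero>\<^bsub>cat_hom R A m n\<^esub>" m n g l] closed[of "\<zero>\<^bsub>cat_hom R A m n\<^esub>" m n g l] that by simp
  have zero_right: "cat_comp l m n f \<zero>\<^bsub>cat_hom R A l m\<^esub> = \<zero>\<^bsub>cat_hom R A l n\<^esub>"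
    if "f \<in> carrier (cat_hom R A m n)" for l m n f
    using smult_right[of \<zero> f m n "\<zero>\<^bsub>cat_hom R A l m\<^esub>" l] closed[of f m n "\<zero>\<^bsub>cat_hom R A l m\<^esub>" l] that by simp
  have assoc: "cat_comp k m n f (cat_comp k l m g h) = cat_comp k l n (cat_comp l m n f g) h"
    if f: "f \<in> carrier (cat_hom R A m n)" and g: "g \<in> carrier (cat_hom R A l m)"
      and h: "h \<in> carrier (cat_hom R A k l)" for k l m n f g h
  proof -
    consider "k \<le> l" "l \<le> m" "m \<le> n" | "\<not> k \<le> l" | "\<not> l \<le> m" | "\<not> m \<le> n" by blast
    then show ?thesis
    proof cases
      case 1
      then obtain x y z where "x \<in> carrier (A n)" "f = ten m n x" "y \<in> carrier (A m)" "g = ten l m y"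
        "z \<in> carrier (A l)" "h = ten k l z"
        using ten_surj f g h by meson
      then show ?thesis using 1 by (simp add: cat_comp_ten compose_assoc)
    next
      case 2
      then show ?thesis using zero_right[OF f, of k] by (simp add: cat_comp_def[of k l])
    next
      case 3
      then show ?thesis using zero_right[OF f, of k] zero_left[OF h, of n]
        by (simp add: cat_comp_def[of k l m] cat_comp_def[of l m n])
    next
      case 4
      then show ?thesis using zero_left[OF h, of n]
        by (simp add: cat_comp_def[of k m n] cat_comp_def[of l m n])
    qed
  qed
  have ident_left: "cat_comp m n n (ten n n \<one>\<^bsub>A n\<^esub>) f = f" if f: "f \<in> carrier (cat_hom R A m n)" for m n f
  proof (cases "m \<le> n")
    case True
    then obtain x where "x \<in> carrier (A n)" "f = ten m n x" using ten_surj f by meson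
    then show ?thesis using True by (simp add: cat_comp_ten compose_def on_top_0)
  next
    \<comment> \<open>Here \<open>f\<close> can only be the zero morphism, which is also the default
      value of the composite.\<close>
    case False
    then show ?thesis using cat_hom_gt[OF False f] by (simp add: cat_comp_def)
  qed
  have ident_right: "cat_comp m m n f (ten m m \<one>\<^bsub>A m\<^esub>) = f" if f: "f \<in> carrier (cat_hom R A m n)" for m n f
  proof (cases "m \<le> n")
    case True
    then obtain x where "x \<in> carrier (A n)" "f = ten m n x" using ten_surj f by meson
    then show ?thesis using True by (simp add: cat_comp_ten compose_def on_top_one')
  next
    case False
    then show ?thesis using cat_hom_gt[OF False f] by (simp add: cat_comp_def)
  qed
  show ?thesis
    by unfold_locales
       (simp_all add: module_cat_hom closed add_left add_right smult_left smult_right assoc ident_left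
          ident_right ten_closed)
qed

text \<open>Both scalars move into the algebra elements, through \<open>compose\<close>, and come
  back out as \<open>r \<otimes> s\<close>.\<close>

lemma cat_comp_cat_tensor:
  assumes "l \<le> m" "m \<le> n" "x \<in> carrier (A n)" "y \<in> carrier (A m)" "r \<in> carrier R" "s \<in> carrier R"
  shows "cat_comp l m n (cat_tensor R A m n x r) (cat_tensor R A l m y s)
    = cat_tensor R A l n (x \<otimes>\<^bsub>A n\<^esub> on_top R m (n - m) y \<one>\<^bsub>A (n - m)\<^esub>) (r \<otimes> s)"
proof -
  have "cat_comp l m n (cat_tensor R A m n x r) (cat_tensor R A l m y s)
      = ten l n (compose m n (r \<odot>\<^bsub>A n\<^esub> x) (s \<odot>\<^bsub>A m\<^esub> y))"
    unfolding cat_tensor_scalar[OF assms(2,3,5)] cat_tensor_scalar[OF assms(1,4,6)]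
    using assms by (intro cat_comp_ten) simp_all
  also have "\<dots> = ten l n ((r \<otimes> s) \<odot>\<^bsub>A n\<^esub> compose m n x y)"
    using assms
    by (simp add: compose_smult_left compose_smult_right module.smult_assoc1[OF module_A, symmetric] m_comm)
  also have "\<dots> = cat_tensor R A l n (compose m n x y) (r \<otimes> s)"
    using assms by (intro cat_tensor_scalar[symmetric]) simp_all
  finally show ?thesis unfolding compose_def .
qed

end

section \<open>Diagram algebras\<close>

text \<open>No condition on the support: multiplication and stacking make sense for all such
  functions, so linearity in one argument can be stated without mentioning a family of
  diagrams.\<close>

definition ring_valued :: "('r, 'x) ring_scheme \<Rightarrow> ('s \<Rightarrow> 'r) \<Rightarrow> bool" where
  "ring_valued R x \<longleftrightarrow> (\<forall>s. x s \<in> carrier R)"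

definition linear_fun :: "('r, 'x) ring_scheme \<Rightarrow> (('s \<Rightarrow> 'r) \<Rightarrow> 't \<Rightarrow> 'r) \<Rightarrow> bool" where
  "linear_fun R f \<longleftrightarrow> (\<forall>x. ring_valued R x \<longrightarrow> ring_valued R (f x))
    \<and> (\<forall>x y. ring_valued R x \<longrightarrow> ring_valued R y \<longrightarrow> f (\<lambda>s. x s \<oplus>\<^bsub>R\<^esub> y s) = (\<lambda>t. f x t \<oplus>\<^bsub>R\<^esub> f y t))
    \<and> (\<forall>a x. a \<in> carrier R \<longrightarrow> ring_valued R x \<longrightarrow> f (\<lambda>s. a \<otimes>\<^bsub>R\<^esub> x s) = (\<lambda>t. a \<otimes>\<^bsub>R\<^esub> f x t))"

context cring
begin

lemma ring_valued_value: "ring_valued R x \<Longrightarrow> x s \<in> carrier R"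
  by (simp add: ring_valued_def)

lemma ring_valued_free_module: "x \<in> carrier (free_module R S) \<Longrightarrow> ring_valued R x"
  using free_module_value by (auto simp: ring_valued_def)

lemma ring_valued_basis_vec [simp]: "ring_valued R (basis_vec R s)"
  by (simp add: ring_valued_def)

lemma ring_valued_add [simp]: "\<lbrakk>ring_valued R x; ring_valued R y\<rbrakk> \<Longrightarrow> ring_valued R (\<lambda>s. x s \<oplus> y s)"
  by (simp add: ring_valued_def)

lemma ring_valued_smult [simp]: "\<lbrakk>a \<in> carrier R; ring_valued R x\<rbrakk> \<Longrightarrow> ring_valued R (\<lambda>s. a \<otimes> x s)"
  by (simp add: ring_valued_def)

lemma linear_fun_ring_valued: "\<lbrakk>linear_fun R f; ring_valued R x\<rbrakk> \<Longrightarrow> ring_valued R (f x)"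
  by (simp add: linear_fun_def)

lemma linear_fun_smult:
  "\<lbrakk>linear_fun R f; a \<in> carrier R; ring_valued R x\<rbrakk> \<Longrightarrow> f (\<lambda>s. a \<otimes> x s) = (\<lambda>t. a \<otimes> f x t)"
  by (simp add: linear_fun_def)

lemma linear_fun_id: "linear_fun R (\<lambda>x. x)"
  by (simp add: linear_fun_def)

lemma linear_fun_comp: "\<lbrakk>linear_fun R f; linear_fun R g\<rbrakk> \<Longrightarrow> linear_fun R (\<lambda>x. f (g x))"
  by (simp add: linear_fun_def)

text \<open>Applied once for each argument, this reduces multilinear identities in the algebras to
  identities between diagrams.\<close>

lemma linear_fun_eqI:
  fixes f g :: "('s \<Rightarrow> 'a) \<Rightarrow> 't \<Rightarrow> 'a"
  assumes f: "linear_fun R f" and g: "linear_fun R g" and x: "x \<in> carrier (free_module R S)"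
    and basis: "\<And>s. s \<in> S \<Longrightarrow> f (basis_vec R s) = g (basis_vec R s)"
  shows "f x = g x"
  using x
proof (induction rule: free_module_induct)
  case zero
  have rv: "ring_valued R (\<lambda>s. \<zero>)" by (simp add: ring_valued_def)
  have "h (\<lambda>s. \<zero>) = (\<lambda>t. \<zero>)" if "linear_fun R h" for h :: "('s \<Rightarrow> 'a) \<Rightarrow> 't \<Rightarrow> 'a"
  proof -
    have "h (\<lambda>s. \<zero> \<otimes> \<zero>) = (\<lambda>t. \<zero> \<otimes> h (\<lambda>s. \<zero>) t)"
      by (rule linear_fun_smult[OF that zero_closed rv])
    moreover have "ring_valued R (h (\<lambda>s. \<zero>))" by (rule linear_fun_ring_valued[OF that rv])
    ultimately show ?thesis by (simp add: ring_valued_value)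
  qed
  from this[OF f] this[OF g] show ?case by simp
next
  case (basis s)
  then show ?case by (rule assms(4))
next
  case (add x y)
  then show ?case using f g by (simp add: linear_fun_def ring_valued_free_module)
next
  case (smult a x)
  then show ?case using f g by (simp add: linear_fun_def ring_valued_free_module)
qed

end

section \<open>Bilinear extensions of operations on diagrams\<close>

locale bilinear_operation = cring R for R (structure) +
  fixes S :: "'s set" and T :: "'t set" and op :: "'s \<Rightarrow> 't \<Rightarrow> 'u" and w :: "'s \<Rightarrow> 't \<Rightarrow> 'a"
  assumes finite_S: "finite S" and finite_T: "finite T" and w_closed [simp]: "w p q \<in> carrier R"
begin

text \<open>With the weights \<open>\<delta> [^] middle_count p r\<close> this is multiplication of
  diagrams, with constant weight \<open>\<one>\<close> it is stacking.\<close>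

definition bil :: "('s \<Rightarrow> 'a) \<Rightarrow> ('t \<Rightarrow> 'a) \<Rightarrow> 'u \<Rightarrow> 'a" where
  "bil x y = (\<lambda>s. finsum R (\<lambda>(p, q). (x p \<otimes> y q) \<otimes> w p q) {(p, q). p \<in> S \<and> q \<in> T \<and> op p q = s})"

lemma finite_fibre: "finite {(p, q). p \<in> S \<and> q \<in> T \<and> op p q = s}"
  by (rule finite_subset[of _ "S \<times> T"]) (auto simp: finite_S finite_T)

lemma terms_closed:
  "\<lbrakk>ring_valued R x; ring_valued R y\<rbrakk> \<Longrightarrow> (\<lambda>(p, q). (x p \<otimes> y q) \<otimes> w p q) \<in> P \<rightarrow> carrier R"
  by (auto simp: ring_valued_def)

lemma ring_valued_bil [simp]: "\<lbrakk>ring_valued R x; ring_valued R y\<rbrakk> \<Longrightarrow> ring_valued R (bil x y)"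
proof -
  assume "ring_valued R x" "ring_valued R y"
  then have "bil x y s \<in> carrier R" for s
    unfolding bil_def by (intro finsum_closed terms_closed)
  then show ?thesis by (simp add: ring_valued_def)
qed

lemma bil_add_left:
  assumes "ring_valued R x" "ring_valued R x'" "ring_valued R y"
  shows "bil (\<lambda>s. x s \<oplus> x' s) y = (\<lambda>s. bil x y s \<oplus> bil x' y s)"
proof
  fix s
  let ?P = "{(p, q). p \<in> S \<and> q \<in> T \<and> op p q = s}"
  have "bil (\<lambda>s. x s \<oplus> x' s) y s
      = (\<Oplus>i\<in>?P. (case i of (p, q) \<Rightarrow> (x p \<otimes> y q) \<otimes> w p q) \<oplus> (case i of (p, q) \<Rightarrow> (x' p \<otimes> y q) \<otimes> w p q))"
    unfolding bil_def using assms
    by (intro finsum_cong') (auto simp: ring_valued_value l_distr)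
  also have "\<dots> = bil x y s \<oplus> bil x' y s"
    unfolding bil_def by (rule finsum_addf[OF terms_closed terms_closed]) (use assms in simp_all)
  finally show "bil (\<lambda>s. x s \<oplus> x' s) y s = bil x y s \<oplus> bil x' y s" .
qed

lemma bil_add_right:
  assumes "ring_valued R x" "ring_valued R y" "ring_valued R y'"
  shows "bil x (\<lambda>s. y s \<oplus> y' s) = (\<lambda>s. bil x y s \<oplus> bil x y' s)"
proof
  fix s
  let ?P = "{(p, q). p \<in> S \<and> q \<in> T \<and> op p q = s}"
  have "bil x (\<lambda>s. y s \<oplus> y' s) s
      = (\<Oplus>i\<in>?P. (case i of (p, q) \<Rightarrow> (x p \<otimes> y q) \<otimes> w p q) \<oplus> (case i of (p, q) \<Rightarrow> (x p \<otimes> y' q) \<otimes> w p q))"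
    unfolding bil_def using assms
    by (intro finsum_cong') (auto simp: ring_valued_value l_distr r_distr)
  also have "\<dots> = bil x y s \<oplus> bil x y' s"
    unfolding bil_def by (rule finsum_addf[OF terms_closed terms_closed]) (use assms in simp_all)
  finally show "bil x (\<lambda>s. y s \<oplus> y' s) s = bil x y s \<oplus> bil x y' s" .
qed

lemma bil_smult_left:
  assumes "a \<in> carrier R" "ring_valued R x" "ring_valued R y"
  shows "bil (\<lambda>s. a \<otimes> x s) y = (\<lambda>s. a \<otimes> bil x y s)"
proof
  fix s
  let ?P = "{(p, q). p \<in> S \<and> q \<in> T \<and> op p q = s}"
  have "bil (\<lambda>s. a \<otimes> x s) y s = (\<Oplus>i\<in>?P. a \<otimes> (case i of (p, q) \<Rightarrow> (x p \<otimes> y q) \<otimes> w p q))"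
    unfolding bil_def using assms
    by (intro finsum_cong') (auto simp: ring_valued_value m_assoc)
  also have "\<dots> = a \<otimes> bil x y s"
    unfolding bil_def using assms by (intro finsum_rdistr[symmetric] finite_fibre terms_closed)
  finally show "bil (\<lambda>s. a \<otimes> x s) y s = a \<otimes> bil x y s" .
qed

lemma bil_smult_right:
  assumes "a \<in> carrier R" "ring_valued R x" "ring_valued R y"
  shows "bil x (\<lambda>s. a \<otimes> y s) = (\<lambda>s. a \<otimes> bil x y s)"
proof
  fix s
  let ?P = "{(p, q). p \<in> S \<and> q \<in> T \<and> op p q = s}"
  have "bil x (\<lambda>s. a \<otimes> y s) s = (\<Oplus>i\<in>?P. a \<otimes> (case i of (p, q) \<Rightarrow> (x p \<otimes> y q) \<otimes> w p q))"
    unfolding bil_def using assms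
    by (intro finsum_cong') (auto simp: ring_valued_value m_assoc m_lcomm)
  also have "\<dots> = a \<otimes> bil x y s"
    unfolding bil_def using assms by (intro finsum_rdistr[symmetric] finite_fibre terms_closed)
  finally show "bil x (\<lambda>s. a \<otimes> y s) s = a \<otimes> bil x y s" .
qed

lemma linear_bil_left:
  "\<lbrakk>linear_fun R g; ring_valued R y\<rbrakk> \<Longrightarrow> linear_fun R (\<lambda>x. bil (g x) y)"
proof -
  assume g: "linear_fun R g" and y: "ring_valued R y"
  have "linear_fun R (\<lambda>x. bil x y)" using y by (simp add: linear_fun_def bil_add_left bil_smult_left)
  from linear_fun_comp[OF this g] show ?thesis .
qed

lemma linear_bil_right:
  "\<lbrakk>ring_valued R x; linear_fun R g\<rbrakk> \<Longrightarrow> linear_fun R (\<lambda>y. bil x (g y))"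
proof -
  assume x: "ring_valued R x" and g: "linear_fun R g"
  have "linear_fun R (bil x)" using x by (simp add: linear_fun_def bil_add_right bil_smult_right)
  from linear_fun_comp[OF this g] show ?thesis .
qed

lemma bil_basis_vec:
  assumes "p \<in> S" "q \<in> T"
  shows "bil (basis_vec R p) (basis_vec R q) = (\<lambda>s. w p q \<otimes> basis_vec R (op p q) s)"
proof
  fix s
  let ?P = "{(p, q). p \<in> S \<and> q \<in> T \<and> op p q = s}"
  have eq: "bil (basis_vec R p) (basis_vec R q) s
      = (\<Oplus>i\<in>?P. if (p, q) = i then (case i of (p, q) \<Rightarrow> w p q) else \<zero>)"
    unfolding bil_def by (intro finsum_cong') (auto simp: basis_vec_def split: if_split_asm)
  show "bil (basis_vec R p) (basis_vec R q) s = w p q \<otimes> basis_vec R (op p q) s"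
  proof (cases "op p q = s")
    case True
    have "(\<Oplus>i\<in>?P. if (p, q) = i then (case i of (p, q) \<Rightarrow> w p q) else \<zero>) = (case (p, q) of (p, q) \<Rightarrow> w p q)"
      using True assms by (intro finsum_singleton finite_fibre) auto
    then show ?thesis unfolding eq using True by (simp add: basis_vec_def)
  next
    case False
    have "(\<Oplus>i\<in>?P. if (p, q) = i then (case i of (p, q) \<Rightarrow> w p q) else \<zero>) = \<zero>"
      using False by (intro add.finprod_one_eqI) auto
    then show ?thesis unfolding eq using False by (simp add: basis_vec_def)
  qed
qed

text \<open>The sum runs over all of \<open>S\<close> and \<open>T\<close>, but coefficients outside
  \<open>S'\<close> and \<open>T'\<close> vanish. Hence products formed in the partition algebra
  stay in the span of a closed family of diagrams.\<close>

lemma bil_closed: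
  assumes x: "x \<in> carrier (free_module R S')" and y: "y \<in> carrier (free_module R T')"
    and op: "\<And>p q. \<lbrakk>p \<in> S'; q \<in> T'\<rbrakk> \<Longrightarrow> op p q \<in> U" and "finite U"
  shows "bil x y \<in> carrier (free_module R U)"
proof -
  have rv: "ring_valued R (bil x y)" using x y by (simp add: ring_valued_free_module)
  have outside: "bil x y s = \<zero>" if "s \<notin> U" for s
    unfolding bil_def
  proof (intro add.finprod_one_eqI, clarify)
    fix p q assume "s = op p q"
    then have "p \<notin> S' \<or> q \<notin> T'" using op that by blast
    then show "x p \<otimes> y q \<otimes> w p q = \<zero>"
      using free_module_outside[OF x] free_module_outside[OF y] x y by (auto simp: free_module_value)
  qed
  then have "finite {s. bil x y s \<noteq> \<zero>}" using \<open>finite U\<close> by (auto intro: finite_subset[of _ U])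
  then show ?thesis using rv outside by (simp add: carrier_free_module ring_valued_def del: free_module_value)
qed

end

text \<open>\<open>M\<close> is only asked to agree with a free module in its module structure,
  because the partition algebra also carries a multiplication and a unit. One inclusion is
  minimality of the span, the other is induction over linear combinations.\<close>

lemma module_span_basis:
  fixes M :: "('r, 's \<Rightarrow> 'r) module"
  assumes "cring R" "S \<subseteq> T"
    and M: "carrier M = carrier (free_module R T)" "zero M = zero (free_module R T)"
      "add M = add (free_module R T)" "smult M = smult (free_module R T)"
  shows "module_span R M (basis_vec R ` S) = carrier (free_module R S)"
proof -
  interpret cring R by fact
  interpret FS: module R "free_module R S" by (rule module_free_module)
  interpret FT: module R "free_module R T" by (rule module_free_module)
  have sub: "submodule H R M \<longleftrightarrow> submodule H R (free_module R T)" for H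
    using M by (simp add: submodule_def submodule_axioms_def)
  have "submodule (carrier (free_module R S)) R (free_module R T)"
  proof (rule FT.submoduleI')
    show "carrier (free_module R S) \<subseteq> carrier (free_module R T)"
    proof
      fix x assume x: "x \<in> carrier (free_module R S)"
      then show "x \<in> carrier (free_module R T)"
        using assms(2) free_module_support[OF x] free_module_outside[OF x] free_module_value[OF x]
        unfolding carrier_free_module[of R T] by blast
    qed
  qed (use FS.M.zero_closed FS.add.m_closed FS.smult_closed in simp_all)
  then have "module_span R M (basis_vec R ` S) \<subseteq> carrier (free_module R S)"
    by (intro module_span_least) (auto simp: sub)
  moreover have "x \<in> module_span R M (basis_vec R ` S)" if x: "x \<in> carrier (free_module R S)" for x
    unfolding module_span_def
  proof (rule InterI)
    fix H assume "H \<in> {H. submodule H R M \<and> basis_vec R ` S \<subseteq> H}"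
    then have H: "submodule H R (free_module R T)" and basis: "basis_vec R ` S \<subseteq> H" by (auto simp: sub)
    from x show "x \<in> H"
    proof (induction rule: free_module_induct)
      case zero
      then show ?case using FT.submodule_zero[OF H] by simp
    next
      case (basis s)
      then show ?case using \<open>basis_vec R ` S \<subseteq> H\<close> by blast
    next
      case (add x y)
      then show ?case using FT.submoduleE(5)[OF H] by simp
    next
      case (smult a x)
      then show ?case using FT.submoduleE(4)[OF H] by simp
    qed
  qed
  ultimately show ?thesis by blast
qed

section \<open>The algebra spanned by a closed family of diagrams\<close>

locale diagram_algebras = cring R for R (structure) +
  fixes \<delta> :: 'a and D :: "nat \<Rightarrow> diagram set"
  assumes delta_closed [simp]: "\<delta> \<in> carrier R"
    and D_subset: "D n \<subseteq> diagrams n"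
    and id_diagram_D: "id_diagram n \<in> D n"
    and diagram_comp_D: "\<lbrakk>p \<in> D n; r \<in> D n\<rbrakk> \<Longrightarrow> diagram_comp p r \<in> D n"
    and diagram_on_top_D: "\<lbrakk>p \<in> D a; q \<in> D b\<rbrakk> \<Longrightarrow> diagram_on_top a p q \<in> D (a + b)"
begin

text \<open>Only the carrier of the partition algebra shrinks; its multiplication still sums over
  all diagrams, with zero coefficients outside \<open>D n\<close>.\<close>

definition alg :: "nat \<Rightarrow> ('a, diagram \<Rightarrow> 'a) module" where
  "alg n = (partition_algebra R \<delta> n)\<lparr>carrier := carrier (free_module R (D n))\<rparr>"

sublocale mul: bilinear_operation R "diagrams n" "diagrams n" diagram_comp "\<lambda>p r. \<delta> [^] middle_count p r" for n
  by unfold_locales (simp_all add: finite_diagrams)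

sublocale top: bilinear_operation R "diagrams a" "diagrams b" "diagram_on_top a" "\<lambda>_ _. \<one>" for a b
  by unfold_locales (simp_all add: finite_diagrams)

lemmas linear_intros = mul.linear_bil_left mul.linear_bil_right top.linear_bil_left top.linear_bil_right
  linear_fun_id

lemma finite_D: "finite (D n)"
  using D_subset finite_diagrams by (rule finite_subset)

lemma D_diagrams: "p \<in> D n \<Longrightarrow> p \<in> diagrams n"
  using D_subset by blast

lemma carrier_alg: "carrier (alg n) = carrier (free_module R (D n))"
  by (simp add: alg_def)

lemma alg_simps [simp]:
  "\<zero>\<^bsub>alg n\<^esub> = (\<lambda>s. \<zero>)" "x \<oplus>\<^bsub>alg n\<^esub> y = (\<lambda>s. x s \<oplus> y s)" "a \<odot>\<^bsub>alg n\<^esub> x = (\<lambda>s. a \<otimes> x s)"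
  "\<one>\<^bsub>alg n\<^esub> = basis_vec R (id_diagram n)"
  by (simp_all add: alg_def partition_algebra_def)

lemma alg_mult [simp]: "x \<otimes>\<^bsub>alg n\<^esub> y = mul.bil n x y"
  by (simp add: alg_def partition_algebra_def mul.bil_def)

lemma ring_valued_alg: "x \<in> carrier (alg n) \<Longrightarrow> ring_valued R x"
  by (simp add: carrier_alg ring_valued_free_module)

lemma on_top_bil: "\<lbrakk>ring_valued R x; ring_valued R y\<rbrakk> \<Longrightarrow> on_top R a b x y = top.bil a b x y"
  unfolding on_top_def top.bil_def by (intro ext finsum_cong') (auto simp: ring_valued_value)

lemma mul_basis_vec: "\<lbrakk>p \<in> D n; q \<in> D n\<rbrakk> \<Longrightarrow>
    mul.bil n (basis_vec R p) (basis_vec R q) = (\<lambda>s. \<delta> [^] middle_count p q \<otimes> basis_vec R (diagram_comp p q) s)"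
  by (simp add: mul.bil_basis_vec D_diagrams)

lemma top_basis_vec: "\<lbrakk>p \<in> D a; q \<in> D b\<rbrakk> \<Longrightarrow>
    top.bil a b (basis_vec R p) (basis_vec R q) = basis_vec R (diagram_on_top a p q)"
  by (simp add: top.bil_basis_vec D_diagrams)

lemma mul_closed: "\<lbrakk>x \<in> carrier (alg n); y \<in> carrier (alg n)\<rbrakk> \<Longrightarrow> mul.bil n x y \<in> carrier (alg n)"
  unfolding carrier_alg by (rule mul.bil_closed) (auto intro: diagram_comp_D finite_D)

lemma top_closed: "\<lbrakk>x \<in> carrier (alg a); y \<in> carrier (alg b)\<rbrakk> \<Longrightarrow> top.bil a b x y \<in> carrier (alg (a + b))"
  unfolding carrier_alg by (rule top.bil_closed) (auto intro: diagram_on_top_D finite_D)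

lemma one_alg_closed: "basis_vec R (id_diagram n) \<in> carrier (alg n)"
  unfolding carrier_alg by (simp add: id_diagram_D)

text \<open>Expanding the arguments into diagrams one after the other leaves associativity of
  \<open>diagram_comp\<close> and the equality of two exponents of \<open>\<delta>\<close>.\<close>

lemma mul_assoc:
  assumes x: "x \<in> carrier (alg n)" and y: "y \<in> carrier (alg n)" and z: "z \<in> carrier (alg n)"
  shows "mul.bil n (mul.bil n x y) z = mul.bil n x (mul.bil n y z)"
proof (rule linear_fun_eqI[OF _ _ x[unfolded carrier_alg]])
  note rv = ring_valued_alg[OF x] ring_valued_alg[OF y] ring_valued_alg[OF z]
  fix p assume p: "p \<in> D n"
  show "mul.bil n (mul.bil n (basis_vec R p) y) z = mul.bil n (basis_vec R p) (mul.bil n y z)"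
  proof (rule linear_fun_eqI[OF _ _ y[unfolded carrier_alg]])
    fix q assume q: "q \<in> D n"
    show "mul.bil n (mul.bil n (basis_vec R p) (basis_vec R q)) z
        = mul.bil n (basis_vec R p) (mul.bil n (basis_vec R q) z)"
    proof (rule linear_fun_eqI[OF _ _ z[unfolded carrier_alg]])
      fix r assume r: "r \<in> D n"
      note d = p q r diagram_comp_D[OF p q] diagram_comp_D[OF q r]
      note pqr = D_diagrams[OF p] D_diagrams[OF q] D_diagrams[OF r]
      have "\<delta> [^] middle_count p q \<otimes> \<delta> [^] middle_count (diagram_comp p q) r
          = \<delta> [^] middle_count q r \<otimes> \<delta> [^] middle_count p (diagram_comp q r)"
        using middle_count_assoc[OF pqr] by (simp add: nat_pow_mult)
      \<comment> \<open>The extra factor \<open>c\<close> stands for the value of the basis vector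
        that follows the powers of \<open>\<delta>\<close> once all scalars have been pulled
        out.\<close>
      then have "\<delta> [^] middle_count p q \<otimes> (\<delta> [^] middle_count (diagram_comp p q) r \<otimes> c)
          = \<delta> [^] middle_count q r \<otimes> (\<delta> [^] middle_count p (diagram_comp q r) \<otimes> c)" if "c \<in> carrier R" for c
        using that by (simp add: m_assoc[symmetric])
      then show "mul.bil n (mul.bil n (basis_vec R p) (basis_vec R q)) (basis_vec R r)
          = mul.bil n (basis_vec R p) (mul.bil n (basis_vec R q) (basis_vec R r))"
        by (simp add: mul_basis_vec d mul.bil_smult_left mul.bil_smult_right diagram_comp_assoc[OF pqr])
    qed (intro linear_intros; simp add: rv)+
  qed (intro linear_intros; simp add: rv)+
qed (intro linear_intros; simp add: ring_valued_alg[OF y] ring_valued_alg[OF z])+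

lemma mul_one_left:
  assumes x: "x \<in> carrier (alg n)"
  shows "mul.bil n (basis_vec R (id_diagram n)) x = x"
proof (rule linear_fun_eqI[OF _ _ x[unfolded carrier_alg]])
  show "mul.bil n (basis_vec R (id_diagram n)) (basis_vec R p) = basis_vec R p" if "p \<in> D n" for p
    using that D_diagrams[OF that]
    by (simp add: mul_basis_vec id_diagram_D diagram_comp_id_left middle_count_id_left)
qed (intro linear_intros; simp)+

lemma mul_one_right:
  assumes x: "x \<in> carrier (alg n)"
  shows "mul.bil n x (basis_vec R (id_diagram n)) = x"
proof (rule linear_fun_eqI[OF _ _ x[unfolded carrier_alg]])
  show "mul.bil n (basis_vec R p) (basis_vec R (id_diagram n)) = basis_vec R p" if "p \<in> D n" for p
    using that D_diagrams[OF that]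
    by (simp add: mul_basis_vec id_diagram_D diagram_comp_id_right middle_count_id_right)
qed (intro linear_intros; simp)+

text \<open>Once all four arguments are diagrams, this is the interchange law for stacking, and the
  exponents of \<open>\<delta>\<close> add up by \<open>middle_count_on_top\<close>.\<close>

lemma top_mul:
  assumes x: "x \<in> carrier (alg a)" and x': "x' \<in> carrier (alg a)"
    and y: "y \<in> carrier (alg b)" and y': "y' \<in> carrier (alg b)"
  shows "top.bil a b (mul.bil a x x') (mul.bil b y y')
    = mul.bil (a + b) (top.bil a b x y) (top.bil a b x' y')"
proof (rule linear_fun_eqI[OF _ _ x[unfolded carrier_alg]])
  note rv = ring_valued_alg[OF x] ring_valued_alg[OF x'] ring_valued_alg[OF y] ring_valued_alg[OF y']
  let ?e = "basis_vec R"
  fix p assume p: "p \<in> D a"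
  show "top.bil a b (mul.bil a (?e p) x') (mul.bil b y y')
      = mul.bil (a + b) (top.bil a b (?e p) y) (top.bil a b x' y')"
  proof (rule linear_fun_eqI[OF _ _ x'[unfolded carrier_alg]])
    fix p' assume p': "p' \<in> D a"
    show "top.bil a b (mul.bil a (?e p) (?e p')) (mul.bil b y y')
        = mul.bil (a + b) (top.bil a b (?e p) y) (top.bil a b (?e p') y')"
    proof (rule linear_fun_eqI[OF _ _ y[unfolded carrier_alg]])
      fix q assume q: "q \<in> D b"
      show "top.bil a b (mul.bil a (?e p) (?e p')) (mul.bil b (?e q) y')
          = mul.bil (a + b) (top.bil a b (?e p) (?e q)) (top.bil a b (?e p') y')"
      proof (rule linear_fun_eqI[OF _ _ y'[unfolded carrier_alg]])
        fix q' assume q': "q' \<in> D b"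
        note D = diagram_comp_D[OF p p'] diagram_comp_D[OF q q'] diagram_on_top_D[OF p q] diagram_on_top_D[OF p' q']
        note d = D_diagrams[OF p] D_diagrams[OF p'] D_diagrams[OF q] D_diagrams[OF q']
        show "top.bil a b (mul.bil a (?e p) (?e p')) (mul.bil b (?e q) (?e q'))
            = mul.bil (a + b) (top.bil a b (?e p) (?e q)) (top.bil a b (?e p') (?e q'))"
          using p p' q q' D
          by (simp add: mul_basis_vec top_basis_vec top.bil_smult_left top.bil_smult_right
              diagram_comp_on_top[OF d] middle_count_on_top[OF d] nat_pow_mult[symmetric] m_assoc)
      qed (intro linear_intros; simp add: rv)+
    qed (intro linear_intros; simp add: rv)+
  qed (intro linear_intros; simp add: rv)+
qed (intro linear_intros; simp add: ring_valued_alg[OF x'] ring_valued_alg[OF y] ring_valued_alg[OF y'])+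

lemma top_assoc:
  assumes x: "x \<in> carrier (alg a)" and y: "y \<in> carrier (alg b)" and z: "z \<in> carrier (alg c)"
  shows "top.bil (a + b) c (top.bil a b x y) z = top.bil a (b + c) x (top.bil b c y z)"
proof (rule linear_fun_eqI[OF _ _ x[unfolded carrier_alg]])
  note rv = ring_valued_alg[OF x] ring_valued_alg[OF y] ring_valued_alg[OF z]
  let ?e = "basis_vec R"
  fix p assume p: "p \<in> D a"
  show "top.bil (a + b) c (top.bil a b (?e p) y) z = top.bil a (b + c) (?e p) (top.bil b c y z)"
  proof (rule linear_fun_eqI[OF _ _ y[unfolded carrier_alg]])
    fix q assume q: "q \<in> D b"
    show "top.bil (a + b) c (top.bil a b (?e p) (?e q)) z = top.bil a (b + c) (?e p) (top.bil b c (?e q) z)"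
    proof (rule linear_fun_eqI[OF _ _ z[unfolded carrier_alg]])
      fix r assume r: "r \<in> D c"
      show "top.bil (a + b) c (top.bil a b (?e p) (?e q)) (?e r)
          = top.bil a (b + c) (?e p) (top.bil b c (?e q) (?e r))"
        using p q r diagram_on_top_D[OF p q] diagram_on_top_D[OF q r]
        by (simp add: top_basis_vec diagram_on_top_assoc)
    qed (intro linear_intros; simp add: rv)+
  qed (intro linear_intros; simp add: rv)+
qed (intro linear_intros; simp add: ring_valued_alg[OF y] ring_valued_alg[OF z])+

lemma top_0:
  assumes x: "x \<in> carrier (alg a)"
  shows "top.bil a 0 x (basis_vec R (id_diagram 0)) = x"
proof (rule linear_fun_eqI[OF _ _ x[unfolded carrier_alg]])
  have "id_diagram 0 = {}" using id_diagram_closed[of 0] by (simp add: diagrams_0)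
  then show "top.bil a 0 (basis_vec R p) (basis_vec R (id_diagram 0)) = basis_vec R p" if "p \<in> D a" for p
    using that id_diagram_D[of 0] by (simp add: top_basis_vec diagram_on_top_empty)
qed (intro linear_intros; simp)+

section \<open>The trivial action as a linear functional\<close>

lemma trivial_action_scalar':
  assumes d: "ring_valued R d" and r: "r \<in> carrier R"
  shows "trivial_action R k d r = trivial_action R k d \<one> \<otimes> r"
proof -
  have "trivial_action R k d r
      = (\<Oplus>e\<in>diagrams k. (d e \<otimes> (if permutation_diagram k e then \<one> else \<zero>)) \<otimes> r)"
    unfolding trivial_action_def using assms by (intro finsum_cong') (auto simp: ring_valued_value)
  also have "\<dots> = trivial_action R k d \<one> \<otimes> r"
    unfolding trivial_action_def using assms
    by (intro finsum_ldistr[symmetric] finite_diagrams) (auto simp: ring_valued_value)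
  finally show ?thesis .
qed

text \<open>The scalar value is read as a function on the one-point type \<open>unit\<close>, so
  that \<open>linear_fun_eqI\<close> applies to functionals too.\<close>

lemma linear_trivial_action: "linear_fun R (\<lambda>d (_ :: unit). trivial_action R k d \<one>)"
  unfolding linear_fun_def
proof (intro conjI allI impI)
  fix d e :: "diagram \<Rightarrow> 'a" and a :: 'a
  assume d: "ring_valued R d"
  let ?c = "\<lambda>e. if permutation_diagram k e then \<one> else \<zero>"
  show "ring_valued R (\<lambda>_ :: unit. trivial_action R k d \<one>)"
    using d by (auto simp: ring_valued_def trivial_action_def intro!: finsum_closed)
  show "(\<lambda>_ :: unit. trivial_action R k (\<lambda>s. a \<otimes> d s) \<one>) = (\<lambda>_. a \<otimes> trivial_action R k d \<one>)"
    if a: "a \<in> carrier R"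
  proof -
    have "trivial_action R k (\<lambda>s. a \<otimes> d s) \<one> = (\<Oplus>s\<in>diagrams k. a \<otimes> (d s \<otimes> ?c s))"
      unfolding trivial_action_def using d a by (intro finsum_cong') (auto simp: ring_valued_value)
    also have "\<dots> = a \<otimes> trivial_action R k d \<one>"
      unfolding trivial_action_def using d a
      by (intro finsum_rdistr[symmetric] finite_diagrams) (auto simp: ring_valued_value)
    finally show ?thesis by simp
  qed
  show "(\<lambda>_ :: unit. trivial_action R k (\<lambda>s. d s \<oplus> e s) \<one>)
      = (\<lambda>_. trivial_action R k d \<one> \<oplus> trivial_action R k e \<one>)" if e: "ring_valued R e"
  proof -
    have "trivial_action R k (\<lambda>s. d s \<oplus> e s) \<one> = (\<Oplus>s\<in>diagrams k. d s \<otimes> ?c s \<oplus> e s \<otimes> ?c s)"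
      unfolding trivial_action_def using d e by (intro finsum_cong') (auto simp: ring_valued_value)
    also have "\<dots> = trivial_action R k d \<one> \<oplus> trivial_action R k e \<one>"
      unfolding trivial_action_def using d e
      by (intro finsum_addf) (auto simp: ring_valued_value)
    finally show ?thesis by simp
  qed
qed

lemma trivial_action_closed': "ring_valued R d \<Longrightarrow> r \<in> carrier R \<Longrightarrow> trivial_action R k d r \<in> carrier R"
  unfolding trivial_action_def by (intro finsum_closed) (auto simp: ring_valued_value)

lemma trivial_action_basis_vec:
  assumes "p \<in> D k"
  shows "trivial_action R k (basis_vec R p) \<one> = (if permutation_diagram k p then \<one> else \<zero>)"
proof -
  let ?c = "\<lambda>e. if permutation_diagram k e then \<one> else \<zero>"
  have "trivial_action R k (basis_vec R p) \<one> = (\<Oplus>e\<in>diagrams k. if p = e then ?c e else \<zero>)"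
    unfolding trivial_action_def by (intro finsum_cong') (auto simp: basis_vec_def)
  also have "\<dots> = ?c p"
    using D_diagrams[OF assms] by (intro finsum_singleton finite_diagrams) auto
  finally show ?thesis .
qed

lemma trivial_action_top_left:
  assumes d: "d \<in> carrier (alg b)"
  shows "trivial_action R (a + b) (top.bil a b (basis_vec R (id_diagram a)) d) \<one> = trivial_action R b d \<one>"
proof -
  have "(\<lambda>_ :: unit. trivial_action R (a + b) (top.bil a b (basis_vec R (id_diagram a)) d) \<one>)
      = (\<lambda>_. trivial_action R b d \<one>)"
  proof (rule linear_fun_eqI[OF _ _ d[unfolded carrier_alg]])
    show "linear_fun R (\<lambda>d (_ :: unit). trivial_action R (a + b) (top.bil a b (basis_vec R (id_diagram a)) d) \<one>)"
      by (intro linear_fun_comp[OF linear_trivial_action top.linear_bil_right[OF _ linear_fun_id]]) simp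
    show "linear_fun R (\<lambda>d (_ :: unit). trivial_action R b d \<one>)" by (rule linear_trivial_action)
    show "(\<lambda>_ :: unit. trivial_action R (a + b) (top.bil a b (basis_vec R (id_diagram a)) (basis_vec R p)) \<one>)
        = (\<lambda>_. trivial_action R b (basis_vec R p) \<one>)" if "p \<in> D b" for p
      using that id_diagram_D diagram_on_top_D[OF id_diagram_D that] D_diagrams[OF that]
      by (simp add: top_basis_vec trivial_action_basis_vec permutation_on_top_id_left)
  qed
  then show ?thesis by metis
qed

lemma trivial_action_top_right:
  assumes d: "d \<in> carrier (alg a)"
  shows "trivial_action R (a + b) (top.bil a b d (basis_vec R (id_diagram b))) \<one> = trivial_action R a d \<one>"
proof -
  have "(\<lambda>_ :: unit. trivial_action R (a + b) (top.bil a b d (basis_vec R (id_diagram b))) \<one>)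
      = (\<lambda>_. trivial_action R a d \<one>)"
  proof (rule linear_fun_eqI[OF _ _ d[unfolded carrier_alg]])
    show "linear_fun R (\<lambda>d (_ :: unit). trivial_action R (a + b) (top.bil a b d (basis_vec R (id_diagram b))) \<one>)"
      by (intro linear_fun_comp[OF linear_trivial_action top.linear_bil_left[OF linear_fun_id]]) simp
    show "linear_fun R (\<lambda>d (_ :: unit). trivial_action R a d \<one>)" by (rule linear_trivial_action)
    show "(\<lambda>_ :: unit. trivial_action R (a + b) (top.bil a b (basis_vec R p) (basis_vec R (id_diagram b))) \<one>)
        = (\<lambda>_. trivial_action R a (basis_vec R p) \<one>)" if "p \<in> D a" for p
      using that id_diagram_D diagram_on_top_D[OF that id_diagram_D] D_diagrams[OF that]
      by (simp add: top_basis_vec trivial_action_basis_vec permutation_on_top_id_right)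
  qed
  then show ?thesis by metis
qed

lemma module_alg: "module R (alg n)"
proof -
  interpret F: module R "free_module R (D n)" by (rule module_free_module)
  show ?thesis
  proof (rule moduleI)
    show "abelian_group (alg n)"
    proof (rule abelian_groupI)
      show "\<exists>y\<in>carrier (alg n). y \<oplus>\<^bsub>alg n\<^esub> x = \<zero>\<^bsub>alg n\<^esub>" if "x \<in> carrier (alg n)" for x
        using that F.add.l_inv_ex[of x] by (simp add: carrier_alg)
    qed (use F.M.zero_closed F.add.m_closed in
          \<open>simp_all add: carrier_alg ring_valued_value ring_valued_free_module a_ac\<close>)
  qed (use F.smult_closed in \<open>simp_all add: is_cring carrier_alg ring_valued_value ring_valued_free_module
      l_distr r_distr m_assoc\<close>)
qed

lemma ring_alg: "ring (alg n)"
proof (rule ringI)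
  show "abelian_group (alg n)" by (rule module.axioms(2)[OF module_alg])
  show "monoid (alg n)"
    by (rule monoidI) (simp_all add: mul_closed one_alg_closed mul_assoc mul_one_left mul_one_right)
qed (simp_all add: mul.bil_add_left mul.bil_add_right ring_valued_alg)

sublocale stackable_algebras R alg
proof (rule stackable_algebras.intro[OF is_cring stackable_algebras_axioms.intro], goal_cases)
  case 1
  show ?case by (rule ring_alg)
next
  case 2
  show ?case by (rule module_alg)
next
  case (13 d k r)
  then show ?case by (intro trivial_action_scalar' ring_valued_alg)
qed (simp_all add: on_top_bil ring_valued_alg mul.bil_smult_left mul.bil_smult_right top_closed
    top.bil_add_left top.bil_smult_left top_basis_vec id_diagram_D diagram_on_top_id top_mul top_assoc
    one_alg_closed top_0 trivial_action_closed' trivial_action_top_left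
    trivial_action_top_right mul_closed)

end

theorem theorem2p1:
  fixes R :: "('r, 'x) ring_scheme"
    and \<delta> :: 'r
    and A :: "nat \<Rightarrow> ('r, diagram \<Rightarrow> 'r) module"
  assumes "cring R"
    and "\<delta> \<in> carrier R"
    and "A \<in> {temperley_lieb_algebra R \<delta>, brauer_algebra R \<delta>, partition_algebra R \<delta>}"
  shows "\<exists>cmp ident.
    module_enriched_category R (UNIV :: nat set) (cat_hom R A) cmp ident \<and>
    (\<forall>l m n x y r s. l \<le> m \<longrightarrow> m \<le> n \<longrightarrow>
       x \<in> carrier (A n) \<longrightarrow> y \<in> carrier (A m) \<longrightarrow> r \<in> carrier R \<longrightarrow> s \<in> carrier R \<longrightarrow>
       cmp l m n (cat_tensor R A m n x r) (cat_tensor R A l m y s) =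
         cat_tensor R A l n (x \<otimes>\<^bsub>A n\<^esub> on_top R m (n - m) y \<one>\<^bsub>A (n - m)\<^esub>) (r \<otimes>\<^bsub>R\<^esub> s))"
proof -
  interpret cring R by fact
  \<comment> \<open>This identifies the carriers given as spans of basis vectors with free modules
    on diagrams, the shape in which \<open>alg\<close> is defined.\<close>
  have span: "module_span R (partition_algebra R \<delta> n) (basis_vec R ` S) = carrier (free_module R S)"
    if "S \<subseteq> diagrams n" for S n
    using that by (intro module_span_basis[OF assms(1)]) (simp_all add: partition_algebra_def)
  have sub: "brauer_diagrams n \<subseteq> diagrams n" "tl_diagrams n \<subseteq> diagrams n" for n
    by (auto simp: brauer_diagrams_def tl_diagrams_def)
  obtain D where D: "diagram_algebras R \<delta> D" and A: "A = diagram_algebras.alg R \<delta> D"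
  proof -
    consider "A = temperley_lieb_algebra R \<delta>" | "A = brauer_algebra R \<delta>" | "A = partition_algebra R \<delta>"
      using assms(3) by blast
    then show ?thesis
    proof cases
      case 1
      have D: "diagram_algebras R \<delta> tl_diagrams"
        using assms(2) sub by unfold_locales
          (auto simp: id_diagram_tl tl_diagram_comp_closed tl_diagram_on_top_closed)
      have "temperley_lieb_algebra R \<delta> n = diagram_algebras.alg R \<delta> tl_diagrams n" for n
        unfolding temperley_lieb_algebra_def diagram_algebras.alg_def[OF D] span[OF sub(2)] ..
      then show ?thesis using D 1 that by blast
    next
      case 2
      have D: "diagram_algebras R \<delta> brauer_diagrams"
        using assms(2) sub by unfold_locales
          (auto simp: id_diagram_brauer brauer_diagram_comp_closed brauer_diagram_on_top_closed)
      have "brauer_algebra R \<delta> n = diagram_algebras.alg R \<delta> brauer_diagrams n" for n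
        unfolding brauer_algebra_def diagram_algebras.alg_def[OF D] span[OF sub(1)] ..
      then show ?thesis using D 2 that by blast
    next
      case 3
      have D: "diagram_algebras R \<delta> diagrams"
        using assms(2) by unfold_locales
          (auto simp: id_diagram_closed diagram_comp_closed diagram_on_top_closed)
      have "partition_algebra R \<delta> n = diagram_algebras.alg R \<delta> diagrams n" for n
      proof -
        \<comment> \<open>The partition algebra is defined without replacing its carrier, so a
          trivial update is inserted for the comparison with \<open>alg\<close>.\<close>
        have "M = M\<lparr>carrier := carrier M\<rparr>" for M :: "('r, diagram \<Rightarrow> 'r) module" by simp
        moreover have "carrier (partition_algebra R \<delta> n) = carrier (free_module R (diagrams n))"
          by (simp add: partition_algebra_def)
        ultimately show ?thesis unfolding diagram_algebras.alg_def[OF D] by metis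
      qed
      then show ?thesis using D 3 that by blast
    qed
  qed
  interpret diagram_algebras R \<delta> D by (rule D)
  show ?thesis
    unfolding A
    by (intro exI[of _ cat_comp] exI[of _ "\<lambda>n. ten n n \<one>\<^bsub>alg n\<^esub>"] conjI allI impI
        module_enriched_category_cat_hom cat_comp_cat_tensor)
qed

end
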